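(* Let $G$ be a locally compact group and let $m \in \mathrm{LUC}(G)^*$. Suppose that left multiplication by $m$, $n \mapsto m \cdot n$, is $w^*$-$w^*$-continuous on $\overline{\delta_G}^{w^*} \subseteq \mathrm{Ball}(\mathrm{LUC}(G)^* )$, i.e. the map $\overline{\delta_G}^{w^*} \to \mathrm{LUC}(G)^*$, $n \mapsto m\cdot n$, is continuous when $\overline{\delta_G}^{w^*}$ carries the relative weak$^*$ topology and $\mathrm{LUC}(G)^*$ the weak$^*$ topology. Then $m \in \mathrm{M}(G)$.
   Context: $\mathrm{LUC}(G)$ is the Banach space (sup norm) of complex-valued bounded left uniformly continuous functions on $G$, i.e. bounded continuous $f$ such that $x \mapsto l_x f$ is norm continuous, where $(l_x f)(y) = f(xy)$. For $n \in \mathrm{LUC}(G)^*$ and $f \in \mathrm{LUC}(G)$, the function $(n \cdot f)(x) := \langle n, l_x f\rangle$ ($x \in G$) belongs to $\mathrm{LUC}(G)$, and the product on $\mathrm{LUC}(G)^*$ is $\langle m \cdot n, f\rangle := \langle m, n \cdot f\rangle$. The weak$^*$ topology on $\mathrm{LUC}(G)^*$ is $\sigma(\mathrm{LUC}(G)^*, \mathrm{LUC}(G))$. For $x \in G$, $\delta_x \in \mathrm{LUC}(G)^*$ is evaluation at $x$; $\delta_G = \{\delta_x : x \in G\}$, and $\overline{\delta_G}^{w^*}$ is its weak$^*$ closure in $\mathrm{LUC}(G)^*$. $\mathrm{Ball}$ denotes the closed unit ball. $\mathrm{M}(G)$ is the algebra of bounded complex regular Borel measures on $G$, regarded as a subspace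 of $\mathrm{LUC}(G)^*$ via $\langle \mu, f\rangle = \int_G f \, d\mu$. *)

theory Defs
  imports "HOL-Analysis.Analysis"
begin

text \<open>
  Groups are written additively, because that is how the library class
  \<^class>\<open>topological_group_add\<close> is set up; the class does not assume commutativity.
  So \<open>x + y\<close> below is the group product \<open>xy\<close>.  Locally compact groups are Hausdorff
  (\<^class>\<open>t2_space\<close>); local compactness is an explicit hypothesis of the theorem.
\<close>


section \<open>The space \<open>LUC(G)\<close>\<close>

text \<open>
  The type \<open>'a \<Rightarrow>\<^sub>C complex\<close> carries the supremum norm, but the library only gives it
  the structure of a real vector space, hence the separate complex scaling.
\<close>

definition cscale :: "complex \<Rightarrow> ('a::topological_space \<Rightarrow>\<^sub>C complex) \<Rightarrow> ('a \<Rightarrow>\<^sub>C complex)"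
  where "cscale c f = Bcontfun (\<lambda>x. c * f x)"

definition ltrans :: "'a::topological_group_add \<Rightarrow> ('a \<Rightarrow>\<^sub>C complex) \<Rightarrow> ('a \<Rightarrow>\<^sub>C complex)"
  where "ltrans x f = Bcontfun (\<lambda>y. f (x + y))"

definition LUC :: "('a::topological_group_add \<Rightarrow>\<^sub>C complex) set"
  where "LUC = {f. continuous_on UNIV (\<lambda>x. ltrans x f)}"

lemma apply_cscale [simp]: "cscale c f x = c * f x"
proof -
  have "(\<lambda>x. c * f x) \<in> bcontfun"
    by (rule bcontfun_normI[where b = "norm c * norm f"])
       (simp_all add: continuous_on_mult_left norm_mult mult_left_mono norm_bounded)
  then show ?thesis by (simp add: cscale_def Bcontfun_inverse)
qed

lemma apply_ltrans [simp]: "ltrans x f y = f (x + y)"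
proof -
  have "continuous_on UNIV (\<lambda>y. x + y)"
    by (intro continuous_intros)
  then have "continuous_on UNIV (\<lambda>y. f (x + y))"
    by (rule continuous_on_compose2[OF continuous_on_apply_bcontfun[of UNIV]]) simp
  then have "(\<lambda>y. f (x + y)) \<in> bcontfun"
    by (rule bcontfun_normI[where b = "norm f"]) (rule norm_bounded)
  then show ?thesis by (simp add: ltrans_def Bcontfun_inverse)
qed

lemma ltrans_ltrans: "ltrans y (ltrans x f) = ltrans (x + y) f"
  by (rule bcontfun_eqI) (simp add: add.assoc)

lemma ltrans_add: "ltrans x (f + g) = ltrans x f + ltrans x g"
  by (rule bcontfun_eqI) simp

lemma ltrans_cscale: "ltrans x (cscale c f) = cscale c (ltrans x f)"
  by (rule bcontfun_eqI) simp

lemma norm_ltrans_le: "norm (ltrans x f) \<le> norm f"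
  by (rule norm_bound) (simp add: norm_bounded)

lemma norm_cscale_le: "norm (cscale c f) \<le> norm c * norm f"
  by (rule norm_bound) (simp add: norm_mult mult_left_mono norm_bounded)

lemma LUC_ltrans:
  assumes "f \<in> LUC"
  shows "ltrans x f \<in> LUC"
proof -
  have "continuous_on UNIV (\<lambda>y. x + y)"
    by (intro continuous_intros)
  then have "continuous_on UNIV (\<lambda>y. ltrans (x + y) f)"
    by (rule continuous_on_compose2[rotated, of _ _ UNIV "\<lambda>x. ltrans x f"])
       (use assms in \<open>simp_all add: LUC_def\<close>)
  then show ?thesis by (simp add: LUC_def ltrans_ltrans)
qed

lemma LUC_add: "f \<in> LUC \<Longrightarrow> g \<in> LUC \<Longrightarrow> f + g \<in> LUC"
  by (simp add: LUC_def ltrans_add continuous_on_add)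

lemma LUC_cscale:
  assumes "f \<in> LUC"
  shows "cscale c f \<in> LUC"
proof -
  have "bounded_linear (cscale c :: ('a \<Rightarrow>\<^sub>C complex) \<Rightarrow> _)"
  proof (rule bounded_linear_intro[where K = "norm c"])
    show "norm (cscale c f) \<le> norm f * norm c" for f :: "'a \<Rightarrow>\<^sub>C complex"
      using norm_cscale_le[of c f] by (simp add: mult.commute)
  qed (rule bcontfun_eqI, simp add: algebra_simps)+
  from bounded_linear.continuous_on[OF this, of UNIV "\<lambda>x. ltrans x f"] show ?thesis
    using assms by (simp add: LUC_def ltrans_cscale)
qed


section \<open>The dual algebra \<open>LUC(G)\<^sup>*\<close>\<close>

text \<open>
  Functionals are extensional functions on \<^const>\<open>LUC\<close> (\<^const>\<open>undefined\<close> elsewhere), so that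
  equality of functionals is equality of functions.
\<close>

definition LUC_dual :: "(('a::topological_group_add \<Rightarrow>\<^sub>C complex) \<Rightarrow> complex) set"
  where "LUC_dual = {m \<in> extensional LUC.
    (\<forall>f\<in>LUC. \<forall>g\<in>LUC. m (f + g) = m f + m g) \<and>
    (\<forall>c. \<forall>f\<in>LUC. m (cscale c f) = c * m f) \<and>
    (\<exists>C. \<forall>f\<in>LUC. norm (m f) \<le> C * norm f)}"

text \<open>
  The weak-star topology: the topology of pointwise convergence on \<^const>\<open>LUC\<close>.
\<close>

definition weak_star :: "(('a::topological_group_add \<Rightarrow>\<^sub>C complex) \<Rightarrow> complex) topology"
  where "weak_star = subtopology (product_topology (\<lambda>f. euclidean) LUC) LUC_dual"

definition point_eval :: "'a::topological_group_add \<Rightarrow> ('a \<Rightarrow>\<^sub>C complex) \<Rightarrow> complex"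
  where "point_eval x = restrict (\<lambda>f. apply_bcontfun f x) LUC"

definition dual_act ::
  "(('a::topological_group_add \<Rightarrow>\<^sub>C complex) \<Rightarrow> complex) \<Rightarrow> ('a \<Rightarrow>\<^sub>C complex) \<Rightarrow> ('a \<Rightarrow>\<^sub>C complex)"
  where "dual_act n f = Bcontfun (\<lambda>x. n (ltrans x f))"

definition dual_mult ::
  "(('a::topological_group_add \<Rightarrow>\<^sub>C complex) \<Rightarrow> complex) \<Rightarrow> (('a \<Rightarrow>\<^sub>C complex) \<Rightarrow> complex)
    \<Rightarrow> ('a \<Rightarrow>\<^sub>C complex) \<Rightarrow> complex"
  where "dual_mult m n = restrict (\<lambda>f. m (dual_act n f)) LUC"

lemma topspace_weak_star [simp]: "topspace weak_star = LUC_dual"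
  by (auto simp: weak_star_def LUC_dual_def PiE_def)

lemma LUC_dual_add: "m \<in> LUC_dual \<Longrightarrow> f \<in> LUC \<Longrightarrow> g \<in> LUC \<Longrightarrow> m (f + g) = m f + m g"
  by (simp add: LUC_dual_def)

lemma LUC_dual_cscale: "m \<in> LUC_dual \<Longrightarrow> f \<in> LUC \<Longrightarrow> m (cscale c f) = c * m f"
  by (simp add: LUC_dual_def)

lemma LUC_dual_bound:
  assumes "m \<in> LUC_dual"
  obtains C where "C \<ge> 0" "\<And>f. f \<in> LUC \<Longrightarrow> norm (m f) \<le> C * norm f"
proof -
  obtain C where C: "\<And>f. f \<in> LUC \<Longrightarrow> norm (m f) \<le> C * norm f"
    using assms unfolding LUC_dual_def by blast
  have "norm (m f) \<le> \<bar>C\<bar> * norm f" if "f \<in> LUC" for f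
    using C[OF that] by (meson abs_ge_self mult_right_mono norm_ge_zero order_trans)
  then show thesis by (intro that[of "\<bar>C\<bar>"]) auto
qed

lemma LUC_dual_diff:
  assumes "m \<in> LUC_dual" "f \<in> LUC" "g \<in> LUC"
  shows "f - g \<in> LUC" "m (f - g) = m f - m g"
proof -
  have eq: "f - g = f + cscale (-1) g"
    by (rule bcontfun_eqI) simp
  show "f - g \<in> LUC"
    unfolding eq by (intro LUC_add LUC_cscale assms)
  have "m (f + cscale (-1) g) = m f + m (cscale (-1) g)"
    by (intro LUC_dual_add LUC_cscale assms)
  also have "m (cscale (-1) g) = - m g"
    by (simp add: LUC_dual_cscale assms)
  finally show "m (f - g) = m f - m g" by (simp add: eq)
qed

lemma point_eval_in_LUC_dual: "point_eval x \<in> LUC_dual"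
  by (auto simp: point_eval_def LUC_dual_def LUC_add LUC_cscale norm_bounded
        intro!: exI[of _ 1])

lemma apply_dual_act:
  assumes n: "n \<in> LUC_dual" and f: "f \<in> LUC"
  shows "dual_act n f x = n (ltrans x f)"
proof -
  obtain C where C: "C \<ge> 0" "\<And>f. f \<in> LUC \<Longrightarrow> norm (n f) \<le> C * norm f"
    by (rule LUC_dual_bound[OF n]) blast
  have "continuous_on UNIV (\<lambda>x. n (ltrans x f))"
    unfolding continuous_on_def
  proof (intro ballI)
    fix a :: 'a
    have "((\<lambda>x. ltrans x f) \<longlongrightarrow> ltrans a f) (at a)"
      using f by (auto simp: LUC_def continuous_on_def)
    then have "((\<lambda>x. norm (ltrans x f - ltrans a f)) \<longlongrightarrow> 0) (at a)"
      by (intro tendsto_norm_zero LIM_zero)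
    then have lim: "((\<lambda>x. C * norm (ltrans x f - ltrans a f)) \<longlongrightarrow> 0) (at a)"
      by (rule tendsto_mult_right_zero)
    have "norm (n (ltrans x f) - n (ltrans a f)) \<le> C * norm (ltrans x f - ltrans a f)" for x
      using C(2)[of "ltrans x f - ltrans a f"] LUC_dual_diff[OF n LUC_ltrans LUC_ltrans, OF f f]
      by simp
    then have "((\<lambda>x. n (ltrans x f) - n (ltrans a f)) \<longlongrightarrow> 0) (at a)"
      by (intro Lim_null_comparison[OF _ lim] always_eventually allI)
    then show "((\<lambda>x. n (ltrans x f)) \<longlongrightarrow> n (ltrans a f)) (at a)"
      by (rule LIM_zero_cancel)
  qed
  moreover have "norm (n (ltrans x f)) \<le> C * norm f" for x
    using C(2)[OF LUC_ltrans[OF f]] mult_left_mono[OF norm_ltrans_le C(1)] order_trans by blast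
  ultimately have "(\<lambda>x. n (ltrans x f)) \<in> bcontfun"
    by (rule bcontfun_normI)
  then show ?thesis by (simp add: dual_act_def Bcontfun_inverse)
qed

lemma ltrans_dual_act:
  assumes "n \<in> LUC_dual" and "f \<in> LUC"
  shows "ltrans x (dual_act n f) = dual_act n (ltrans x f)"
  by (rule bcontfun_eqI) (simp add: assms LUC_ltrans apply_dual_act ltrans_ltrans)

lemma norm_dual_act_le:
  assumes "n \<in> LUC_dual"
  obtains C where "C \<ge> 0" "\<And>f. f \<in> LUC \<Longrightarrow> norm (dual_act n f) \<le> C * norm f"
proof -
  obtain C where C: "C \<ge> 0" "\<And>f. f \<in> LUC \<Longrightarrow> norm (n f) \<le> C * norm f"
    by (rule LUC_dual_bound[OF assms]) blast
  have "norm (dual_act n f) \<le> C * norm f" if f: "f \<in> LUC" for f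
  proof (rule norm_bound)
    show "norm (dual_act n f x) \<le> C * norm f" for x
      using C(2)[OF LUC_ltrans[OF f], of x] mult_left_mono[OF norm_ltrans_le C(1), of x f]
      by (simp add: apply_dual_act assms f)
  qed
  with C(1) show thesis by (rule that)
qed

lemma dual_act_diff:
  assumes "n \<in> LUC_dual" "f \<in> LUC" "g \<in> LUC"
  shows "dual_act n f - dual_act n g = dual_act n (f - g)"
proof (rule bcontfun_eqI)
  fix x
  have "ltrans x (f - g) = ltrans x f - ltrans x g"
    by (rule bcontfun_eqI) simp
  then show "(dual_act n f - dual_act n g) x = dual_act n (f - g) x"
    using assms by (simp add: apply_dual_act LUC_dual_diff LUC_ltrans)
qed

lemma dual_act_in_LUC:
  assumes n: "n \<in> LUC_dual" and f: "f \<in> LUC"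
  shows "dual_act n f \<in> LUC"
proof -
  obtain C where C: "C \<ge> 0" "\<And>f. f \<in> LUC \<Longrightarrow> norm (dual_act n f) \<le> C * norm f"
    by (rule norm_dual_act_le[OF n]) blast
  have "continuous_on UNIV (\<lambda>x. dual_act n (ltrans x f))"
    unfolding continuous_on_def
  proof (intro ballI)
    fix a :: 'a
    have "((\<lambda>x. ltrans x f) \<longlongrightarrow> ltrans a f) (at a)"
      using f by (auto simp: LUC_def continuous_on_def)
    then have "((\<lambda>x. norm (ltrans x f - ltrans a f)) \<longlongrightarrow> 0) (at a)"
      by (intro tendsto_norm_zero LIM_zero)
    then have lim: "((\<lambda>x. C * norm (ltrans x f - ltrans a f)) \<longlongrightarrow> 0) (at a)"
      by (rule tendsto_mult_right_zero)
    have "norm (dual_act n (ltrans x f) - dual_act n (ltrans a f))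
        \<le> C * norm (ltrans x f - ltrans a f)" for x
      using C(2)[of "ltrans x f - ltrans a f"] dual_act_diff[OF n LUC_ltrans LUC_ltrans, OF f f]
        LUC_dual_diff(1)[OF n LUC_ltrans LUC_ltrans, OF f f]
      by simp
    then have "((\<lambda>x. dual_act n (ltrans x f) - dual_act n (ltrans a f)) \<longlongrightarrow> 0) (at a)"
      by (intro Lim_null_comparison[OF _ lim] always_eventually allI)
    then show "((\<lambda>x. dual_act n (ltrans x f)) \<longlongrightarrow> dual_act n (ltrans a f)) (at a)"
      by (rule LIM_zero_cancel)
  qed
  then show ?thesis by (simp add: LUC_def ltrans_dual_act[OF n f])
qed

lemma dual_mult_in_LUC_dual:
  assumes m: "m \<in> LUC_dual" and n: "n \<in> LUC_dual"
  shows "dual_mult m n \<in> LUC_dual"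
proof -
  have add: "dual_act n (f + g) = dual_act n f + dual_act n g" if "f \<in> LUC" "g \<in> LUC" for f g
    using that n by (intro bcontfun_eqI)
      (simp add: apply_dual_act LUC_add ltrans_add LUC_ltrans LUC_dual_add)
  have scale: "dual_act n (cscale c f) = cscale c (dual_act n f)" if "f \<in> LUC" for c f
    using that n by (intro bcontfun_eqI)
      (simp add: apply_dual_act LUC_cscale ltrans_cscale LUC_ltrans LUC_dual_cscale)
  obtain C where C: "C \<ge> 0" "\<And>f. f \<in> LUC \<Longrightarrow> norm (m f) \<le> C * norm f"
    by (rule LUC_dual_bound[OF m]) blast
  obtain D where D: "D \<ge> 0" "\<And>f. f \<in> LUC \<Longrightarrow> norm (dual_act n f) \<le> D * norm f"
    by (rule norm_dual_act_le[OF n]) blast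
  have "norm (m (dual_act n f)) \<le> (C * D) * norm f" if "f \<in> LUC" for f
    using C(2)[OF dual_act_in_LUC[OF n that]] mult_left_mono[OF D(2)[OF that] C(1)]
    by (simp add: mult.assoc)
  then have "\<forall>f\<in>LUC. norm (dual_mult m n f) \<le> (C * D) * norm f"
    by (simp add: dual_mult_def)
  then have "\<exists>C. \<forall>f\<in>LUC. norm (dual_mult m n f) \<le> C * norm f" ..
  then show ?thesis
    by (simp add: LUC_dual_def)
       (simp add: dual_mult_def LUC_add LUC_cscale add scale dual_act_in_LUC[OF n]
          LUC_dual_add[OF m] LUC_dual_cscale[OF m])
qed


section \<open>Complex measures and \<open>M(G)\<close>\<close>

text \<open>
  A complex measure is a set function, of which only the values on \<^term>\<open>sets M\<close> matter;
  countable additivity includes \<open>\<mu> {} = 0\<close>.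
\<close>

definition complex_measure :: "'a measure \<Rightarrow> ('a set \<Rightarrow> complex) \<Rightarrow> bool"
  where "complex_measure M \<mu> \<longleftrightarrow>
    (\<forall>A::nat \<Rightarrow> 'a set. range A \<subseteq> sets M \<longrightarrow> disjoint_family A \<longrightarrow>
      (\<lambda>i. \<mu> (A i)) sums \<mu> (\<Union>i. A i))"

definition total_variation :: "'a measure \<Rightarrow> ('a set \<Rightarrow> complex) \<Rightarrow> 'a set \<Rightarrow> ennreal"
  where "total_variation M \<mu> A =
    (SUP P \<in> {P. finite P \<and> P \<subseteq> sets M \<and> disjoint P \<and> \<Union>P = A}.
      \<Sum>E\<in>P. ennreal (norm (\<mu> E)))"

definition regular_borel :: "('a::topological_space set \<Rightarrow> complex) \<Rightarrow> bool"
  where "regular_borel \<mu> \<longleftrightarrow>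
    (\<forall>A \<in> sets borel.
      total_variation borel \<mu> A = (INF U \<in> {U. open U \<and> A \<subseteq> U}. total_variation borel \<mu> U) \<and>
      total_variation borel \<mu> A = (SUP K \<in> {K. compact K \<and> K \<subseteq> A}. total_variation borel \<mu> K))"

text \<open>
  For a real-valued countably additive \<open>\<nu>\<close> this is the positive part \<open>\<nu>\<^sup>+\<close> of the Jordan
  decomposition; the negative part is the positive part of \<open>-\<nu>\<close>.  Negative values of \<open>\<nu>\<close>
  are cut off by \<^const>\<open>ennreal\<close>, harmlessly because of the competitor \<open>B = {}\<close>.
\<close>

definition positive_part :: "'a measure \<Rightarrow> ('a set \<Rightarrow> real) \<Rightarrow> 'a measure"
  where "positive_part M \<nu> = measure_of (space M) (sets M)
    (\<lambda>A. SUP B \<in> {B \<in> sets M. B \<subseteq> A}. ennreal (\<nu> B))"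

definition signed_integral :: "'a measure \<Rightarrow> ('a set \<Rightarrow> real) \<Rightarrow> ('a \<Rightarrow> complex) \<Rightarrow> complex"
  where "signed_integral M \<nu> f =
    integral\<^sup>L (positive_part M \<nu>) f - integral\<^sup>L (positive_part M (\<lambda>A. - \<nu> A)) f"

definition complex_measure_integral ::
  "'a measure \<Rightarrow> ('a set \<Rightarrow> complex) \<Rightarrow> ('a \<Rightarrow> complex) \<Rightarrow> complex"
  where "complex_measure_integral M \<mu> f =
    signed_integral M (\<lambda>A. Re (\<mu> A)) f + \<i> * signed_integral M (\<lambda>A. Im (\<mu> A)) f"

definition regular_complex_borel_measure :: "('a::topological_space set \<Rightarrow> complex) \<Rightarrow> bool"
  where "regular_complex_borel_measure \<mu> \<longleftrightarrow>
    complex_measure borel \<mu> \<and> total_variation borel \<mu> UNIV < \<infinity> \<and> regular_borel \<mu>"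

definition measure_functional ::
  "('a::topological_group_add set \<Rightarrow> complex) \<Rightarrow> ('a \<Rightarrow>\<^sub>C complex) \<Rightarrow> complex"
  where "measure_functional \<mu> = restrict (\<lambda>f. complex_measure_integral borel \<mu> (apply_bcontfun f)) LUC"

definition M_G :: "(('a::topological_group_add \<Rightarrow>\<^sub>C complex) \<Rightarrow> complex) set"
  where "M_G = {measure_functional \<mu> | \<mu>. regular_complex_borel_measure \<mu>}"

text \<open>
  \<^const>\<open>measure_of\<close> yields the zero measure if the given set function is not countably
  additive.  The following lemmas show that this does not happen in \<^const>\<open>positive_part\<close>,
  and that the Jordan decomposition recovers \<open>\<nu>\<close>.
\<close>

lemma countably_additive_union:
  fixes \<nu> :: "'a set \<Rightarrow> real"
  assumes \<nu>: "\<And>A::nat \<Rightarrow> 'a set. range A \<subseteq> sets M \<Longrightarrow> disjoint_family A \<Longrightarrow>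
      (\<lambda>i. \<nu> (A i)) sums \<nu> (\<Union>i. A i)"
  shows "\<nu> {} = 0"
    and "A \<in> sets M \<Longrightarrow> B \<in> sets M \<Longrightarrow> A \<inter> B = {} \<Longrightarrow> \<nu> (A \<union> B) = \<nu> A + \<nu> B"
proof -
  have "(\<lambda>i::nat. \<nu> {}) sums \<nu> {}"
    using \<nu>[of "\<lambda>_. {}"] by (simp add: disjoint_family_on_def)
  then have "(\<lambda>i::nat. \<nu> {}) \<longlonglongrightarrow> 0"
    by (intro summable_LIMSEQ_zero) (rule sums_summable)
  then show empty: "\<nu> {} = 0"
    by (simp add: LIMSEQ_const_iff)
  assume AB: "A \<in> sets M" "B \<in> sets M" "A \<inter> B = {}"
  have "disjoint_family (binaryset A B)"
    using AB(3) by (auto simp: disjoint_family_on_def binaryset_def)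
  then have "(\<lambda>i. \<nu> (binaryset A B i)) sums \<nu> (A \<union> B)"
    using \<nu>[of "binaryset A B"] AB by (simp add: range_binaryset_eq UN_binaryset_eq)
  moreover have "(\<lambda>i. \<nu> (binaryset A B i)) sums (\<nu> A + \<nu> B)"
    by (rule binaryset_sums) (rule empty)
  ultimately show "\<nu> (A \<union> B) = \<nu> A + \<nu> B"
    by (rule sums_unique2)
qed

lemma emeasure_positive_part:
  fixes \<nu> :: "'a set \<Rightarrow> real"
  assumes \<nu>: "\<And>A::nat \<Rightarrow> 'a set. range A \<subseteq> sets M \<Longrightarrow> disjoint_family A \<Longrightarrow>
      (\<lambda>i. \<nu> (A i)) sums \<nu> (\<Union>i. A i)"
    and A: "A \<in> sets M"
  shows "emeasure (positive_part M \<nu>) A = (SUP B \<in> {B \<in> sets M. B \<subseteq> A}. ennreal (\<nu> B))"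
proof -
  define S where "S A = (SUP B \<in> {B \<in> sets M. B \<subseteq> A}. ennreal (\<nu> B))" for A
  have upper: "ennreal (\<nu> B) \<le> S A" if "B \<in> sets M" "B \<subseteq> A" for A B
    unfolding S_def by (rule SUP_upper) (use that in auto)
  have mono: "S A \<le> S B" if "A \<subseteq> B" for A B
    unfolding S_def by (rule SUP_subset_mono) (use that in auto)
  have S_empty: "S {} = 0"
  proof -
    have "{B \<in> sets M. B \<subseteq> {}} = {{}}" by auto
    then show ?thesis using countably_additive_union(1)[OF \<nu>] by (simp add: S_def)
  qed
  have super: "S A + S B \<le> S (A \<union> B)" if "A \<inter> B = {}" for A B
  proof -
    have "ennreal (\<nu> C) + ennreal (\<nu> D) \<le> S (A \<union> B)"
      if C: "C \<in> sets M" "C \<subseteq> A" and D: "D \<in> sets M" "D \<subseteq> B" for C D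
    proof -
      have CD: "\<nu> (C \<union> D) = \<nu> C + \<nu> D"
        by (rule countably_additive_union(2)[OF \<nu>]) (use C D \<open>A \<inter> B = {}\<close> in auto)
      have "ennreal (\<nu> C) \<le> S (A \<union> B)" "ennreal (\<nu> D) \<le> S (A \<union> B)"
        "ennreal (\<nu> (C \<union> D)) \<le> S (A \<union> B)"
        by (rule upper; use C D in auto)+
      then show ?thesis
        by (cases "\<nu> C \<ge> 0"; cases "\<nu> D \<ge> 0") (auto simp: CD ennreal_neg)
    qed
    then have "ennreal (\<nu> C) + S B \<le> S (A \<union> B)" if "C \<in> sets M" "C \<subseteq> A" for C
      using that unfolding S_def[of B]
      by (subst ennreal_SUP_add_right) (auto intro!: SUP_least exI[of _ "{}"])
    then show ?thesis
      unfolding S_def[of A]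
      by (subst ennreal_SUP_add_left[symmetric]) (auto intro!: SUP_least exI[of _ "{}"])
  qed
  have "countably_additive (sets M) S"
  proof (rule countably_additiveI)
    fix A :: "nat \<Rightarrow> 'a set"
    assume A: "range A \<subseteq> sets M" "disjoint_family A"
    show "(\<Sum>i. S (A i)) = S (\<Union>i. A i)"
    proof (rule antisym)
      have "(\<Sum>i<n. S (A i)) \<le> S (\<Union>i<n. A i)" for n
      proof (induction n)
        case (Suc n)
        have "(\<Union>i<n. A i) \<inter> A n = {}"
          using A(2) by (auto simp: disjoint_family_on_def dest: less_imp_neq)
        then have "S (\<Union>i<n. A i) + S (A n) \<le> S ((\<Union>i<n. A i) \<union> A n)"
          by (rule super)
        moreover have "(\<Union>i<n. A i) \<union> A n = (\<Union>i<Suc n. A i)"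
          by (auto simp: less_Suc_eq)
        ultimately have "S (\<Union>i<n. A i) + S (A n) \<le> S (\<Union>i<Suc n. A i)"
          by metis
        with add_right_mono[OF Suc.IH, of "S (A n)"] show ?case
          unfolding sum.lessThan_Suc by (rule order_trans)
      qed (simp add: S_empty)
      moreover have "S (\<Union>i<n. A i) \<le> S (\<Union>i. A i)" for n
        by (rule mono) auto
      ultimately show "(\<Sum>i. S (A i)) \<le> S (\<Union>i. A i)"
        by (intro suminf_le_const) (auto intro: order_trans)
      show "S (\<Union>i. A i) \<le> (\<Sum>i. S (A i))"
        unfolding S_def[of "\<Union>i. A i"]
      proof (rule SUP_least, clarsimp)
        fix B assume B: "B \<in> sets M" "B \<subseteq> (\<Union>i. A i)"
        have "(\<lambda>i. \<nu> (B \<inter> A i)) sums \<nu> (\<Union>i. B \<inter> A i)"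
          by (rule \<nu>) (use A B in \<open>auto simp: disjoint_family_on_def\<close>)
        moreover have "(\<Union>i. B \<inter> A i) = B" using B by auto
        ultimately have "(\<lambda>n. \<Sum>i<n. \<nu> (B \<inter> A i)) \<longlonglongrightarrow> \<nu> B"
          by (simp add: sums_def)
        then have lim: "(\<lambda>n. ennreal (\<Sum>i<n. \<nu> (B \<inter> A i))) \<longlonglongrightarrow> ennreal (\<nu> B)"
          by (rule tendsto_ennrealI)
        have "ennreal (\<Sum>i<n. \<nu> (B \<inter> A i)) \<le> (\<Sum>i. S (A i))" for n
        proof -
          have "ennreal (\<Sum>i<n. \<nu> (B \<inter> A i)) \<le> ennreal (\<Sum>i<n. max 0 (\<nu> (B \<inter> A i)))"
            by (intro ennreal_leI sum_mono) auto
          also have "\<dots> = (\<Sum>i<n. ennreal (max 0 (\<nu> (B \<inter> A i))))"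
            by (subst sum_ennreal) auto
          also have "\<dots> \<le> (\<Sum>i<n. S (A i))"
          proof (rule sum_mono)
            fix i
            have "ennreal (\<nu> (B \<inter> A i)) \<le> S (A i)"
              by (rule upper) (use A B in auto)
            then show "ennreal (max 0 (\<nu> (B \<inter> A i))) \<le> S (A i)"
              by (simp add: max_def)
          qed
          also have "\<dots> \<le> (\<Sum>i. S (A i))"
            by (rule sum_le_suminf) auto
          finally show ?thesis .
        qed
        with lim show "ennreal (\<nu> B) \<le> (\<Sum>i. S (A i))"
          by (intro LIMSEQ_le_const2) auto
      qed
    qed
  qed
  moreover have "positive (sets M) S"
    by (simp add: positive_def S_empty)
  ultimately have "emeasure (measure_of (space M) (sets M) S) A = S A"
    using A by (intro emeasure_measure_of_sigma) (auto simp: sets.sigma_algebra_axioms)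
  then show ?thesis by (simp add: positive_part_def S_def[abs_def])
qed

lemma jordan_decomposition:
  fixes \<nu> :: "'a set \<Rightarrow> real"
  assumes \<nu>: "\<And>A::nat \<Rightarrow> 'a set. range A \<subseteq> sets M \<Longrightarrow> disjoint_family A \<Longrightarrow>
      (\<lambda>i. \<nu> (A i)) sums \<nu> (\<Union>i. A i)"
    and bd: "\<And>A. A \<in> sets M \<Longrightarrow> \<bar>\<nu> A\<bar> \<le> C"
    and A: "A \<in> sets M"
  shows "\<nu> A = measure (positive_part M \<nu>) A - measure (positive_part M (\<lambda>A. - \<nu> A)) A"
proof -
  have neg: "(\<lambda>i. - \<nu> (A i)) sums - \<nu> (\<Union>i. A i)"
    if "range A \<subseteq> sets M" "disjoint_family A" for A :: "nat \<Rightarrow> 'a set"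
    using \<nu>[OF that] by (rule sums_minus)
  let ?I = "{B \<in> sets M. B \<subseteq> A}"
  have val: "measure (positive_part M \<rho>) A = (SUP B\<in>?I. \<rho> B) \<and> bdd_above (\<rho> ` ?I)"
    if \<rho>: "\<And>A::nat \<Rightarrow> 'a set. range A \<subseteq> sets M \<Longrightarrow> disjoint_family A \<Longrightarrow>
      (\<lambda>i. \<rho> (A i)) sums \<rho> (\<Union>i. A i)"
    and b: "\<And>A. A \<in> sets M \<Longrightarrow> \<bar>\<rho> A\<bar> \<le> C" for \<rho> :: "'a set \<Rightarrow> real"
  proof -
    have bdd: "bdd_above (\<rho> ` ?I)"
      using b by (intro bdd_aboveI[of _ C]) (auto simp: abs_le_iff)
    have nonneg: "0 \<le> (SUP B\<in>?I. \<rho> B)"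
      using cSUP_upper[OF _ bdd, of "{}"] countably_additive_union(1)[OF \<rho>] by auto
    have "(SUP B\<in>?I. ennreal (\<rho> B)) = ennreal (SUP B\<in>?I. \<rho> B)"
    proof (rule antisym)
      show "(SUP B\<in>?I. ennreal (\<rho> B)) \<le> ennreal (SUP B\<in>?I. \<rho> B)"
        by (rule SUP_least) (intro ennreal_leI cSUP_upper bdd)
      have "(SUP B\<in>?I. ennreal (\<rho> B)) \<le> ennreal C"
        using b by (intro SUP_least ennreal_leI) (auto simp: abs_le_iff)
      then have fin: "(SUP B\<in>?I. ennreal (\<rho> B)) < \<infinity>"
        using le_less_trans by fastforce
      have "(SUP B\<in>?I. \<rho> B) \<le> enn2real (SUP B\<in>?I. ennreal (\<rho> B))"
      proof (rule cSUP_least)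
        fix B assume B: "B \<in> ?I"
        have "ennreal (\<rho> B) \<le> (SUP B\<in>?I. ennreal (\<rho> B))"
          by (rule SUP_upper[OF B])
        then have "enn2real (ennreal (\<rho> B)) \<le> enn2real (SUP B\<in>?I. ennreal (\<rho> B))"
          using fin by (intro enn2real_mono) auto
        then show "\<rho> B \<le> enn2real (SUP B\<in>?I. ennreal (\<rho> B))"
          by (cases "\<rho> B \<ge> 0") (auto intro: order_trans[OF _ enn2real_nonneg])
      qed auto
      then have "ennreal (SUP B\<in>?I. \<rho> B) \<le> ennreal (enn2real (SUP B\<in>?I. ennreal (\<rho> B)))"
        by (rule ennreal_leI)
      also have "\<dots> = (SUP B\<in>?I. ennreal (\<rho> B))"
        by (rule ennreal_enn2real) (use fin in simp)
      finally show "ennreal (SUP B\<in>?I. \<rho> B) \<le> (SUP B\<in>?I. ennreal (\<rho> B))" .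
    qed
    then have "measure (positive_part M \<rho>) A = (SUP B\<in>?I. \<rho> B)"
      using nonneg by (simp add: measure_def emeasure_positive_part[OF \<rho> A])
    with bdd show ?thesis by simp
  qed
  have pos: "measure (positive_part M \<nu>) A = (SUP B\<in>?I. \<nu> B)" "bdd_above (\<nu> ` ?I)"
    using val[of \<nu>, OF \<nu> bd] by auto
  have ngt: "measure (positive_part M (\<lambda>A. - \<nu> A)) A = (SUP B\<in>?I. - \<nu> B)"
    "bdd_above ((\<lambda>B. - \<nu> B) ` ?I)"
    using val[of "\<lambda>A. - \<nu> A", OF neg] bd by auto
  have diff: "\<nu> A = \<nu> B + \<nu> (A - B)" if "B \<in> ?I" for B
    using countably_additive_union(2)[of M \<nu> B "A - B", OF \<nu>] that A
    by (auto simp: Un_absorb1)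
  have "(SUP B\<in>?I. \<nu> B) \<le> \<nu> A + (SUP B\<in>?I. - \<nu> B)"
  proof (rule cSUP_least)
    fix B assume B: "B \<in> ?I"
    have "- \<nu> (A - B) \<le> (SUP B\<in>?I. - \<nu> B)"
      by (rule cSUP_upper[OF _ ngt(2)]) (use A B in auto)
    then show "\<nu> B \<le> \<nu> A + (SUP B\<in>?I. - \<nu> B)"
      using diff[OF B] by simp
  qed auto
  moreover have "(SUP B\<in>?I. - \<nu> B) \<le> (SUP B\<in>?I. \<nu> B) - \<nu> A"
  proof (rule cSUP_least)
    fix B assume B: "B \<in> ?I"
    have "\<nu> (A - B) \<le> (SUP B\<in>?I. \<nu> B)"
      by (rule cSUP_upper[OF _ pos(2)]) (use A B in auto)
    then show "- \<nu> B \<le> (SUP B\<in>?I. \<nu> B) - \<nu> A"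
      using diff[OF B] by simp
  qed auto
  ultimately show ?thesis using pos(1) ngt(1) by simp
qed

end

theory Submission
  imports Defs
begin

text \<open>
  Write \<open>R\<^sub>x h = \<delta>\<^sub>x \<cdot> h\<close>, so that \<open>R\<^sub>x h (y) = h (y + x)\<close>.  The weak-star closure of the point
  evaluations is compact, so the hypothesis makes \<open>m\<close> continuous for pointwise convergence on the
  orbit \<open>{R\<^sub>x h}\<close> of any single \<open>h \<in> LUC\<close>, including its limits in \<open>LUC\<close>.

  Given \<open>f \<in> LUC\<close>, let \<open>u\<^sub>F\<close> be compactly supported cut-off functions increasing to \<open>1\<close>, indexed by
  the finite subsets \<open>F\<close> of a set \<open>D\<close> of least cardinality whose translates of a fixed neighbourhood
  of \<open>0\<close> cover the group.  If \<open>D\<close> is infinite, fewer than \<open>|D|\<close> compact sets never cover the group,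
  so transfinite recursion yields points \<open>a (F, L)\<close> by which the functions \<open>f (1 - u\<^sub>F) u\<^sub>L\<close> can be
  translated to have uniformly separated supports; their sum \<open>h\<close> is in \<open>LUC\<close>.  Letting first \<open>L\<close> and
  then \<open>F\<close> grow inside the orbit of this one \<open>h\<close> gives \<open>m (f (1 - u\<^sub>F)) \<longlonglongrightarrow> m 0 = 0\<close>.  So \<open>m f\<close> is the
  limit of \<open>m (f u\<^sub>F)\<close>, and on compactly supported functions \<open>m\<close> is a regular measure by the Riesz
  representation theorem.
\<close>

text \<open>The hypothesis yields limits only along nets that stay in the orbit of a single
  function. The tails \<open>f (1 - u_F)\<close> for varying \<open>F\<close> do not form such a
  net, and in general they are not compactly supported, so they cannot themselves be placed at
  disjoint positions; only their compact pieces, cut off by \<open>u_L\<close>, can. This forces the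
  double index \<open>(F, L)\<close>. For fixed \<open>F\<close> the pieces converge pointwise to
  the tail, and for a suitable choice \<open>L = \<Lambda> F\<close> they converge pointwise to
  \<open>0\<close>. Both limits are taken in the orbit of the same \<open>h\<close>, so comparing
  them bounds \<open>m\<close> on the tail.

  Finite subsets replace an exhausting sequence because the group need not be sigma-compact. An
  infinite \<open>D\<close> has no more pairs of finite subsets than elements, so the recursion
  never runs out of room.

  Gluing is possible because membership in \<open>LUC\<close> concerns shifts \<open>x + y\<close>
  on the left, while the pieces are moved by \<open>a\<close> on the right. The two operations
  commute, so a piece keeps its modulus of continuity wherever it is placed.\<close>

unbundle cardinal_syntax

section \<open>Disjoint translates of many compact sets\<close>

text \<open>A finite subset is the set of entries of some list. For infinite \<open>A\<close> the
  lists of any fixed length number at most \<open>|A|\<close>, and a countable union of such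
  families is no larger.\<close>

lemma card_of_Fpow_infinite:
  assumes "infinite A"
  shows "|Fpow A| \<le>o |A|"
proof -
  have len: "|{xs. length xs = n \<and> set xs \<subseteq> A}| \<le>o |A|" for n
  proof (induction n)
    case 0
    have "{xs. length xs = 0 \<and> set xs \<subseteq> A} = {[]}" by auto
    moreover have "A \<noteq> {}" using assms by auto
    ultimately show ?case by (metis card_of_singl_ordLeq)
  next
    case (Suc n)
    have "{xs. length xs = Suc n \<and> set xs \<subseteq> A}
        \<subseteq> (\<lambda>(x, xs). x # xs) ` (A \<times> {xs. length xs = n \<and> set xs \<subseteq> A})"
      by (auto simp: length_Suc_conv image_def)
    then have "|{xs. length xs = Suc n \<and> set xs \<subseteq> A}|
        \<le>o |A \<times> {xs. length xs = n \<and> set xs \<subseteq> A}|"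
      by (rule surj_imp_ordLeq)
    also have "|A \<times> {xs. length xs = n \<and> set xs \<subseteq> A}| \<le>o |A|"
      using Suc assms by (intro card_of_Times_ordLeq_infinite_Field) (auto simp: Field_card_of card_of_mono1 card_of_card_order_on)
    finally show ?case .
  qed
  have "Fpow A \<subseteq> set ` (\<Union>n. {xs. length xs = n \<and> set xs \<subseteq> A})"
  proof
    fix F assume "F \<in> Fpow A"
    then obtain xs where "set xs = F" "set xs \<subseteq> A"
      using finite_list[of F] by (auto simp: Fpow_def)
    then show "F \<in> set ` (\<Union>n. {xs. length xs = n \<and> set xs \<subseteq> A})" by auto
  qed
  then have "|Fpow A| \<le>o |\<Union>n. {xs. length xs = n \<and> set xs \<subseteq> A}|"
    by (rule surj_imp_ordLeq)
  also have "|\<Union>n. {xs. length xs = n \<and> set xs \<subseteq> A}| \<le>o |A|"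
    using assms len infinite_iff_card_of_nat by (intro card_of_UNION_ordLeq_infinite) auto
  finally show ?thesis .
qed

lemma finite_ordLess_infinite_card_of: "finite A \<Longrightarrow> infinite B \<Longrightarrow> |A| <o |B|"
  using finite_ordLess_infinite[OF card_of_Well_order card_of_Well_order]
  by (simp add: Field_card_of)

lemma minimal_cover_obtain:
  assumes "\<exists>D. P D"
  obtains D where "P D" "\<And>E. P E \<Longrightarrow> |D| \<le>o |E|"
proof -
  have "\<exists>r \<in> card_of ` Collect P. \<forall>r' \<in> card_of ` Collect P. r \<le>o r'"
    using assms by (intro exists_minim_Card_order) (auto simp: card_of_Card_order)
  then show thesis using that by auto
qed

lemma finite_cover_translates:
  fixes V :: "'a::topological_group_add set"
  assumes V: "open V" and cover: "\<And>y. \<exists>d\<in>D. y - d \<in> V" and K: "compact K"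
  shows "\<exists>F. finite F \<and> F \<subseteq> D \<and> (\<forall>y\<in>K. \<exists>d\<in>F. y - d \<in> V)"
proof -
  have "open ((\<lambda>y. y - d) -` V)" for d
    using V by (intro open_vimage continuous_intros)
  moreover have "K \<subseteq> (\<Union>d\<in>D. (\<lambda>y. y - d) -` V)"
    using cover by auto
  ultimately obtain F where "F \<subseteq> D" "finite F" "K \<subseteq> (\<Union>d\<in>F. (\<lambda>y. y - d) -` V)"
    using K by (metis compactE_image)
  then show ?thesis by (intro exI[of _ F]) auto
qed

lemma disjoint_translates:
  fixes V :: "'a::{topological_group_add, t2_space} set" and T :: "'i \<Rightarrow> 'a set"
  assumes V: "open V"
    and cover: "\<And>y. \<exists>d\<in>D. y - d \<in> V"
    and minimal: "\<And>E. (\<And>y. \<exists>d\<in>E. y - d \<in> V) \<Longrightarrow> |D| \<le>o |E|"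
    and inf: "infinite D" and I: "|I| \<le>o |D|"
    and T: "\<And>i. i \<in> I \<Longrightarrow> compact (T i)"
  obtains x where "\<And>i j s t. i \<in> I \<Longrightarrow> j \<in> I \<Longrightarrow> i \<noteq> j \<Longrightarrow> s \<in> T i \<Longrightarrow> t \<in> T j \<Longrightarrow> s + x i \<noteq> t + x j"
proof -
  \<comment> \<open>The well-order is the cardinal \<open>|I|\<close> itself, so every proper
    initial segment has strictly fewer than \<open>|I|\<close>, hence fewer than \<open>|D|\<close>,
    elements.\<close>
  define r where "r = |I|"
  have fld: "Field r = I" by (simp add: r_def Field_card_of)
  have wo: "Well_order r" unfolding r_def by (rule card_of_Well_order)
  \<comment> \<open>If \<open>x j = y\<close>, then \<open>B i j y\<close> is the set of forbidden values of \<open>x i\<close>.\<close>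
  define B where "B i j y = (\<lambda>(s, t). - s + t + y) ` (T i \<times> T j)" for i j y
  have B: "compact (B i j y)" if "i \<in> I" "j \<in> I" for i j y
    unfolding B_def using that
    by (intro compact_continuous_image compact_Times T)
       (auto simp: case_prod_beta intro!: continuous_intros)
  have ex: "\<exists>y. i \<in> I \<longrightarrow> (\<forall>j\<in>underS r i. y \<notin> B i j (g j))" for g i
  proof (rule ccontr)
    assume "\<not> ?thesis"
    \<comment> \<open>If every point were forbidden, the finite sets \<open>F j\<close> covering the
      compact sets \<open>B i j (g j)\<close> would together form a cover by fewer than
      \<open>|D|\<close> translates.\<close>
    then have i: "i \<in> I" and cov: "\<And>y. \<exists>j\<in>underS r i. y \<in> B i j (g j)" by auto
    have sub: "underS r i \<subseteq> I" using fld by (auto dest: underS_Field)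
    have "\<exists>F. finite F \<and> F \<subseteq> D \<and> (\<forall>y\<in>B i j (g j). \<exists>d\<in>F. y - d \<in> V)" if "j \<in> underS r i" for j
    proof -
      have "j \<in> I" using sub that by blast
      show ?thesis by (rule finite_cover_translates[OF V cover B[OF i \<open>j \<in> I\<close>]])
    qed
    then obtain F where F: "\<And>j. j \<in> underS r i \<Longrightarrow> finite (F j)"
      "\<And>j y. j \<in> underS r i \<Longrightarrow> y \<in> B i j (g j) \<Longrightarrow> \<exists>d\<in>F j. y - d \<in> V"
      by metis
    have small: "|underS r i| <o |D|"
      using card_of_underS[of r i] i fld I card_of_Card_order[of I]
      by (simp add: r_def ordLess_ordLeq_trans)
    have "|\<Union>j\<in>underS r i. F j| <o |D|"
    \<comment> \<open>Absorbing the finite sets \<open>F j\<close> into the cardinality of the index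
      set requires an infinite index set; a finite one gives a finite union, smaller than the
      infinite \<open>D\<close>.\<close>
    proof (cases "finite (underS r i)")
      case True
      then show ?thesis using F(1) inf by (intro finite_ordLess_infinite_card_of) auto
    next
      case False
      have "|F j| \<le>o |underS r i|" if "j \<in> underS r i" for j
        using F(1)[OF that] False by (intro ordLess_imp_ordLeq finite_ordLess_infinite_card_of)
      then have "|\<Union>j\<in>underS r i. F j| \<le>o |underS r i|"
        using False by (intro card_of_UNION_ordLeq_infinite) (auto simp: card_of_mono1)
      then show ?thesis using small by (rule ordLeq_ordLess_trans)
    qed
    moreover have "|D| \<le>o |\<Union>j\<in>underS r i. F j|"
    proof (rule minimal)
      fix y
      obtain j where j: "j \<in> underS r i" "y \<in> B i j (g j)" using cov by blast
      then obtain d where "d \<in> F j" "y - d \<in> V" using F(2) by blast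
      then show "\<exists>d\<in>\<Union>j\<in>underS r i. F j. y - d \<in> V" using j(1) by blast
    qed
    ultimately show False by (simp add: not_ordLess_ordLeq)
  qed
  have "wf (r - Id)" using wo by (simp add: well_order_on_def)
  then have "\<exists>x. \<forall>i. i \<in> I \<longrightarrow> (\<forall>j\<in>underS r i. x i \<notin> B i j (x j))"
    by (rule dependent_wf_choice[where P = "\<lambda>g i y. i \<in> I \<longrightarrow> (\<forall>j\<in>underS r i. y \<notin> B i j (g j))"])
       (use ex in \<open>auto simp: underS_def\<close>)
  then obtain x where x: "\<And>i j. i \<in> I \<Longrightarrow> j \<in> underS r i \<Longrightarrow> x i \<notin> B i j (x j)" by blast
  have ne: "s + x i \<noteq> t + x j" if "i \<in> I" "j \<in> underS r i" "s \<in> T i" "t \<in> T j" for i j s t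
  proof
    assume "s + x i = t + x j"
    then have "x i = - s + t + x j"
      by (metis add.assoc minus_add_cancel)
    then show False using x[OF that(1,2)] that(3,4) by (auto simp: B_def)
  qed
  show thesis
  proof (rule that[of x])
    fix i j s t assume ij: "i \<in> I" "j \<in> I" "i \<noteq> j" and st: "s \<in> T i" "t \<in> T j"
    have "total_on I r" using wo fld by (metis well_order_on_def linear_order_on_def)
    then have "j \<in> underS r i \<or> i \<in> underS r j"
      using ij by (auto simp: total_on_def underS_def)
    then show "s + x i \<noteq> t + x j"
      using ne ij st by metis
  qed
qed


section \<open>Left uniform continuity and orbits\<close>

lemma Urysohn_compact_open:
  fixes K U :: "'a::t2_space set"
  assumes lc: "locally_compact_space (euclidean :: 'a topology)"
    and "compact K" "open U" "K \<subseteq> U"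
  obtains f :: "'a \<Rightarrow> real" where "continuous_on UNIV f" "\<And>x. 0 \<le> f x" "\<And>x. f x \<le> 1"
    "\<And>x. x \<in> K \<Longrightarrow> f x = 1" "\<And>x. x \<notin> U \<Longrightarrow> f x = 0"
proof -
  have haus: "Hausdorff_space (euclidean :: 'a topology)"
    unfolding Hausdorff_space_def disjnt_def by (metis hausdorff open_openin topspace_euclidean)
  have cr: "completely_regular_space (euclidean :: 'a topology)"
    using lc haus by (simp add: locally_compact_regular_imp_completely_regular_space)
  obtain f where f: "continuous_map euclidean (top_of_set {0..1::real}) f"
    "f ` (- U) \<subseteq> {0}" "f ` K \<subseteq> {1}"
    by (rule Urysohn_completely_regular_compact_closed[of 0 1 euclidean K "- U"])
       (use assms cr in \<open>auto simp: disjnt_def\<close>)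
  show thesis
    by (rule that[of f]) (use f in \<open>auto simp: continuous_map_in_subtopology image_subset_iff Pi_iff\<close>)
qed

text \<open>Norm continuity of translation at \<open>0\<close> alone, in pointwise form. It applies
  also to bare real-valued functions such as the cut-offs, which are not elements of the space of
  bounded continuous functions.\<close>

definition left_uc :: "('a::topological_group_add \<Rightarrow> 'b::real_normed_vector) \<Rightarrow> bool"
  where "left_uc f \<longleftrightarrow> (\<forall>e>0. \<forall>\<^sub>F x in nhds 0. \<forall>y. norm (f (x + y) - f y) < e)"

lemma tendsto_diff_self:
  fixes a :: "'a::topological_group_add"
  shows "((\<lambda>b. b - a) \<longlongrightarrow> 0) (nhds a)"
  using tendsto_diff[OF tendsto_ident_at[of a UNIV] tendsto_const[of a]]
  using tendsto_at_iff_tendsto_nhds[of "\<lambda>b. b - a" a] by simp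

lemma continuous_on_left_uc:
  assumes "left_uc f"
  shows "continuous_on UNIV f"
  unfolding continuous_on_def
proof (intro ballI tendstoI)
  fix a and e :: real assume "e > 0"
  then have "\<forall>\<^sub>F x in nhds 0. \<forall>y. norm (f (x + y) - f y) < e"
    using assms by (simp add: left_uc_def)
  then have "\<forall>\<^sub>F b in nhds a. \<forall>y. norm (f (b - a + y) - f y) < e"
    by (rule eventually_compose_filterlim) (rule tendsto_diff_self)
  then have "\<forall>\<^sub>F b in nhds a. dist (f b) (f a) < e"
    by (rule eventually_mono) (metis diff_add_cancel dist_norm)
  then show "\<forall>\<^sub>F b in at a. dist (f b) (f a) < e"
    by (simp add: eventually_at_filter eventually_mono)
qed

text \<open>Continuity at \<open>0\<close> gives continuity at \<open>a\<close>, because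
  \<open>ltrans b f - ltrans a f\<close> is the left translate by \<open>a\<close> of
  \<open>ltrans (b - a) f - f\<close>, and translation does not increase the norm.\<close>

lemma LUC_iff_left_uc: "f \<in> LUC \<longleftrightarrow> left_uc (apply_bcontfun f)"
proof
  assume "f \<in> LUC"
  then have "((\<lambda>x. ltrans x f) \<longlongrightarrow> ltrans 0 f) (at 0)"
    by (auto simp: LUC_def continuous_on_def)
  then have lim: "((\<lambda>x. ltrans x f) \<longlongrightarrow> ltrans 0 f) (nhds 0)"
    by (simp add: tendsto_nhds_iff)
  have l0: "ltrans 0 f = f" by (rule bcontfun_eqI) simp
  show "left_uc (apply_bcontfun f)"
    unfolding left_uc_def
  proof (intro allI impI)
    fix e :: real assume "e > 0"
    with lim have "\<forall>\<^sub>F x in nhds 0. dist (ltrans x f) f < e"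
      by (auto simp: tendsto_iff l0)
    then show "\<forall>\<^sub>F x in nhds 0. \<forall>y. norm (f (x + y) - f y) < e"
    proof (rule eventually_mono, intro allI)
      fix x y assume "dist (ltrans x f) f < e"
      then show "norm (f (x + y) - f y) < e"
        using norm_bounded[of "ltrans x f - f" y] by (simp add: dist_norm)
    qed
  qed
next
  assume uc: "left_uc (apply_bcontfun f)"
  show "f \<in> LUC"
    unfolding LUC_def continuous_on_def mem_Collect_eq
  proof (intro ballI tendstoI)
    fix a and e :: real assume "e > 0"
    then have "\<forall>\<^sub>F x in nhds 0. \<forall>y. norm (f (x + y) - f y) < e / 2"
      using uc half_gt_zero unfolding left_uc_def by blast
    then have "\<forall>\<^sub>F b in nhds a. \<forall>y. norm (f (b - a + y) - f y) < e / 2"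
      by (rule eventually_compose_filterlim) (rule tendsto_diff_self)
    then have "\<forall>\<^sub>F b in nhds a. dist (ltrans b f) (ltrans a f) < e"
    proof (rule eventually_mono)
      fix b assume b: "\<forall>y. norm (f (b - a + y) - f y) < e / 2"
      have "norm (ltrans b f - ltrans a f) \<le> e / 2"
      proof (rule norm_bound)
        fix y
        have "b - a + (a + y) = b + y" by (metis add.assoc diff_add_cancel)
        then show "norm ((ltrans b f - ltrans a f) y) \<le> e / 2"
          using b[rule_format, of "a + y"] by simp
      qed
      then show "dist (ltrans b f) (ltrans a f) < e"
        using \<open>e > 0\<close> by (simp add: dist_norm)
    qed
    then show "\<forall>\<^sub>F b in at a. dist (ltrans b f) (ltrans a f) < e"
      by (simp add: eventually_at_filter eventually_mono)
  qed
qed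

lemma Bcontfun_in_LUC:
  assumes "left_uc f" and "\<And>x. norm (f x) \<le> B"
  shows "apply_bcontfun (Bcontfun f) = f" and "Bcontfun f \<in> LUC"
proof -
  have "f \<in> bcontfun"
    using continuous_on_left_uc[OF assms(1)] assms(2) by (rule bcontfun_normI)
  then show "apply_bcontfun (Bcontfun f) = f"
    by (rule Bcontfun_inverse)
  then show "Bcontfun f \<in> LUC" using assms(1) by (simp add: LUC_iff_left_uc)
qed

lemma left_uc_compact_support:
  fixes f :: "'a::topological_group_add \<Rightarrow> 'b::real_normed_vector"
  assumes cont: "continuous_on UNIV f" and K: "compact K" and off: "\<And>x. x \<notin> K \<Longrightarrow> f x = 0"
  shows "left_uc f"
  unfolding left_uc_def
proof (intro allI impI)
  fix e :: real assume "e > 0"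
  define W where "W = {p. norm (f (fst p + snd p) - f (snd p)) < e}"
  have "open W"
    unfolding W_def
    by (intro open_Collect_less continuous_intros continuous_on_compose2[OF cont]) auto
  moreover have "{0} \<times> K \<subseteq> W" using \<open>e > 0\<close> by (auto simp: W_def)
  ultimately have "\<exists>N. 0 \<in> N \<and> open N \<and> N \<times> K \<subseteq> W"
    by (rule Elementary_Topology.tube_lemma[OF K])
  then obtain N where N: "0 \<in> N" "open N" "N \<times> K \<subseteq> W" by blast
  have near: "norm (f (x + y) - f y) < e" if "x \<in> N" "y \<in> K" for x y
    using N(3) that by (auto simp: W_def)
  \<comment> \<open>The tube handles \<open>y \<in> K\<close>. Symmetrizing \<open>N\<close> adds
    the case \<open>x + y \<in> K\<close>, where \<open>y\<close> is reached from
    \<open>x + y\<close> by the shift \<open>- x\<close>.\<close>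
  have "open (uminus -` N)" using N(2) by (intro open_vimage continuous_intros)
  then have "\<forall>\<^sub>F x in nhds 0. x \<in> N \<inter> uminus -` N"
    using N by (intro eventually_nhds_in_open) auto
  then show "\<forall>\<^sub>F x in nhds 0. \<forall>y. norm (f (x + y) - f y) < e"
  proof (rule eventually_mono, intro allI)
    fix x y assume x: "x \<in> N \<inter> uminus -` N"
    consider "y \<in> K" | "x + y \<in> K" | "y \<notin> K" "x + y \<notin> K" by blast
    then show "norm (f (x + y) - f y) < e"
    proof cases
      case 1 then show ?thesis using near x by blast
    next
      case 2
      then have "norm (f (- x + (x + y)) - f (x + y)) < e" using near x by blast
      then show ?thesis by (simp add: norm_minus_commute)
    next
      case 3 then show ?thesis using off \<open>e > 0\<close> by simp
    qed
  qed
qed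

text \<open>Cluster points are expressed by \<open>inf (nhds n) F \<noteq> bot\<close>, which plays
  the role of a convergent subnet: along this nontrivial filter the evaluation tends both to
  \<open>n f\<close> and to \<open>c\<close>.\<close>

lemma eval_cluster_point:
  assumes "inf (nhds n) F \<noteq> bot" and "((\<lambda>p. p f) \<longlongrightarrow> c) F"
  shows "n f = (c :: 'b::t2_space)"
proof -
  have "((\<lambda>p. p f) \<longlongrightarrow> n f) (nhds n)"
    using continuous_on_product_coordinates[of f]
    by (metis UNIV_I continuous_on_def tendsto_nhds_iff)
  then have "((\<lambda>p. p f) \<longlongrightarrow> n f) (inf (nhds n) F)"
    by (rule tendsto_mono[rotated]) simp
  moreover have "((\<lambda>p. p f) \<longlongrightarrow> c) (inf (nhds n) F)"
    using assms(2) by (rule tendsto_mono[rotated]) simp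
  ultimately show ?thesis using assms(1) tendsto_unique by blast
qed

lemma closed_cluster_point:
  assumes "inf (nhds n) F \<noteq> bot" and "closed S" and "\<forall>\<^sub>F p in F. p \<in> S"
  shows "n \<in> S"
proof (rule ccontr)
  assume "n \<notin> S"
  then have "\<forall>\<^sub>F p in nhds n. p \<notin> S"
    using assms(2) eventually_nhds_in_open[of "- S" n] by auto
  then have "\<forall>\<^sub>F p in inf (nhds n) F. False"
    using assms(3) unfolding eventually_inf by blast
  then show False using assms(1) by (simp add: trivial_limit_def)
qed

text \<open>The bridge between \<open>weak_star\<close> and the type class topology on all
  functions, in which filters and compactness are handled: restriction to \<open>LUC\<close> is
  continuous and fixes the elements of \<open>LUC_dual\<close>.\<close>

lemma weak_star_open_imp_nhds:
  assumes "openin weak_star T" and "n \<in> T"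
  shows "\<forall>\<^sub>F p in nhds n. p \<in> LUC_dual \<longrightarrow> p \<in> T"
proof -
  obtain U where U: "openin (product_topology (\<lambda>f. euclidean) LUC) U" "T = U \<inter> LUC_dual"
    using assms(1) by (auto simp: weak_star_def openin_subtopology)
  have "continuous_map euclidean (product_topology (\<lambda>f. euclidean) LUC) (\<lambda>p. restrict p LUC)"
    by (auto simp: continuous_map_componentwise continuous_on_product_coordinates)
  from openin_continuous_map_preimage[OF this U(1)]
  have "open {p. restrict p LUC \<in> U}" by (simp only: topspace_euclidean UNIV_I simp_thms open_openin)
  moreover have ext: "restrict p LUC = p" if "p \<in> LUC_dual" for p :: "('a \<Rightarrow>\<^sub>C complex) \<Rightarrow> complex"
    using that by (auto simp: LUC_dual_def extensional_restrict)
  ultimately have "\<forall>\<^sub>F p in nhds n. p \<in> {p. restrict p LUC \<in> U}"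
    using assms(2) U(2) by (intro eventually_nhds_in_open) auto
  then show ?thesis by (rule eventually_mono) (use U(2) ext in auto)
qed

text \<open>Banach-Alaoglu in filter form. Point evaluations lie in a product of discs, which is
  compact by Tychonoff, and linearity passes to a cluster point because it is a closed
  condition.\<close>

lemma point_eval_cluster_point:
  fixes F :: "'a::topological_group_add filter"
  assumes "F \<noteq> bot"
  obtains n where "inf (nhds n) (filtermap point_eval F) \<noteq> bot"
    and "n \<in> weak_star closure_of range point_eval" and "n \<in> LUC_dual"
proof -
  \<comment> \<open>Indices outside \<open>LUC\<close> receive the one-point factor
    \<open>{undefined}\<close>: the product stays compact, and a cluster point in it is
    extensional.\<close>
  define Y where "Y = Pi\<^sub>E UNIV (\<lambda>f :: 'a \<Rightarrow>\<^sub>C complex. if f \<in> LUC then cball (0::complex) (norm f) else {undefined})"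
  have "compactin (product_topology (\<lambda>f. euclidean) UNIV) Y"
    unfolding Y_def compactin_PiE by simp
  then have "compact Y" by (simp add: euclidean_product_topology)
  moreover have ev: "\<forall>\<^sub>F p in filtermap point_eval F. p \<in> S" if "\<And>x. point_eval x \<in> S" for S
    using that by (simp add: eventually_filtermap)
  moreover have "point_eval x \<in> Y" for x
    by (auto simp: Y_def point_eval_def norm_bounded)
  moreover have "filtermap point_eval F \<noteq> bot" using assms by (simp add: filtermap_bot_iff)
  ultimately obtain n where n: "n \<in> Y" "inf (nhds n) (filtermap point_eval F) \<noteq> bot"
    unfolding compact_filter by meson
  note closed = closed_cluster_point[OF n(2) _ ev]
  have [continuous_intros]: "continuous_on UNIV (\<lambda>p :: ('a \<Rightarrow>\<^sub>C complex) \<Rightarrow> complex. p f)" for f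
    by (rule continuous_on_product_coordinates)
  have add: "n (f + g) = n f + n g" if "f \<in> LUC" "g \<in> LUC" for f g
  proof -
    have "closed {p :: ('a \<Rightarrow>\<^sub>C complex) \<Rightarrow> complex. p (f + g) = p f + p g}"
      by (intro closed_Collect_eq continuous_intros)
    from closed[OF this] show ?thesis
      using that LUC_dual_add[OF point_eval_in_LUC_dual] by auto
  qed
  have scale: "n (cscale c f) = c * n f" if "f \<in> LUC" for c f
  proof -
    have "closed {p :: ('a \<Rightarrow>\<^sub>C complex) \<Rightarrow> complex. p (cscale c f) = c * p f}"
      by (intro closed_Collect_eq continuous_intros)
    from closed[OF this] show ?thesis
      using that LUC_dual_cscale[OF point_eval_in_LUC_dual] by auto
  qed
  have Y: "n f \<in> (if f \<in> LUC then cball 0 (norm f) else {undefined})" for f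
    using n(1) by (auto simp: Y_def PiE_def Pi_def)
  have "n \<in> extensional LUC" using Y by (auto simp: extensional_def) (metis singletonD)
  moreover have "\<forall>f\<in>LUC. norm (n f) \<le> 1 * norm f"
    using Y by (metis dist_0_norm mem_cball mult_1)
  ultimately have dual: "n \<in> LUC_dual"
    using add scale unfolding LUC_dual_def by blast
  have "n \<in> weak_star closure_of range point_eval"
    unfolding in_closure_of
  proof (intro conjI allI impI)
    show "n \<in> topspace weak_star" using dual by simp
    fix T assume "n \<in> T \<and> openin weak_star T"
    then have T: "\<forall>\<^sub>F p in nhds n. p \<in> LUC_dual \<longrightarrow> p \<in> T"
      using weak_star_open_imp_nhds by blast
    show "\<exists>p. p \<in> range point_eval \<and> p \<in> T"
    proof (rule ccontr)
      assume "\<not> ?thesis"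
      then have "\<forall>\<^sub>F p in filtermap point_eval F. \<not> (p \<in> LUC_dual \<longrightarrow> p \<in> T)"
        by (auto simp: eventually_filtermap point_eval_in_LUC_dual)
      then have "\<forall>\<^sub>F p in inf (nhds n) (filtermap point_eval F). False"
        using T unfolding eventually_inf by blast
      then show False using n(2) by (simp add: trivial_limit_def)
    qed
  qed
  then show thesis using that n(2) dual by blast
qed

text \<open>Pointwise convergence of the right translates of \<open>h\<close> determines
  \<open>n \<cdot> h\<close> for each cluster point \<open>n\<close> of the evaluations, although it
  need not determine \<open>n\<close>. Since \<open>dual_mult m p\<close> takes the value
  \<open>m (p \<cdot> h)\<close> at \<open>h\<close>, continuity at one such \<open>n\<close> gives
  the contradiction, provided the cluster point is taken along points where the convergence
  fails.\<close>

lemma functional_continuous_on_orbit: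
  fixes m :: "('a::topological_group_add \<Rightarrow>\<^sub>C complex) \<Rightarrow> complex" and F :: "'a filter"
    and g :: "'a \<Rightarrow>\<^sub>C complex"
  assumes cont: "continuous_map (subtopology weak_star (weak_star closure_of (range point_eval)))
           weak_star (\<lambda>n. dual_mult m n)"
    and h: "h \<in> LUC"
    and lim: "\<And>y. ((\<lambda>x. h (y + x)) \<longlongrightarrow> g y) F"
  shows "((\<lambda>x. m (dual_act (point_eval x) h)) \<longlongrightarrow> m g) F"
proof (rule ccontr)
  assume "\<not> ?thesis"
  then obtain e where e: "e > 0" "\<not> (\<forall>\<^sub>F x in F. dist (m (dual_act (point_eval x) h)) (m g) < e)"
    by (auto simp: tendsto_iff)
  define B where "B = {x. \<not> dist (m (dual_act (point_eval x) h)) (m g) < e}"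
  define F' where "F' = inf F (principal B)"
  have "F' \<noteq> bot"
    using e(2) by (simp add: F'_def B_def trivial_limit_def eventually_inf_principal)
  then obtain n where n: "inf (nhds n) (filtermap point_eval F') \<noteq> bot"
    "n \<in> weak_star closure_of range point_eval" "n \<in> LUC_dual"
    by (rule point_eval_cluster_point)
  have "dual_act n h = g"
  proof (rule bcontfun_eqI)
    fix y
    have "((\<lambda>x. h (y + x)) \<longlongrightarrow> g y) F'"
      using lim unfolding F'_def by (rule tendsto_mono[rotated]) simp
    then have "((\<lambda>p. p (ltrans y h)) \<longlongrightarrow> g y) (filtermap point_eval F')"
      using LUC_ltrans[OF h] by (simp add: filterlim_filtermap point_eval_def)
    then have "n (ltrans y h) = g y"
      by (rule eval_cluster_point[OF n(1)])
    then show "dual_act n h y = g y" using n(3) h by (simp add: apply_dual_act)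
  qed
  have "continuous_map weak_star euclidean (\<lambda>p :: ('a \<Rightarrow>\<^sub>C complex) \<Rightarrow> complex. p h)"
    unfolding weak_star_def
    by (intro continuous_map_from_subtopology continuous_map_product_projection h)
  from continuous_map_compose[OF cont this]
  have "continuous_map (subtopology weak_star (weak_star closure_of (range point_eval)))
     euclidean (\<lambda>p. m (dual_act p h))"
    using h by (simp add: o_def dual_mult_def)
  then have "openin (subtopology weak_star (weak_star closure_of (range point_eval)))
     {p \<in> topspace (subtopology weak_star (weak_star closure_of (range point_eval))).
        m (dual_act p h) \<in> ball (m g) e}"
    by (rule openin_continuous_map_preimage) simp
  then obtain T where T: "openin weak_star T"
    "{p \<in> LUC_dual \<inter> weak_star closure_of (range point_eval). m (dual_act p h) \<in> ball (m g) e}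
      = T \<inter> weak_star closure_of (range point_eval)"
    by (auto simp: openin_subtopology)
  define X where "X = weak_star closure_of range (point_eval :: 'a \<Rightarrow> _)"
  have mem_T: "p \<in> T \<longleftrightarrow> m (dual_act p h) \<in> ball (m g) e" if "p \<in> LUC_dual" "p \<in> X" for p
    using that T(2) unfolding X_def[symmetric] by blast
  have "n \<in> T"
    using mem_T n(2,3) \<open>dual_act n h = g\<close> e(1) unfolding X_def by simp
  then have "\<forall>\<^sub>F p in nhds n. p \<in> LUC_dual \<longrightarrow> p \<in> T"
    using T(1) weak_star_open_imp_nhds by blast
  moreover have "\<forall>\<^sub>F p in filtermap point_eval F'. \<not> (p \<in> LUC_dual \<longrightarrow> p \<in> T)"
  proof -
    have cl: "point_eval x \<in> X" for x
      unfolding X_def by (rule subsetD[OF closure_of_subset]) (auto simp: point_eval_in_LUC_dual)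
    have "point_eval x \<notin> T" if "x \<in> B" for x
      using that mem_T[OF point_eval_in_LUC_dual cl] by (simp add: B_def dist_commute)
    then have "\<forall>\<^sub>F x in F'. point_eval x \<notin> T"
      unfolding F'_def eventually_inf_principal by simp
    then show ?thesis by (simp add: eventually_filtermap point_eval_in_LUC_dual)
  qed
  ultimately have "\<forall>\<^sub>F p in inf (nhds n) (filtermap point_eval F'). False"
    unfolding eventually_inf by blast
  then show False using n(1) by (simp add: trivial_limit_def)
qed


section \<open>Encoding all tails of a function in one orbit\<close>

text \<open>\<open>S i\<close> carries the i-th piece and \<open>T i\<close> adds a margin. For
  small \<open>x\<close>, if \<open>h\<close> is nonzero at \<open>z\<close> or at
  \<open>x + z\<close>, then both points lie in the same \<open>T i + a i\<close>. The difference is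
  therefore that of a single piece, and the common modulus \<open>equi\<close> applies.\<close>

lemma glue_left_uc:
  fixes g :: "'i \<Rightarrow> 'a::topological_group_add \<Rightarrow> 'b::real_normed_vector"
  assumes equi: "\<And>e. e > 0 \<Longrightarrow> \<forall>\<^sub>F x in nhds 0. \<forall>i\<in>I. \<forall>y. norm (g i (x + y) - g i y) < e"
    and disj: "\<And>i j s t. i \<in> I \<Longrightarrow> j \<in> I \<Longrightarrow> i \<noteq> j \<Longrightarrow> s \<in> T i \<Longrightarrow> t \<in> T j \<Longrightarrow> s + a i \<noteq> t + a j"
    and ST: "\<forall>\<^sub>F x in nhds 0. \<forall>i\<in>I. \<forall>s\<in>S i. x + s \<in> T i"
    and off: "\<And>i y. i \<in> I \<Longrightarrow> y \<notin> S i \<Longrightarrow> g i y = 0"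
    and bdd: "\<And>i y. i \<in> I \<Longrightarrow> norm (g i y) \<le> B" and "0 \<le> B"
  obtains h where "left_uc h" "\<And>z. norm (h z) \<le> B"
    "\<And>i y. i \<in> I \<Longrightarrow> y \<in> T i \<Longrightarrow> h (y + a i) = g i y"
proof -
  define P where "P z i \<longleftrightarrow> i \<in> I \<and> z - a i \<in> T i" for z i
  define h where "h z = (if \<exists>i. P z i then g (THE i. P z i) (z - a (THE i. P z i)) else 0)" for z
  have unique: "i = j" if "P z i" "P z j" for z i j
    using disj[of i j "z - a i" "z - a j"] that by (auto simp: P_def)
  have h_eq: "h z = g i (z - a i)" if "P z i" for z i
  proof -
    have "(THE i. P z i) = i" using that unique by blast
    then show ?thesis using that by (auto simp: h_def)
  qed
  have nz: "\<exists>i\<in>I. z - a i \<in> S i" if hz: "h z \<noteq> 0" for z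
  proof -
    obtain i where i: "P z i" using hz by (metis h_def)
    then have "z - a i \<in> S i" using hz off[of i "z - a i"] h_eq[OF i] by (auto simp: P_def)
    with i show ?thesis by (auto simp: P_def)
  qed
  have neg: "filterlim uminus (nhds 0) (nhds (0 :: 'a))"
    using tendsto_minus[OF tendsto_ident_at[of "0::'a" UNIV]]
      tendsto_at_iff_tendsto_nhds[of uminus "0::'a"] by simp
  have "left_uc h"
    unfolding left_uc_def
  proof (intro allI impI)
    fix e :: real assume "e > 0"
    \<comment> \<open>If it is \<open>x + z\<close> that lies over \<open>S i\<close>, the way back
      to \<open>z\<close> is the shift \<open>- x\<close>, so the margin has to absorb both
      signs.\<close>
    have "\<forall>\<^sub>F x in nhds 0. \<forall>i\<in>I. \<forall>s\<in>S i. - x + s \<in> T i"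
      using ST neg by (rule eventually_compose_filterlim)
    moreover have "\<forall>\<^sub>F x in nhds (0 :: 'a). \<forall>i\<in>I. \<forall>s\<in>S i. s \<in> T i"
      using eventually_nhds_x_imp_x[OF ST] by simp
    ultimately show "\<forall>\<^sub>F x in nhds 0. \<forall>y. norm (h (x + y) - h y) < e"
      using ST equi[OF \<open>e > 0\<close>]
    proof (eventually_elim, intro allI)
      fix x z
      assume mx: "\<forall>i\<in>I. \<forall>s\<in>S i. - x + s \<in> T i" and z0: "\<forall>i\<in>I. \<forall>s\<in>S i. s \<in> T i"
        and px: "\<forall>i\<in>I. \<forall>s\<in>S i. x + s \<in> T i" and eq: "\<forall>i\<in>I. \<forall>y. norm (g i (x + y) - g i y) < e"
      have "\<exists>i. P z i \<and> P (x + z) i" if "h z \<noteq> 0 \<or> h (x + z) \<noteq> 0"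
        using that
      proof
        assume "h z \<noteq> 0"
        then obtain i where i: "i \<in> I" "z - a i \<in> S i" using nz by blast
        then have "x + (z - a i) \<in> T i" "z - a i \<in> T i" using px z0 by blast+
        then show ?thesis using i(1) by (auto simp: P_def add_diff_eq)
      next
        assume "h (x + z) \<noteq> 0"
        then obtain i where i: "i \<in> I" "x + z - a i \<in> S i" using nz by blast
        then have "- x + (x + z - a i) \<in> T i" "x + z - a i \<in> T i" using mx z0 by blast+
        moreover have "- x + (x + z - a i) = z - a i"
          by (metis add_diff_eq minus_add_cancel)
        ultimately show ?thesis using i(1) by (auto simp: P_def)
      qed
      then consider "h z = 0" "h (x + z) = 0" | i where "P z i" "P (x + z) i" by blast
      then show "norm (h (x + z) - h z) < e"
      proof cases
        case 1 then show ?thesis using \<open>e > 0\<close> by simp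
      next
        case (2 i)
        then show ?thesis
          using eq[rule_format, of i "z - a i"] by (simp add: h_eq[of _ i] P_def add_diff_eq)
      qed
    qed
  qed
  moreover have "norm (h z) \<le> B" for z
  proof (cases "\<exists>i. P z i")
    case True
    then show ?thesis using bdd h_eq by (auto simp: P_def)
  next
    case False
    then show ?thesis using \<open>0 \<le> B\<close> by (simp add: h_def)
  qed
  moreover have "h (y + a i) = g i y" if "i \<in> I" "y \<in> T i" for i y
    using h_eq[of "y + a i" i] that by (simp add: P_def)
  ultimately show thesis by (rule that)
qed

section \<open>Cut-off functions with a common modulus of continuity\<close>

lemma Max_image_diff_less:
  fixes p q :: "'i \<Rightarrow> real"
  assumes "finite L" "\<And>d. d \<in> L \<Longrightarrow> \<bar>p d - q d\<bar> < e" "e > 0"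
  shows "\<bar>Max (insert 0 (p ` L)) - Max (insert 0 (q ` L))\<bar> < e"
proof -
  have aux: "Max (insert 0 (p ` L)) < Max (insert 0 (q ` L)) + e"
    if "\<And>d. d \<in> L \<Longrightarrow> \<bar>p d - q d\<bar> < e" for p q :: "'i \<Rightarrow> real"
  proof -
    have ge: "q d \<le> Max (insert 0 (q ` L))" if "d \<in> L" for d
      using that assms(1) by (intro Max_ge) auto
    have "0 \<le> Max (insert 0 (q ` L))" using assms(1) by (intro Max_ge) auto
    moreover have "p d < Max (insert 0 (q ` L)) + e" if d: "d \<in> L" for d
      using ge[OF d] \<open>\<And>d. d \<in> L \<Longrightarrow> \<bar>p d - q d\<bar> < e\<close>[OF d] by linarith
    ultimately show ?thesis
      using assms(1,3) by (subst Max_less_iff) (auto intro: add_nonneg_pos)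
  qed
  show ?thesis using aux[of p q] aux[of q p] assms(2) by (force simp: abs_minus_commute abs_less_iff)
qed

text \<open>That \<open>w\<close> equals \<open>1\<close> on a whole neighbourhood of
  \<open>0\<close> lets finitely many translates attain the exact value \<open>1\<close> on a
  compact set. The pointwise limits needed later are then eventually constant.\<close>

locale bump =
  fixes w :: "'a::{topological_group_add, t2_space} \<Rightarrow> real" and C V :: "'a set"
  assumes w_cont: "continuous_on UNIV w" and w_nonneg: "0 \<le> w x" and w_le_1: "w x \<le> 1"
    and C: "compact C" and w_off: "x \<notin> C \<Longrightarrow> w x = 0"
    and V: "open V" "0 \<in> V" and w_on: "x \<in> V \<Longrightarrow> w x = 1"
begin

text \<open>
  A maximum rather than a sum, so that the modulus of continuity does not depend on \<open>L\<close>.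
\<close>

definition plateau :: "'a set \<Rightarrow> 'a \<Rightarrow> real"
  where "plateau L y = Max (insert 0 ((\<lambda>d. w (y - d)) ` L))"

definition thick :: "'a set \<Rightarrow> 'a set"
  where "thick L = (\<Union>d\<in>L. (\<lambda>c. c + d) ` C)"

lemma VC: "V \<subseteq> C" using w_on w_off by force

lemma compact_thick: "finite L \<Longrightarrow> compact (thick L)"
  unfolding thick_def by (intro compact_UN compact_continuous_image C continuous_intros) auto

lemma thick_if: "d \<in> L \<Longrightarrow> y - d \<in> C \<Longrightarrow> y \<in> thick L"
  unfolding thick_def by (metis UN_I diff_add_cancel image_eqI)

lemma plateau_nonneg: "finite L \<Longrightarrow> 0 \<le> plateau L y"
  unfolding plateau_def by (intro Max_ge) auto

lemma plateau_le_1: "finite L \<Longrightarrow> plateau L y \<le> 1"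
  unfolding plateau_def by (subst Max_le_iff) (auto simp: w_le_1)

lemma plateau_eq_1:
  assumes "finite L" "d \<in> L" "y - d \<in> V"
  shows "plateau L y = 1"
proof (rule antisym)
  have "w (y - d) \<le> plateau L y" unfolding plateau_def by (intro Max_ge) (use assms in auto)
  then show "1 \<le> plateau L y" by (simp add: w_on assms(3))
qed (rule plateau_le_1[OF assms(1)])

lemma plateau_eq_0:
  assumes "finite L" "y \<notin> thick L"
  shows "plateau L y = 0"
proof -
  have "w (y - d) = 0" if "d \<in> L" for d
    using assms(2) thick_if that w_off by blast
  then have "insert 0 ((\<lambda>d. w (y - d)) ` L) = {0}" by auto
  then show ?thesis unfolding plateau_def by (simp only: Max_singleton)
qed

lemma plateau_equi_left_uc:
  assumes "e > 0"
  shows "\<forall>\<^sub>F x in nhds 0. \<forall>L y. finite L \<longrightarrow> \<bar>plateau L (x + y) - plateau L y\<bar> < e"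
proof -
  have "left_uc w" using w_cont C w_off by (rule left_uc_compact_support)
  then have "\<forall>\<^sub>F x in nhds 0. \<forall>y. norm (w (x + y) - w y) < e"
    using assms by (simp add: left_uc_def)
  then show ?thesis
  proof (rule eventually_mono, intro allI impI)
    fix x y and L :: "'a set" assume x: "\<forall>y. norm (w (x + y) - w y) < e" and L: "finite L"
    have "\<bar>w (x + y - d) - w (y - d)\<bar> < e" for d
      using x[rule_format, of "y - d"] by (simp add: add_diff_eq)
    then show "\<bar>plateau L (x + y) - plateau L y\<bar> < e"
      unfolding plateau_def using L assms by (intro Max_image_diff_less) auto
  qed
qed

lemma continuous_plateau:
  fixes L :: "'a set"
  assumes "finite L"
  shows "continuous_on UNIV (plateau L)"
proof (rule continuous_on_left_uc, unfold left_uc_def, intro allI impI)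
  fix e :: real assume "e > 0"
  from plateau_equi_left_uc[OF this]
  show "\<forall>\<^sub>F x in nhds 0. \<forall>y. norm (plateau L (x + y) - plateau L y) < e"
    by (rule eventually_mono) (use assms in auto)
qed

end

lemma bump_exists:
  assumes "locally_compact_space (euclidean :: 'a::{topological_group_add, t2_space} topology)"
  obtains w :: "'a::{topological_group_add, t2_space} \<Rightarrow> real" and C V where "bump w C V"
proof -
  obtain U C where U: "open U" "compact C" "(0::'a) \<in> U" "U \<subseteq> C"
    using assms unfolding locally_compact_space_def by simp blast
  obtain f :: "'a \<Rightarrow> real" where f: "continuous_on UNIV f" "\<And>x. 0 \<le> f x" "\<And>x. f x \<le> 1"
    "\<And>x. x \<in> {0} \<Longrightarrow> f x = 1" "\<And>x. x \<notin> U \<Longrightarrow> f x = 0"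
    by (rule Urysohn_compact_open[OF assms, of "{0}" U]) (use U in auto)
  \<comment> \<open>Doubling and truncating turns the peak at \<open>0\<close> into a plateau on the
    open set where \<open>f\<close> exceeds one half.\<close>
  have "bump (\<lambda>x. min 1 (2 * f x)) C {x. 1 / 2 < f x}"
  proof
    show "continuous_on UNIV (\<lambda>x. min 1 (2 * f x))" by (intro continuous_intros f)
    show "open {x. 1 / 2 < f x}" by (intro open_Collect_less continuous_intros f)
    show "min 1 (2 * f x) = 0" if "x \<notin> C" for x
    proof -
      have "x \<notin> U" using U(4) that by blast
      then show ?thesis using f(5) by simp
    qed
  qed (use f U in auto)
  then show thesis by (rule that)
qed


lemma norm_cutoff_diff_le:
  fixes a a' :: complex and b b' c c' :: real
  assumes "norm a' \<le> B" "0 \<le> b" "b \<le> 1" "0 \<le> b'" "b' \<le> 1" "0 \<le> c" "c \<le> 1"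
  shows "norm (a * of_real (1 - b) * of_real c - a' * of_real (1 - b') * of_real c')
    \<le> norm (a - a') + B * \<bar>b - b'\<bar> + B * \<bar>c - c'\<bar>"
proof -
  have B: "0 \<le> B" using assms(1) norm_ge_zero order_trans by blast
  \<comment> \<open>The factors are exchanged one at a time: first \<open>a\<close>, then
    \<open>b\<close>, then \<open>c\<close>.\<close>
  have "a * of_real (1 - b) * of_real c - a' * of_real (1 - b') * of_real c'
    = (a - a') * of_real ((1 - b) * c) + a' * of_real ((b' - b) * c) + a' * of_real ((1 - b') * (c - c'))"
    by (simp add: algebra_simps)
  also have "norm \<dots> \<le> norm ((a - a') * of_real ((1 - b) * c)) + norm (a' * of_real ((b' - b) * c))
      + norm (a' * of_real ((1 - b') * (c - c')))"
    by (intro order_trans[OF norm_triangle_ineq] add_mono) auto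
  also have "norm ((a - a') * of_real ((1 - b) * c)) \<le> norm (a - a') * 1"
    unfolding norm_mult norm_of_real abs_mult using assms
    by (intro mult_left_mono mult_le_one) auto
  also have "norm (a' * of_real ((b' - b) * c)) \<le> B * (\<bar>b - b'\<bar> * 1)"
    unfolding norm_mult norm_of_real abs_mult using assms B
    by (intro mult_mono) (auto simp: abs_minus_commute)
  also have "norm (a' * of_real ((1 - b') * (c - c'))) \<le> B * (1 * \<bar>c - c'\<bar>)"
    unfolding norm_mult norm_of_real abs_mult using assms B
    by (intro mult_mono) auto
  finally show ?thesis by simp
qed

context bump
begin

text \<open>The neighbourhood of \<open>0\<close> must not depend on \<open>F\<close> and
  \<open>L\<close>, because the pieces for all pairs are glued into one function.\<close>

lemma cutoff_equi_left_uc: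
  fixes f :: "'a \<Rightarrow> complex"
  assumes f: "left_uc f" and B: "\<And>x. norm (f x) \<le> B" and "e > 0"
  shows "\<forall>\<^sub>F x in nhds 0. \<forall>F L y. finite F \<longrightarrow> finite L \<longrightarrow>
    norm (f (x + y) * of_real (1 - plateau F (x + y)) * of_real (plateau L (x + y))
      - f y * of_real (1 - plateau F y) * of_real (plateau L y)) < e"
proof -
  have B0: "0 \<le> B" using B[of 0] norm_ge_zero order_trans by blast
  \<comment> \<open>Half of \<open>e\<close> is spent on \<open>f\<close> and a quarter on each of
    the two cut-offs; adding \<open>1\<close> keeps the denominator positive when
    \<open>B = 0\<close>.\<close>
  define d where "d = e / (4 * (B + 1))"
  have "d > 0" using B0 \<open>e > 0\<close> by (simp add: d_def)
  have Bd: "B * d \<le> e / 4" using B0 \<open>e > 0\<close> by (simp add: d_def field_simps)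
  have "\<forall>\<^sub>F x in nhds 0. \<forall>y. norm (f (x + y) - f y) < e / 2"
    using f half_gt_zero[OF \<open>e > 0\<close>] unfolding left_uc_def by blast
  then show ?thesis
    using plateau_equi_left_uc[OF \<open>d > 0\<close>]
  proof (eventually_elim, intro allI impI)
    fix x y and F L :: "'a set" assume fx: "\<forall>y. norm (f (x + y) - f y) < e / 2"
      and px: "\<forall>L y. finite L \<longrightarrow> \<bar>plateau L (x + y) - plateau L y\<bar> < d"
      and fin: "finite F" "finite L"
    have "B * \<bar>plateau F (x + y) - plateau F y\<bar> \<le> B * d"
      "B * \<bar>plateau L (x + y) - plateau L y\<bar> \<le> B * d"
      using px fin B0 by (auto intro!: mult_left_mono intro: less_imp_le)
    moreover have "norm (f (x + y) - f y) < e / 2" using fx by blast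
    moreover have "norm (f (x + y) * of_real (1 - plateau F (x + y)) * of_real (plateau L (x + y))
      - f y * of_real (1 - plateau F y) * of_real (plateau L y))
      \<le> norm (f (x + y) - f y) + B * \<bar>plateau F (x + y) - plateau F y\<bar>
        + B * \<bar>plateau L (x + y) - plateau L y\<bar>"
      using fin by (intro norm_cutoff_diff_le B plateau_nonneg plateau_le_1)
    ultimately show "norm (f (x + y) * of_real (1 - plateau F (x + y)) * of_real (plateau L (x + y))
      - f y * of_real (1 - plateau F y) * of_real (plateau L y)) < e"
      using Bd by linarith
  qed
qed

definition tail :: "('a \<Rightarrow>\<^sub>C complex) \<Rightarrow> 'a set \<Rightarrow> 'a \<Rightarrow>\<^sub>C complex"
  where "tail f F = Bcontfun (\<lambda>y. f y * of_real (1 - plateau F y))"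

lemma tail:
  assumes f: "f \<in> LUC" and F: "finite F"
  shows "tail f F \<in> LUC" and "tail f F y = f y * of_real (1 - plateau F y)"
proof -
  have uc: "left_uc (\<lambda>y. f y * of_real (1 - plateau F y))"
    unfolding left_uc_def
  proof (intro allI impI)
    fix e :: real assume "e > 0"
    define d where "d = e / 2 / (norm f + 1)"
    have "d > 0" using \<open>e > 0\<close> norm_ge_zero[of f] by (simp add: d_def add_nonneg_pos)
    have "norm f + 1 \<noteq> 0" using norm_ge_zero[of f] by linarith
    then have "(norm f + 1) * d = e / 2"
      unfolding d_def times_divide_eq_right[of "norm f + 1" "e / 2"]
      by (rule nonzero_mult_div_cancel_left)
    then have Bd: "norm f * d \<le> e / 2" using \<open>d > 0\<close> by (simp add: distrib_right)
    have "\<forall>\<^sub>F x in nhds 0. \<forall>y. norm (f (x + y) - f y) < e / 2"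
      using f half_gt_zero[OF \<open>e > 0\<close>] unfolding LUC_iff_left_uc left_uc_def by blast
    then show "\<forall>\<^sub>F x in nhds 0. \<forall>y. norm (f (x + y) * of_real (1 - plateau F (x + y))
        - f y * of_real (1 - plateau F y)) < e"
      using plateau_equi_left_uc[OF \<open>d > 0\<close>]
    proof (eventually_elim, intro allI)
      fix x y assume fx: "\<forall>y. norm (f (x + y) - f y) < e / 2"
        and px: "\<forall>L y. finite L \<longrightarrow> \<bar>plateau L (x + y) - plateau L y\<bar> < d"
      have "norm f * \<bar>plateau F (x + y) - plateau F y\<bar> \<le> norm f * d"
        using px F by (auto intro!: mult_left_mono intro: less_imp_le)
      moreover have "norm (f (x + y) - f y) < e / 2" using fx by blast
      moreover have "norm (f (x + y) * of_real (1 - plateau F (x + y)) - f y * of_real (1 - plateau F y))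
        \<le> norm (f (x + y) - f y) + norm f * \<bar>plateau F (x + y) - plateau F y\<bar>"
        using norm_cutoff_diff_le[of "f y" "norm f" "plateau F (x + y)" "plateau F y" 1 "f (x + y)" 1]
          F plateau_nonneg plateau_le_1 norm_bounded[of f y] by simp
      ultimately show "norm (f (x + y) * of_real (1 - plateau F (x + y))
        - f y * of_real (1 - plateau F y)) < e"
        using Bd by linarith
    qed
  qed
  have B: "norm (f y * of_real (1 - plateau F y)) \<le> norm f" for y
    unfolding norm_mult norm_of_real using plateau_nonneg[OF F, of y] plateau_le_1[OF F, of y]
      norm_bounded[of f y] by (intro mult_left_le[THEN order_trans]) auto
  show "tail f F \<in> LUC"
    unfolding tail_def by (rule Bcontfun_in_LUC(2)[OF uc B])
  show "tail f F y = f y * of_real (1 - plateau F y)"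
    unfolding tail_def Bcontfun_in_LUC(1)[OF uc B] by (rule refl)
qed

lemma orbit_encoding:
  assumes cover: "\<And>y. \<exists>d\<in>D. y - d \<in> V"
    and minimal: "\<And>E. (\<And>y. \<exists>d\<in>E. y - d \<in> V) \<Longrightarrow> |D| \<le>o |E|"
    and inf: "infinite D" and f: "f \<in> LUC"
  obtains h a where "h \<in> LUC"
    "\<And>F L y. F \<in> Fpow D \<Longrightarrow> L \<in> Fpow D \<Longrightarrow> y \<in> thick L \<Longrightarrow>
      h (y + a (F, L)) = f y * of_real (1 - plateau F y) * of_real (plateau L y)"
proof -
  define I where "I = Fpow D \<times> Fpow D"
  \<comment> \<open>The summand \<open>C\<close> is the margin for \<open>glue_left_uc\<close>: a
    shift by \<open>x \<in> V\<close> keeps \<open>thick L\<close> inside \<open>T\<close>, as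
    \<open>V \<subseteq> C\<close>.\<close>
  define T where "T = (\<lambda>(F :: 'a set, L). (\<lambda>p. fst p + snd p) ` (C \<times> thick L))"
  define S where "S = (\<lambda>(F :: 'a set, L). thick L)"
  define g where "g = (\<lambda>(F, L) y. f y * of_real (1 - plateau F y) * of_real (plateau L y))"
  have fin: "finite F" "finite L" if "(F, L) \<in> I" for F L
    using that by (auto simp: I_def Fpow_def)
  have "|I| \<le>o |D|"
    unfolding I_def using card_of_Fpow_infinite[OF inf] inf
    by (intro card_of_Times_ordLeq_infinite_Field) (auto simp: Field_card_of card_of_card_order_on)
  moreover have "compact (T i)" if "i \<in> I" for i
    using that fin unfolding T_def
    by (auto intro!: compact_continuous_image compact_Times C compact_thick continuous_intros
        split: prod.splits)
  ultimately obtain a where a: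
    "\<And>i j s t. i \<in> I \<Longrightarrow> j \<in> I \<Longrightarrow> i \<noteq> j \<Longrightarrow> s \<in> T i \<Longrightarrow> t \<in> T j \<Longrightarrow> s + a i \<noteq> t + a j"
    using disjoint_translates[OF V(1) cover minimal inf] by metis
  have uc: "left_uc f" using f by (simp add: LUC_iff_left_uc)
  have ST: "\<forall>\<^sub>F x in nhds 0. \<forall>i\<in>I. \<forall>s\<in>S i. x + s \<in> T i"
    using eventually_nhds_in_open[OF V]
  proof (rule eventually_mono, intro ballI)
    fix x i s assume "x \<in> V" "i \<in> I" "s \<in> S i"
    then show "x + s \<in> T i"
      using VC by (auto simp: T_def S_def split: prod.splits intro!: image_eqI[of _ _ "(x, s)"])
  qed
  obtain h where h: "left_uc h" "\<And>z. norm (h z) \<le> norm f"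
    "\<And>i y. i \<in> I \<Longrightarrow> y \<in> T i \<Longrightarrow> h (y + a i) = g i y"
  proof (rule glue_left_uc[of I g T a S "norm f"])
    show "\<forall>\<^sub>F x in nhds 0. \<forall>i\<in>I. \<forall>y. norm (g i (x + y) - g i y) < e" if "e > 0" for e
      using cutoff_equi_left_uc[OF uc norm_bounded that]
      by (rule eventually_mono) (use fin in \<open>auto simp: g_def\<close>)
    show "g i y = 0" if "i \<in> I" "y \<notin> S i" for i y
      using that fin plateau_eq_0 by (auto simp: g_def S_def split: prod.splits)
    show "norm (g i y) \<le> norm f" if "i \<in> I" for i y
    proof -
      obtain F L where i: "i = (F, L)" by (cases i)
      have "norm (g i y) = norm (f y) * ((1 - plateau F y) * plateau L y)"
        using plateau_nonneg plateau_le_1 fin that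
        by (simp add: g_def i norm_mult abs_of_nonneg del: of_real_diff)
      also have "\<dots> \<le> norm (f y) * 1"
        using plateau_nonneg plateau_le_1 fin that i by (intro mult_left_mono mult_le_one) auto
      also have "\<dots> \<le> norm f" using norm_bounded[of f y] by simp
      finally show ?thesis .
    qed
  qed (use a ST in auto)
  note hb = Bcontfun_in_LUC[OF h(1,2)]
  have "0 \<in> C" using V VC by auto
  show thesis
  proof (rule that[of "Bcontfun h" a])
    show "Bcontfun h (y + a (F, L)) = f y * of_real (1 - plateau F y) * of_real (plateau L y)"
      if "F \<in> Fpow D" "L \<in> Fpow D" "y \<in> thick L" for F L y
    proof -
      have "y \<in> T (F, L)"
        using \<open>0 \<in> C\<close> that(3) by (auto simp: T_def intro!: image_eqI[of _ _ "(0, y)"])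
      then show ?thesis using h(3)[of "(F, L)" y] that(1,2) by (simp add: hb I_def g_def)
    qed
  qed (rule hb)
qed

section \<open>Vanishing of the functional along the tails\<close>

lemma tail_tendsto_0:
  fixes m :: "('a \<Rightarrow>\<^sub>C complex) \<Rightarrow> complex"
  assumes cover: "\<And>y. \<exists>d\<in>D. y - d \<in> V"
    and minimal: "\<And>E. (\<And>y. \<exists>d\<in>E. y - d \<in> V) \<Longrightarrow> |D| \<le>o |E|"
    and f: "f \<in> LUC" and m: "m \<in> LUC_dual"
    and cont: "continuous_map (subtopology weak_star (weak_star closure_of (range point_eval)))
           weak_star (\<lambda>n. dual_mult m n)"
  shows "((\<lambda>F. m (tail f F)) \<longlongrightarrow> 0) (finite_subsets_at_top D)"
proof -
  have m0: "m 0 = 0" using LUC_dual_diff(2)[OF m f f] by simp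
  have ev: "\<forall>\<^sub>F L in finite_subsets_at_top D. finite L \<and> L \<subseteq> D \<and> d \<in> L \<and> F \<subseteq> L"
    if "d \<in> D" "F \<in> Fpow D" for d F
    unfolding eventually_finite_subsets_at_top
    by (intro exI[of _ "insert d F"]) (use that in \<open>auto simp: Fpow_def\<close>)
  show ?thesis
  proof (cases "finite D")
    case True
    \<comment> \<open>For finite \<open>D\<close> the filter is principal at \<open>D\<close>, and
      \<open>plateau D\<close> is identically \<open>1\<close> because the translates cover.\<close>
    have "tail f D = 0"
    proof (rule bcontfun_eqI)
      fix y
      obtain d where "d \<in> D" "y - d \<in> V" using cover by blast
      then show "tail f D y = apply_bcontfun 0 y"
        using tail(2)[OF f True] plateau_eq_1[OF True] by simp
    qed
    then show ?thesis
      using True m0 by (intro tendsto_eventually) (auto simp: finite_subsets_at_top_finite eventually_principal)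
  next
    case False
    obtain h a where h: "h \<in> LUC" "\<And>F L y. F \<in> Fpow D \<Longrightarrow> L \<in> Fpow D \<Longrightarrow> y \<in> thick L \<Longrightarrow>
      h (y + a (F, L)) = f y * of_real (1 - plateau F y) * of_real (plateau L y)"
      using orbit_encoding[OF cover minimal False f] by metis
    have h': "h (y + a (F, L)) = tail f F y"
      if "F \<in> Fpow D" "L \<in> Fpow D" "d \<in> L" "y - d \<in> V" for F L y d
    proof -
      have "y \<in> thick L" using that VC by (intro thick_if) auto
      then show ?thesis
        using h(2)[OF that(1,2)] tail(2)[OF f, of F] plateau_eq_1[of L d y] that
        by (auto simp: Fpow_def)
    qed
    define \<phi> where "\<phi> = (\<lambda>x. m (dual_act (point_eval x) h))"
    \<comment> \<open>For fixed \<open>F\<close>, each \<open>y\<close> lies on the plateau of all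
      sufficiently large \<open>L\<close>, and there the double cut-off reduces to the tail.\<close>
    have inner: "((\<lambda>L. \<phi> (a (F, L))) \<longlongrightarrow> m (tail f F)) (finite_subsets_at_top D)"
      if F: "F \<in> Fpow D" for F
    proof -
      have "(\<phi> \<longlongrightarrow> m (tail f F)) (filtermap (\<lambda>L. a (F, L)) (finite_subsets_at_top D))"
        unfolding \<phi>_def
      proof (rule functional_continuous_on_orbit[OF cont h(1)])
        fix y
        obtain d where "d \<in> D" "y - d \<in> V" using cover by blast
        then have "\<forall>\<^sub>F L in finite_subsets_at_top D. h (y + a (F, L)) = tail f F y"
          using ev[OF \<open>d \<in> D\<close> F] h'[OF F] by (auto elim!: eventually_mono simp: Fpow_def)
        then show "((\<lambda>x. h (y + x)) \<longlongrightarrow> tail f F y)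
            (filtermap (\<lambda>L. a (F, L)) (finite_subsets_at_top D))"
          unfolding filterlim_filtermap by (rule tendsto_eventually)
      qed
      then show ?thesis by (simp add: filterlim_filtermap)
    qed
    show ?thesis
    proof (rule tendstoI)
      fix e :: real assume "e > 0"
      \<comment> \<open>The requirement \<open>F \<subseteq> L\<close> puts every
        \<open>d \<in> F\<close> into \<open>L\<close>. So at a point \<open>y\<close> with
        \<open>y - d \<in> V\<close> the value of \<open>h\<close> is known: it is that of the tail,
        which vanishes there since \<open>d \<in> F\<close>. Hence the translates along
        \<open>F \<mapsto> a (F, \<Lambda> F)\<close> tend to \<open>0\<close> pointwise.\<close>
      have "\<exists>L. F \<in> Fpow D \<longrightarrow> L \<in> Fpow D \<and> F \<subseteq> L \<and> dist (\<phi> (a (F, L))) (m (tail f F)) < e / 2" for F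
      proof (cases "F \<in> Fpow D")
        case True
        obtain d where "d \<in> D" using cover by blast
        have "\<forall>\<^sub>F L in finite_subsets_at_top D.
            (finite L \<and> L \<subseteq> D \<and> d \<in> L \<and> F \<subseteq> L) \<and> dist (\<phi> (a (F, L))) (m (tail f F)) < e / 2"
          by (rule eventually_conj[OF ev[OF \<open>d \<in> D\<close> True]
              tendstoD[OF inner[OF True] half_gt_zero[OF \<open>e > 0\<close>]]])
        from eventually_happens'[OF finite_subsets_at_top_neq_bot this]
        show ?thesis by (auto simp: Fpow_def)
      qed auto
      then obtain \<Lambda> where \<Lambda>: "\<And>F. F \<in> Fpow D \<Longrightarrow>
          \<Lambda> F \<in> Fpow D \<and> F \<subseteq> \<Lambda> F \<and> dist (\<phi> (a (F, \<Lambda> F))) (m (tail f F)) < e / 2"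
        by metis
      have "(\<phi> \<longlongrightarrow> m 0) (filtermap (\<lambda>F. a (F, \<Lambda> F)) (finite_subsets_at_top D))"
        unfolding \<phi>_def
      proof (rule functional_continuous_on_orbit[OF cont h(1)])
        fix y
        obtain d where d: "d \<in> D" "y - d \<in> V" using cover by blast
        have zero: "h (y + a (F, \<Lambda> F)) = 0" if "F \<in> Fpow D" "d \<in> F" for F
        proof -
          have "h (y + a (F, \<Lambda> F)) = tail f F y"
            using h'[of F "\<Lambda> F" d y] \<Lambda>[OF that(1)] that d by blast
          also have "\<dots> = 0"
            using that d plateau_eq_1[of F d y] tail(2)[OF f, of F] by (auto simp: Fpow_def)
          finally show ?thesis .
        qed
        have "{} \<in> Fpow D" by (rule empty_in_Fpow)
        from ev[OF d(1) this]
        have "\<forall>\<^sub>F F in finite_subsets_at_top D. h (y + a (F, \<Lambda> F)) = apply_bcontfun 0 y"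
          by (rule eventually_mono) (use zero in \<open>auto simp: Fpow_def\<close>)
        then show "((\<lambda>x. h (y + x)) \<longlongrightarrow> apply_bcontfun 0 y)
            (filtermap (\<lambda>F. a (F, \<Lambda> F)) (finite_subsets_at_top D))"
          unfolding filterlim_filtermap by (rule tendsto_eventually)
      qed
      then have "((\<lambda>F. \<phi> (a (F, \<Lambda> F))) \<longlongrightarrow> 0) (finite_subsets_at_top D)"
        by (simp add: filterlim_filtermap m0)
      from tendstoD[OF this half_gt_zero[OF \<open>e > 0\<close>]] eventually_finite_subsets_at_top_weakI
      show "\<forall>\<^sub>F F in finite_subsets_at_top D. dist (m (tail f F)) 0 < e"
      proof (rule eventually_elim2[where Q = "\<lambda>F. F \<in> Fpow D"])
        fix F assume 1: "dist (\<phi> (a (F, \<Lambda> F))) 0 < e / 2" and F: "F \<in> Fpow D"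
        have "dist (\<phi> (a (F, \<Lambda> F))) (m (tail f F)) < e / 2" using \<Lambda>[OF F] by blast
        then show "dist (m (tail f F)) 0 < e"
          using 1 dist_triangle_half_r[of "\<phi> (a (F, \<Lambda> F))" "m (tail f F)" e 0] by blast
      qed (auto simp: Fpow_def)
    qed
  qed
qed

end

text \<open>Prescribing \<open>K\<close> allows the cut-off to be adapted to a compact set that
  already carries almost all of a measure, so that the remainder \<open>r\<close> is small both for
  \<open>m\<close> and for the measure.\<close>

lemma functional_tight:
  fixes m :: "('a::{topological_group_add, t2_space} \<Rightarrow>\<^sub>C complex) \<Rightarrow> complex"
  assumes lc: "locally_compact_space (euclidean :: 'a topology)"
    and m: "m \<in> LUC_dual"
    and cont: "continuous_map (subtopology weak_star (weak_star closure_of (range point_eval)))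
           weak_star (\<lambda>n. dual_mult m n)"
    and f: "f \<in> LUC" and K: "compact K" and "e > 0"
  obtains u :: "'a \<Rightarrow> real" and K' r where "continuous_on UNIV u" "\<And>x. 0 \<le> u x" "\<And>x. u x \<le> 1"
    "compact K'" "\<And>x. x \<notin> K' \<Longrightarrow> u x = 0" "\<And>x. x \<in> K \<Longrightarrow> u x = 1"
    "r \<in> LUC" "\<And>x. r x = f x * of_real (1 - u x)" "norm (m r) < e"
proof -
  obtain w :: "'a \<Rightarrow> real" and C V where "bump w C V" using bump_exists[OF lc] by blast
  then interpret bump w C V .
  have "\<exists>D. \<forall>y. \<exists>d\<in>D. y - d \<in> V" using V(2) by (intro exI[of _ UNIV]) (metis UNIV_I diff_self)
  then obtain D where cover: "\<forall>y. \<exists>d\<in>D. y - d \<in> V"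
    and minimal: "\<And>E. \<forall>y. \<exists>d\<in>E. y - d \<in> V \<Longrightarrow> |D| \<le>o |E|"
    by (rule minimal_cover_obtain[of "\<lambda>D. \<forall>y. \<exists>d\<in>D. y - d \<in> V"]) auto
  have "((\<lambda>F. m (tail f F)) \<longlongrightarrow> 0) (finite_subsets_at_top D)"
    using tail_tendsto_0[OF _ _ f m cont, of D] cover minimal by blast
  from tendstoD[OF this \<open>e > 0\<close>]
  obtain X where X: "finite X" "X \<subseteq> D"
    "\<And>F. finite F \<Longrightarrow> X \<subseteq> F \<Longrightarrow> F \<subseteq> D \<Longrightarrow> norm (m (tail f F)) < e"
    unfolding eventually_finite_subsets_at_top by auto
  \<comment> \<open>Adding \<open>F\<close> to \<open>X\<close> makes the cut-off equal to
    \<open>1\<close> on \<open>K\<close>; smallness of the tail persists for every finite superset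
    of \<open>X\<close> inside \<open>D\<close>.\<close>
  obtain F where F: "finite F" "F \<subseteq> D" "\<forall>y\<in>K. \<exists>d\<in>F. y - d \<in> V"
    using finite_cover_translates[OF V(1) _ K, of D] cover by blast
  have XF: "finite (X \<union> F)" using X(1) F(1) by simp
  show thesis
  proof (rule that[of "plateau (X \<union> F)" "thick (X \<union> F)" "tail f (X \<union> F)"])
    show "plateau (X \<union> F) x = 1" if "x \<in> K" for x
      using F(3) that plateau_eq_1[OF XF] by blast
    show "tail f (X \<union> F) x = f x * of_real (1 - plateau (X \<union> F) x)" for x
      by (rule tail(2)[OF f XF])
    show "norm (m (tail f (X \<union> F))) < e" using X F by (intro X(3)) auto
  qed (use XF f in \<open>auto intro: continuous_plateau plateau_nonneg plateau_le_1 compact_thick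
        plateau_eq_0 tail\<close>)
qed


section \<open>The Riesz representation theorem for bounded positive functionals\<close>

text \<open>Working on the positive cone makes it possible to use the positive part of a functional
  directly where the supremum defines it, without extending it linearly to differences.\<close>

definition Cc_nonneg :: "('a::topological_space \<Rightarrow> real) set"
  where "Cc_nonneg = {f. continuous_on UNIV f \<and> (\<forall>x. 0 \<le> f x) \<and>
    (\<exists>K. compact K \<and> (\<forall>x. x \<notin> K \<longrightarrow> f x = 0))}"

lemma Cc_nonnegI:
  assumes "continuous_on UNIV f" "\<And>x. 0 \<le> f x" "compact K" "\<And>x. x \<notin> K \<Longrightarrow> f x = 0"
  shows "f \<in> Cc_nonneg"
  using assms by (auto simp: Cc_nonneg_def)

lemma Cc_nonnegD:
  assumes "f \<in> Cc_nonneg"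
  shows "continuous_on UNIV f" "0 \<le> f x" "\<exists>K. compact K \<and> (\<forall>x. x \<notin> K \<longrightarrow> f x = 0)"
  using assms by (auto simp: Cc_nonneg_def)

lemma Cc_nonneg_mono:
  assumes "f \<in> Cc_nonneg" "continuous_on UNIV g" "\<And>x. 0 \<le> g x" "\<And>x. f x = 0 \<Longrightarrow> g x = 0"
  shows "g \<in> Cc_nonneg"
  using assms by (auto simp: Cc_nonneg_def)

lemma Cc_nonneg_add:
  assumes "f \<in> Cc_nonneg" "g \<in> Cc_nonneg"
  shows "(\<lambda>x. f x + g x) \<in> Cc_nonneg"
proof -
  obtain K K' where "compact K" "\<forall>x. x \<notin> K \<longrightarrow> f x = 0" "compact K'" "\<forall>x. x \<notin> K' \<longrightarrow> g x = 0"
    using assms[THEN Cc_nonnegD(3)] by blast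
  then show ?thesis
    using assms by (intro Cc_nonnegI[of _ "K \<union> K'"] continuous_intros) (auto simp: Cc_nonneg_def)
qed

lemma Cc_nonneg_bounded:
  assumes "f \<in> Cc_nonneg"
  obtains M where "\<And>x. f x \<le> M" "0 \<le> M"
proof -
  obtain K where K: "compact K" "\<forall>x. x \<notin> K \<longrightarrow> f x = 0" using Cc_nonnegD(3)[OF assms] by blast
  have "compact (f ` K)"
    using K(1) Cc_nonnegD(1)[OF assms] by (blast intro: compact_continuous_image continuous_on_subset)
  then obtain M where "\<And>y. y \<in> f ` K \<Longrightarrow> norm y \<le> M"
    using compact_imp_bounded bounded_iff by metis
  then have "f x \<le> max M 0" for x
    using K(2) by (cases "x \<in> K") force+
  then show thesis using that[of "max M 0"] by simp
qed

text \<open>Inner and outer regularity are packed into one condition on \<open>U - K\<close>, so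
  that later several measures can be approximated by a single pair of sets.\<close>

definition radon_measure :: "'a::topological_space measure \<Rightarrow> bool"
  where "radon_measure M \<longleftrightarrow> sets M = sets borel \<and> finite_measure M \<and>
    (\<forall>A\<in>sets borel. \<forall>e>0. \<exists>K U. compact K \<and> open U \<and> K \<subseteq> A \<and> A \<subseteq> U \<and> measure M (U - K) < e)"

text \<open>The only scaling used in the representation is by natural numbers, and this follows from
  additivity (\<open>L_of_nat_mult\<close>). The constant \<open>B\<close> stands for the norm of
  the functional and bounds the total mass.\<close>

locale positive_functional =
  fixes L :: "('a::t2_space \<Rightarrow> real) \<Rightarrow> real" and B :: real
  assumes lc: "locally_compact_space (euclidean :: 'a topology)"
    and add: "f \<in> Cc_nonneg \<Longrightarrow> g \<in> Cc_nonneg \<Longrightarrow> L (\<lambda>x. f x + g x) = L f + L g"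
    and nonneg: "f \<in> Cc_nonneg \<Longrightarrow> 0 \<le> L f"
    and bound: "f \<in> Cc_nonneg \<Longrightarrow> (\<And>x. f x \<le> c) \<Longrightarrow> L f \<le> B * c"
begin

lemma zero_in: "(\<lambda>x. 0) \<in> (Cc_nonneg :: ('a \<Rightarrow> real) set)"
  by (rule Cc_nonnegI[of _ "{}"]) auto

lemma L_0: "L (\<lambda>x. 0) = 0"
  using add[OF zero_in zero_in] by simp

lemma mono:
  assumes "f \<in> Cc_nonneg" "g \<in> Cc_nonneg" "\<And>x. f x \<le> g x"
  shows "L f \<le> L g"
proof -
  have "(\<lambda>x. g x - f x) \<in> Cc_nonneg"
  proof (rule Cc_nonneg_mono[OF assms(2)])
    show "g x = 0 \<Longrightarrow> g x - f x = 0" for x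
      using assms(3)[of x] Cc_nonnegD(2)[OF assms(1), of x] by simp
    show "0 \<le> g x - f x" for x using assms(3)[of x] by simp
  qed (intro continuous_intros Cc_nonnegD(1) assms)
  from add[OF assms(1) this] nonneg[OF this] show ?thesis by simp
qed

lemma sum_in:
  fixes f :: "nat \<Rightarrow> 'a \<Rightarrow> real"
  shows "(\<And>k. k < n \<Longrightarrow> f k \<in> Cc_nonneg) \<Longrightarrow> (\<lambda>x. \<Sum>k<n. f k x) \<in> Cc_nonneg"
  by (induction n) (auto intro: zero_in Cc_nonneg_add)

lemma L_sum:
  fixes f :: "nat \<Rightarrow> 'a \<Rightarrow> real"
  shows "(\<And>k. k < n \<Longrightarrow> f k \<in> Cc_nonneg) \<Longrightarrow> L (\<lambda>x. \<Sum>k<n. f k x) = (\<Sum>k<n. L (f k))"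
  by (induction n) (simp_all add: L_0 add sum_in)

lemma L_of_nat_mult:
  assumes "f \<in> Cc_nonneg"
  shows "L (\<lambda>x. real n * f x) = real n * L f"
  using L_sum[of n "\<lambda>_. f"] assms by simp

text \<open>
  Functions in \<open>below U\<close> need not have their support inside \<open>U\<close>; truncating them at a small height
  (\<open>L_le_if_compact\<close>) reduces to that case.
\<close>

definition below :: "'a set \<Rightarrow> ('a \<Rightarrow> real) set"
  where "below U = {f \<in> Cc_nonneg. (\<forall>x. f x \<le> 1) \<and> (\<forall>x. x \<notin> U \<longrightarrow> f x = 0)}"

definition content :: "'a set \<Rightarrow> ennreal"
  where "content U = (SUP f\<in>below U. ennreal (L f))"

definition outer :: "'a set \<Rightarrow> ennreal"
  where "outer A = (INF U\<in>{U. open U \<and> A \<subseteq> U}. content U)"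

lemma B_nonneg: "0 \<le> B"
  using bound[OF zero_in, of 1] by (simp add: L_0)

lemma content_upper: "f \<in> below U \<Longrightarrow> ennreal (L f) \<le> content U"
  unfolding content_def by (rule SUP_upper)

lemma content_mono: "U \<subseteq> V \<Longrightarrow> content U \<le> content V"
  unfolding content_def by (rule SUP_subset_mono) (auto simp: below_def)

lemma content_le_B: "content U \<le> ennreal B"
  unfolding content_def using bound[of _ 1] by (intro SUP_least ennreal_leI) (auto simp: below_def)

lemma outer_open: "open U \<Longrightarrow> outer U = content U"
  unfolding outer_def by (intro antisym INF_lower INF_greatest content_mono) auto

lemma outer_mono: "A \<subseteq> A' \<Longrightarrow> outer A \<le> outer A'"
  unfolding outer_def by (rule INF_superset_mono) auto

lemma outer_le_B: "outer A \<le> ennreal B"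
  using outer_mono[of A UNIV] outer_open[of UNIV] content_le_B[of UNIV] by simp

lemma L_le_if_compact:
  assumes f: "f \<in> below U"
    and le: "\<And>g K. g \<in> below U \<Longrightarrow> compact K \<Longrightarrow> K \<subseteq> U \<Longrightarrow> (\<And>x. x \<notin> K \<Longrightarrow> g x = 0) \<Longrightarrow> ennreal (L g) \<le> c"
  shows "ennreal (L f) \<le> c"
proof (rule ennreal_le_epsilon)
  fix e :: real assume "e > 0"
  \<comment> \<open>Truncation at height \<open>d\<close> discards a function bounded by
    \<open>d\<close>, at a cost of at most \<open>B * d \<le> e\<close>. What remains vanishes
    outside the part of \<open>K\<close> where \<open>d \<le> f\<close>, which is compact and
    contained in \<open>U\<close>.\<close>
  define d where "d = e / (B + 1)"
  have "d > 0" using \<open>e > 0\<close> B_nonneg by (simp add: d_def)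
  have "(B + 1) * d = e" using B_nonneg by (simp add: d_def)
  then have Bd: "B * d \<le> e" using \<open>d > 0\<close> by (simp add: distrib_right)
  define g where "g x = max 0 (f x - d)" for x
  define g' where "g' x = min (f x) d" for x
  have fC: "f \<in> Cc_nonneg" using f by (simp add: below_def)
  note f_cont = Cc_nonnegD(1)[OF fC] and f_nonneg = Cc_nonnegD(2)[OF fC]
  have g: "g \<in> Cc_nonneg" and g': "g' \<in> Cc_nonneg"
    unfolding g_def g'_def using \<open>d > 0\<close> f_nonneg
    by (auto intro!: Cc_nonneg_mono[OF fC] continuous_intros f_cont)
  have "f = (\<lambda>x. g x + g' x)" by (auto simp: g_def g'_def)
  then have "L f = L g + L g'" using add[OF g g'] by simp
  moreover have "L g' \<le> B * d" by (rule bound[OF g']) (simp add: g'_def)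
  ultimately have Lf: "L f \<le> L g + e" using Bd by linarith
  obtain K where K: "compact K" "\<forall>x. x \<notin> K \<longrightarrow> f x = 0" using Cc_nonnegD(3)[OF fC] by blast
  have "closed {x. d \<le> f x}" by (intro closed_Collect_le continuous_intros f_cont)
  then have "compact ({x. d \<le> f x} \<inter> K)" using K(1) by (rule closed_Int_compact)
  moreover have "{x. d \<le> f x} \<inter> K \<subseteq> U" using f \<open>d > 0\<close> by (force simp: below_def)
  moreover have "g x = 0" if "x \<notin> {x. d \<le> f x} \<inter> K" for x
    using that K(2) \<open>d > 0\<close> by (auto simp: g_def max_def)
  moreover have "g \<in> below U"
  proof -
    have "f x - d \<le> 1" "x \<notin> U \<longrightarrow> f x = 0" for x
      using f \<open>d > 0\<close> by (auto simp: below_def intro: order_trans[of _ "f x"])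
    then show ?thesis using g \<open>d > 0\<close> by (simp add: below_def g_def)
  qed
  ultimately have "ennreal (L g) \<le> c" using le by blast
  have "ennreal (L f) \<le> ennreal (L g + e)" by (rule ennreal_leI[OF Lf])
  also have "\<dots> = ennreal (L g) + ennreal e" using nonneg[OF g] \<open>e > 0\<close> by simp
  also have "\<dots> \<le> c + ennreal e" by (rule add_right_mono) fact
  finally show "ennreal (L f) \<le> c + ennreal e" .
qed

lemma content_Un:
  assumes "open U" "open V"
  shows "content (U \<union> V) \<le> content U + content V"
  unfolding content_def[of "U \<union> V"]
proof (rule SUP_least, erule L_le_if_compact)
  fix f K assume f: "f \<in> below (U \<union> V)" and K: "compact K" "K \<subseteq> U \<union> V" "\<And>x. x \<notin> K \<Longrightarrow> f x = 0"
  have fC: "f \<in> Cc_nonneg" and f1: "f x \<le> 1" for x using f by (auto simp: below_def)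
  have "compact (K - V)" using K(1) assms(2) by (rule compact_diff)
  \<comment> \<open>As \<open>k\<close> is \<open>1\<close> on \<open>K - V\<close> and
    \<open>0\<close> off \<open>U\<close>, the product \<open>f * k\<close> lives in
    \<open>U\<close>, and \<open>f * (1 - k)\<close> vanishes off \<open>V\<close>.\<close>
  then obtain k :: "'a \<Rightarrow> real" where k: "continuous_on UNIV k" "\<And>x. 0 \<le> k x" "\<And>x. k x \<le> 1"
    "\<And>x. x \<in> K - V \<Longrightarrow> k x = 1" "\<And>x. x \<notin> U \<Longrightarrow> k x = 0"
    using Urysohn_compact_open[OF lc, of "K - V" U] assms(1) K(2) by blast
  define f1' where "f1' x = f x * k x" for x
  define f2' where "f2' x = f x * (1 - k x)" for x
  note fc = Cc_nonnegD(1)[OF fC] and fn = Cc_nonnegD(2)[OF fC]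
  have C: "f1' \<in> Cc_nonneg" "f2' \<in> Cc_nonneg"
    unfolding f1'_def f2'_def using k(2,3) fn
    by (auto intro!: Cc_nonneg_mono[OF fC] continuous_intros fc k(1))
  have "f1' \<in> below U"
    using C k(5) fn f1 k(2,3) by (auto simp: below_def f1'_def intro: mult_le_one)
  moreover have "f2' \<in> below V"
  proof -
    have "f2' x = 0" if "x \<notin> V" for x
      using that K(3)[of x] k(4)[of x] by (cases "x \<in> K") (auto simp: f2'_def)
    then show ?thesis
      using C fn f1 k(2,3) by (auto simp: below_def f2'_def intro: mult_le_one)
  qed
  moreover have "L f = L f1' + L f2'"
    using add[OF C] by (simp add: f1'_def f2'_def algebra_simps)
  ultimately show "ennreal (L f) \<le> content U + content V"
    using nonneg C by (auto intro!: add_mono content_upper)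
qed

lemma content_empty: "content {} = 0"
proof -
  have "f = (\<lambda>x. 0)" if "f \<in> below {}" for f using that by (auto simp: below_def)
  then show ?thesis using L_0 unfolding content_def by (intro antisym SUP_least) auto
qed

lemma content_UN_lessThan:
  fixes U :: "nat \<Rightarrow> 'a set"
  assumes "\<And>i. open (U i)"
  shows "content (\<Union>i<n. U i) \<le> (\<Sum>i<n. content (U i))"
proof (induction n)
  case (Suc n)
  have "content (\<Union>i<Suc n. U i) = content ((\<Union>i<n. U i) \<union> U n)"
    by (simp add: lessThan_Suc Un_commute)
  also have "\<dots> \<le> content (\<Union>i<n. U i) + content (U n)"
    using assms by (intro content_Un) auto
  finally show ?case using Suc by (auto intro: order_trans add_right_mono)
qed (simp add: content_empty)

lemma content_UN:
  fixes U :: "nat \<Rightarrow> 'a set"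
  assumes "\<And>i. open (U i)"
  shows "content (\<Union>i. U i) \<le> (\<Sum>i. content (U i))"
  unfolding content_def[of "\<Union>i. U i"]
proof (rule SUP_least, erule L_le_if_compact)
  fix f K assume f: "f \<in> below (\<Union>i. U i)" and K: "compact K" "K \<subseteq> (\<Union>i. U i)" "\<And>x. x \<notin> K \<Longrightarrow> f x = 0"
  obtain I where I: "finite I" "K \<subseteq> (\<Union>i\<in>I. U i)"
    using compactE_image[OF K(1), of UNIV U] assms K(2) by metis
  obtain n where "I \<subseteq> {..<n}" using finite_nat_bounded[OF I(1)] by blast
  then have "K \<subseteq> (\<Union>i<n. U i)" using I(2) by blast
  then have "f x = 0" if "x \<notin> (\<Union>i<n. U i)" for x using that K(3) by blast
  then have "f \<in> below (\<Union>i<n. U i)" using f by (simp add: below_def)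
  then have "ennreal (L f) \<le> content (\<Union>i<n. U i)" by (rule content_upper)
  also have "\<dots> \<le> (\<Sum>i<n. content (U i))" by (rule content_UN_lessThan[OF assms])
  also have "\<dots> \<le> (\<Sum>i. content (U i))" by (rule sum_le_suminf) auto
  finally show "ennreal (L f) \<le> (\<Sum>i. content (U i))" .
qed

section \<open>Caratheodory measurability of open sets\<close>

lemma outer_approx:
  assumes "e > 0"
  obtains U where "open U" "A \<subseteq> U" "content U < outer A + ennreal e"
proof -
  have "outer A \<noteq> \<infinity>" using outer_le_B[of A] by (metis ennreal_neq_top infinity_ennreal_def neq_top_trans)
  then show thesis
    using INF_approx_ennreal[where e = e and x = "outer A" and A = "{U. open U \<and> A \<subseteq> U}" and f = content] assms that
    by (auto simp: outer_def)
qed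

lemma outer_measure_space_outer: "outer_measure_space (Pow UNIV) outer"
  unfolding outer_measure_space_def
proof (intro conjI)
  show "positive (Pow UNIV) outer"
    using outer_open[of "{}"] by (simp add: positive_def content_empty)
  show "increasing (Pow UNIV) outer" by (simp add: increasing_def outer_mono)
  show "countably_subadditive (Pow UNIV) outer"
  proof (unfold countably_subadditive_def, intro allI impI)
    fix A :: "nat \<Rightarrow> 'a set"
    show "outer (\<Union>i. A i) \<le> (\<Sum>i. outer (A i))"
    proof (rule ennreal_le_epsilon)
      fix e :: real assume "e > 0"
      have "\<exists>U. open U \<and> A i \<subseteq> U \<and> content U < outer (A i) + ennreal (e * (1/2)^Suc i)" for i
        using outer_approx[of "e * (1/2)^Suc i" "A i"] \<open>e > 0\<close> by (metis half_gt_zero_iff mult_pos_pos zero_less_one zero_less_power)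
      then obtain U where U: "\<And>i. open (U i)" "\<And>i. A i \<subseteq> U i"
        "\<And>i. content (U i) < outer (A i) + ennreal (e * (1/2)^Suc i)"
        by metis
      have "outer (\<Union>i. A i) \<le> outer (\<Union>i. U i)" using U(2) by (intro outer_mono) blast
      also have "\<dots> = content (\<Union>i. U i)" using U(1) by (intro outer_open) auto
      also have "\<dots> \<le> (\<Sum>i. content (U i))" by (rule content_UN[OF U(1)])
      also have "\<dots> \<le> (\<Sum>i. outer (A i) + ennreal (e * (1/2)^Suc i))"
        using U(3) by (intro suminf_le) (auto intro: less_imp_le)
      also have "\<dots> = (\<Sum>i. outer (A i)) + (\<Sum>i. ennreal (e * (1/2)^Suc i))"
        by (intro suminf_add[symmetric]) auto
      also have "(\<Sum>i. ennreal (e * (1/2)^Suc i)) = ennreal e"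
        using \<open>e > 0\<close> sums_mult[OF power_half_series, of e]
        by (subst suminf_ennreal2) (auto simp: sums_iff)
      finally show "outer (\<Union>i. A i) \<le> (\<Sum>i. outer (A i)) + ennreal e" .
    qed
  qed
qed

text \<open>Let \<open>g\<close> vanish outside a compact \<open>K \<subseteq> W \<inter> U\<close>.
  Then \<open>W - K\<close> is an open set containing \<open>W - U\<close>, and every function below
  \<open>W - K\<close> can be added to \<open>g\<close> without exceeding \<open>1\<close>, since at
  each point one of the two vanishes.\<close>

lemma content_split:
  assumes "open U" "open W"
  shows "content (W \<inter> U) + outer (W - U) \<le> content W"
proof -
  have "ennreal (L f) + outer (W - U) \<le> content W" if "f \<in> below (W \<inter> U)" for f
  proof -
    \<comment> \<open>\<open>L_le_if_compact\<close> bounds \<open>L f\<close> alone, so the finite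
      quantity \<open>outer (W - U)\<close> is moved to the right-hand side first.\<close>
    have "ennreal (L f) \<le> content W - outer (W - U)"
      using that
    proof (rule L_le_if_compact)
      fix g K assume g: "g \<in> below (W \<inter> U)" and K: "compact K" "K \<subseteq> W \<inter> U" "\<And>x. x \<notin> K \<Longrightarrow> g x = 0"
      have op: "open (W - K)" using assms(2) K(1) by (intro open_Diff compact_imp_closed)
      have "ennreal (L g) + ennreal (L k) \<le> content W" if k: "k \<in> below (W - K)" for k
      proof -
        have gC: "g \<in> Cc_nonneg" and kC: "k \<in> Cc_nonneg" using g k by (auto simp: below_def)
        have "g x = 0 \<or> k x = 0" for x using K(3)[of x] k by (auto simp: below_def)
        then have "(\<lambda>x. g x + k x) \<in> below W"
          using g k Cc_nonneg_add[OF gC kC] unfolding below_def by (auto, metis add.left_neutral add.right_neutral)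
        then have "ennreal (L (\<lambda>x. g x + k x)) \<le> content W" by (rule content_upper)
        then show ?thesis using add[OF gC kC] nonneg gC kC by simp
      qed
      moreover have "below (W - K) \<noteq> {}" using zero_in by (auto simp: below_def)
      ultimately have "ennreal (L g) + content (W - K) \<le> content W"
        unfolding content_def[of "W - K"]
        by (subst ennreal_SUP_add_right) (auto intro!: SUP_least)
      moreover have "outer (W - U) \<le> content (W - K)"
        unfolding outer_def using op K(2) by (intro INF_lower) auto
      ultimately have "ennreal (L g) + outer (W - U) \<le> content W"
        by (meson add_left_mono order_trans)
      then show "ennreal (L g) \<le> content W - outer (W - U)"
        using outer_le_B[of "W - U"]
        by (simp add: ennreal_le_minus_iff add.commute)
    qed
    moreover have "outer (W - U) \<le> content W"
      using outer_mono[of "W - U" W] outer_open[OF assms(2)] by auto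
    ultimately show ?thesis
      by (metis add_right_mono diff_add_cancel_ennreal)
  qed
  moreover have "below (W \<inter> U) \<noteq> {}" using zero_in by (auto simp: below_def)
  ultimately show ?thesis
    unfolding content_def[of "W \<inter> U"]
    by (subst ennreal_SUP_add_left[symmetric]) (auto intro!: SUP_least)
qed

text \<open>\<open>content_split\<close> gives the inequality for open test sets \<open>W\<close>;
  taking the infimum over \<open>W \<supseteq> A\<close> gives it for all \<open>A\<close>. The
  converse is finite subadditivity.\<close>

lemma open_in_lambda_system:
  assumes "open U"
  shows "U \<in> lambda_system UNIV (Pow UNIV) outer"
proof -
  have "outer (U \<inter> A) + outer (- U \<inter> A) = outer A" for A
  proof (rule antisym)
    show "outer (U \<inter> A) + outer (- U \<inter> A) \<le> outer A"
      unfolding outer_def[of A]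
    proof (rule INF_greatest, clarsimp)
      fix W assume W: "open W" "A \<subseteq> W"
      have "outer (U \<inter> A) \<le> content (W \<inter> U)"
        unfolding outer_def using W assms by (intro INF_lower) auto
      moreover have "outer (- U \<inter> A) \<le> outer (W - U)" using W by (intro outer_mono) auto
      ultimately have "outer (U \<inter> A) + outer (- U \<inter> A) \<le> content (W \<inter> U) + outer (W - U)"
        by (rule add_mono)
      also have "\<dots> \<le> content W" by (rule content_split[OF assms W(1)])
      finally show "outer (U \<inter> A) + outer (- U \<inter> A) \<le> content W" .
    qed
    show "outer A \<le> outer (U \<inter> A) + outer (- U \<inter> A)"
    proof (rule ennreal_le_epsilon)
      fix e :: real assume "e > 0"
      obtain V where V: "open V" "U \<inter> A \<subseteq> V" "content V < outer (U \<inter> A) + ennreal (e / 2)"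
        using outer_approx[of "e / 2"] \<open>e > 0\<close> by (metis half_gt_zero)
      obtain V' where V': "open V'" "- U \<inter> A \<subseteq> V'" "content V' < outer (- U \<inter> A) + ennreal (e / 2)"
        using outer_approx[of "e / 2"] \<open>e > 0\<close> by (metis half_gt_zero)
      have "outer A \<le> content (V \<union> V')"
        unfolding outer_def[of A] using V V' by (intro INF_lower) auto
      also have "\<dots> \<le> content V + content V'" by (rule content_Un[OF V(1) V'(1)])
      also have "\<dots> \<le> (outer (U \<inter> A) + ennreal (e / 2)) + (outer (- U \<inter> A) + ennreal (e / 2))"
        using V(3) V'(3) by (intro add_mono less_imp_le)
      also have "\<dots> = outer (U \<inter> A) + outer (- U \<inter> A) + (ennreal (e / 2) + ennreal (e / 2))"
        by (simp add: ac_simps)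
      also have "ennreal (e / 2) + ennreal (e / 2) = ennreal e"
        using \<open>e > 0\<close> by (simp flip: ennreal_plus)
      finally show "outer A \<le> outer (U \<inter> A) + outer (- U \<inter> A) + ennreal e" .
    qed
  qed
  then show ?thesis by (auto simp: lambda_system_def Compl_eq_Diff_UNIV)
qed

section \<open>The representing measure, its integral and its regularity\<close>

definition M :: "'a measure" where "M = measure_of UNIV (sets borel) outer"

lemma sets_M [measurable_cong]: "sets M = sets borel"
  unfolding M_def using sets.sigma_sets_eq[of "borel :: 'a measure"] by (simp add: sets_measure_of_conv)

lemma emeasure_M:
  assumes "A \<in> sets borel"
  shows "emeasure M A = outer A"
proof -
  have ms: "measure_space UNIV (lambda_system UNIV (Pow UNIV) outer) outer"
    using sigma_algebra.caratheodory_lemma[OF sigma_algebra_Pow outer_measure_space_outer] by simp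
  then have sa: "sigma_algebra UNIV (lambda_system UNIV (Pow UNIV) outer)"
    by (simp add: measure_space_def)
  have "sets (borel :: 'a measure) \<subseteq> lambda_system UNIV (Pow UNIV) outer"
  proof -
    have "sets (borel :: 'a measure) = sigma_sets UNIV (Collect open)" by (simp add: borel_def)
    also have "\<dots> \<subseteq> lambda_system UNIV (Pow UNIV) outer"
      by (intro sigma_algebra.sigma_sets_subset[OF sa]) (use open_in_lambda_system in auto)
    finally show ?thesis .
  qed
  moreover have "sigma_algebra UNIV (sets (borel :: 'a measure))"
    using sets.sigma_algebra_axioms[of "borel :: 'a measure"] by simp
  ultimately have "measure_space UNIV (sets borel) outer"
    using measure_down[OF ms] by blast
  then show ?thesis
    unfolding M_def using assms by (intro emeasure_measure_of_sigma) (auto simp: measure_space_def)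
qed

lemma space_M: "space M = UNIV"
  using sets_M sets_eq_imp_space_eq by fastforce

lemma finite_M: "finite_measure M"
proof
  show "emeasure M (space M) \<noteq> \<infinity>"
    using outer_le_B[of UNIV] by (auto simp: space_M emeasure_M top_unique)
qed

lemma measure_open:
  assumes "open U"
  shows "ennreal (measure M U) = content U"
  using finite_measure.emeasure_eq_measure[OF finite_M, of U] emeasure_M[of U] outer_open[OF assms] assms
  by simp

lemma L_le_measure:
  assumes "open U" "f \<in> below U"
  shows "L f \<le> measure M U"
  using content_upper[OF assms(2)] measure_open[OF assms(1)]
  by (metis ennreal_le_iff measure_nonneg)

lemma measure_le_L:
  assumes "open U" "f \<in> Cc_nonneg" "\<And>x. x \<in> U \<Longrightarrow> 1 \<le> f x"
  shows "measure M U \<le> L f"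
proof -
  have "L g \<le> L f" if "g \<in> below U" for g
  proof (rule mono)
    show "g x \<le> f x" for x
      using that assms(3)[of x] Cc_nonnegD(2)[OF assms(2), of x]
      by (cases "x \<in> U") (auto simp: below_def intro: order_trans)
  qed (use that assms in \<open>auto simp: below_def\<close>)
  then have "content U \<le> ennreal (L f)"
    unfolding content_def by (intro SUP_least ennreal_leI)
  then show ?thesis
    using measure_open[OF assms(1)] nonneg[OF assms(2)] by (metis ennreal_le_iff)
qed

lemma measurable_Cc: "f \<in> Cc_nonneg \<Longrightarrow> f \<in> borel_measurable M"
  using borel_measurable_continuous_onI[OF Cc_nonnegD(1)] measurable_cong_sets[OF sets_M refl] by blast

lemma integrable_Cc:
  assumes "f \<in> Cc_nonneg"
  shows "integrable M f"
proof -
  obtain c where "\<And>x. f x \<le> c" using Cc_nonneg_bounded[OF assms] by blast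
  then show ?thesis
    using assms by (intro finite_measure.integrable_const_bound[OF finite_M, of _ c] measurable_Cc)
      (auto simp: Cc_nonneg_def)
qed

lemma integral_eq_L:
  assumes f: "f \<in> Cc_nonneg"
  shows "integral\<^sup>L M f = L f"
proof -
  interpret finite_measure M by (rule finite_M)
  obtain c where c: "\<And>x. f x \<le> c" "0 \<le> c" using Cc_nonneg_bounded[OF f] by blast
  have close: "\<bar>L f - integral\<^sup>L M f\<bar> \<le> measure M UNIV / real n" if "n > 0" for n
  proof -
    \<comment> \<open>Layer cake: both functionals map the slice \<open>n * s k\<close> into
        \<open>[measure M (U (Suc k)), measure M (U k)]\<close>, and these intervals telescope.\<close>
    define s where "s k x = min (max (f x - real k / n) 0) (1 / n)" for k x
    define U where "U k = {x. real k / n < f x}" for k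
    have U: "open (U k)" for k
      unfolding U_def by (intro open_Collect_less continuous_intros Cc_nonnegD(1)[OF f])
    have s: "s k \<in> Cc_nonneg" for k
      unfolding s_def by (intro Cc_nonneg_mono[OF f] continuous_intros Cc_nonnegD(1)[OF f]) auto
    have ns: "(\<lambda>x. real n * s k x) \<in> Cc_nonneg" for k
      by (rule Cc_nonneg_mono[OF s]) (auto intro!: continuous_intros Cc_nonnegD[OF s] mult_nonneg_nonneg)
    have on: "real n * s k x = 1" if "x \<in> U (Suc k)" for k x
    proof -
      have "1 / n \<le> f x - real k / n" using that \<open>n > 0\<close> by (simp add: U_def field_simps)
      moreover have "0 < 1 / real n" using \<open>n > 0\<close> by simp
      ultimately have "s k x = 1 / n" unfolding s_def by linarith
      then show ?thesis using \<open>n > 0\<close> by simp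
    qed
    have off: "s k x = 0" if "x \<notin> U k" for k x
      using that by (simp add: s_def U_def)
    have le1: "real n * s k x \<le> 1" for k x
    proof -
      have "s k x \<le> 1 / n" by (simp add: s_def)
      then show ?thesis using \<open>n > 0\<close> by (simp add: field_simps)
    qed
    have bel: "(\<lambda>x. real n * s k x) \<in> below (U k)" for k
      using ns off le1 by (auto simp: below_def)
    \<comment> \<open>Enough slices of height \<open>1 / n\<close> to reach the bound
      \<open>c\<close> of \<open>f\<close>.\<close>
    define N where "N = nat \<lceil>c * n\<rceil>"
    have N: "f x \<le> real N / n" for x
    proof -
      have "f x * n \<le> c * n" using c(1) by (intro mult_right_mono) auto
      also have "c * n \<le> real N" unfolding N_def by linarith
      finally show ?thesis using \<open>n > 0\<close> by (simp add: field_simps)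
    qed
    have "(\<Sum>k<j. s k x) = min (f x) (real j / n)" for j x
    proof (induction j)
      case 0 then show ?case using Cc_nonnegD(2)[OF f, of x] by simp
    next
      case (Suc j)
      have "real (Suc j) / n = real j / n + 1 / n" by (simp add: add_divide_distrib)
      moreover have "0 \<le> 1 / real n" by simp
      ultimately have "min (f x) (real j / n) + s j x = min (f x) (real (Suc j) / n)"
        unfolding s_def by linarith
      then show ?case unfolding sum.lessThan_Suc Suc.IH .
    qed
    then have f_sum: "f = (\<lambda>x. \<Sum>k<N. s k x)" using N by (auto simp: min_def)
    have Lf: "L f = (\<Sum>k<N. L (s k))" by (subst f_sum) (rule L_sum[OF s])
    have If: "integral\<^sup>L M f = (\<Sum>k<N. integral\<^sup>L M (s k))"
      by (subst f_sum) (rule Bochner_Integration.integral_sum[OF integrable_Cc[OF s]])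
    have slice: "\<bar>n * L (s k) - n * integral\<^sup>L M (s k)\<bar> \<le> measure M (U k) - measure M (U (Suc k))" for k
    proof -
      have "n * L (s k) \<le> measure M (U k)"
        using L_le_measure[OF U bel] L_of_nat_mult[OF s] by simp
      moreover have "measure M (U (Suc k)) \<le> n * L (s k)"
        using measure_le_L[OF U ns, of "Suc k" k] on L_of_nat_mult[OF s] by simp
      moreover have "(\<integral>x. n * s k x \<partial>M) \<le> (\<integral>x. indicator (U k) x \<partial>M)"
        using U le1 off by (intro integral_mono integrable_Cc[OF ns] integrable_real_indicator) (auto simp: sets_M emeasure_eq_measure indicator_def)
      moreover have "(\<integral>x. indicator (U (Suc k)) x \<partial>M) \<le> (\<integral>x. n * s k x \<partial>M)"
        using U on Cc_nonnegD(2)[OF ns] by (intro integral_mono integrable_Cc[OF ns] integrable_real_indicator) (auto simp: sets_M emeasure_eq_measure indicator_def)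
      ultimately show ?thesis by (simp add: space_M)
    qed
    have "n * \<bar>L f - integral\<^sup>L M f\<bar> = \<bar>\<Sum>k<N. n * L (s k) - n * integral\<^sup>L M (s k)\<bar>"
      by (simp add: Lf If sum_subtractf flip: sum_distrib_left right_diff_distrib add: abs_mult)
    also have "\<dots> \<le> (\<Sum>k<N. measure M (U k) - measure M (U (Suc k)))"
      by (intro order_trans[OF sum_abs] sum_mono slice)
    also have "\<dots> = measure M (U 0) - measure M (U N)" by (rule sum_lessThan_telescope')
    also have "\<dots> \<le> measure M UNIV"
    proof -
      have "measure M (U 0) \<le> measure M UNIV" by (rule finite_measure_mono) (auto simp: sets_M)
      then show ?thesis using measure_nonneg[of M "U N"] by linarith
    qed
    finally show ?thesis using \<open>n > 0\<close> by (simp add: field_simps)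
  qed
  have "(\<lambda>n. measure M UNIV / real n) \<longlonglongrightarrow> 0" by (rule lim_const_over_n)
  then have "\<bar>L f - integral\<^sup>L M f\<bar> \<le> 0"
    by (rule LIMSEQ_le_const) (use close in \<open>auto intro: exI[of _ 1]\<close>)
  then show ?thesis by simp
qed

text \<open>A member of \<open>below U\<close> carried by a compact \<open>K \<subseteq> U\<close>
  integrates to at most the measure of \<open>K\<close>. If all such \<open>K\<close> fell short by
  \<open>e\<close>, then so would \<open>content U\<close>, the supremum of these integrals.\<close>

lemma measure_le_compact:
  assumes "open U" "e > 0"
  obtains K where "compact K" "K \<subseteq> U" "measure M U < measure M K + e"
proof (rule ccontr)
  assume "\<not> thesis"
  then have no: "measure M K \<le> measure M U - e" if "compact K" "K \<subseteq> U" for K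
    using that \<open>\<And>K. \<lbrakk>compact K; K \<subseteq> U; measure M U < measure M K + e\<rbrakk> \<Longrightarrow> thesis\<close> by force
  interpret finite_measure M by (rule finite_M)
  have e: "0 \<le> measure M U - e" using no[of "{}"] by simp
  have "content U \<le> ennreal (measure M U - e)"
    unfolding content_def
  proof (rule SUP_least, erule L_le_if_compact)
    fix g K assume g: "g \<in> below U" and K: "compact K" "K \<subseteq> U" "\<And>x. x \<notin> K \<Longrightarrow> g x = 0"
    have gC: "g \<in> Cc_nonneg" using g by (simp add: below_def)
    have "closed K" using K(1) by (rule compact_imp_closed)
    have "L g = integral\<^sup>L M g" by (rule integral_eq_L[OF gC, symmetric])
    also have "\<dots> \<le> (\<integral>x. indicator K x \<partial>M)"
      using g K(3) \<open>closed K\<close>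
      by (intro integral_mono integrable_Cc[OF gC] integrable_real_indicator)
         (auto simp: sets_M emeasure_eq_measure indicator_def below_def)
    also have "\<dots> = measure M K" by (simp add: space_M)
    also have "\<dots> \<le> measure M U - e" by (rule no[OF K(1,2)])
    finally show "ennreal (L g) \<le> ennreal (measure M U - e)" by (rule ennreal_leI)
  qed
  then have "measure M U \<le> measure M U - e"
    using measure_open[OF assms(1)] e by (metis ennreal_le_iff)
  then show False using assms(2) by simp
qed

lemma radon_M: "radon_measure M"
  unfolding radon_measure_def
proof (intro conjI ballI allI impI sets_M finite_M)
  interpret finite_measure M by (rule finite_M)
  have outer_reg: "\<exists>U. open U \<and> A \<subseteq> U \<and> measure M (U - A) < e" if A: "A \<in> sets borel" and "e > 0" for A e
  proof -
    obtain U where U: "open U" "A \<subseteq> U" "content U < outer A + ennreal e"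
      using outer_approx[OF \<open>e > 0\<close>] by blast
    have "ennreal (measure M U) < ennreal (measure M A + e)"
      using U(3) measure_open[OF U(1)] emeasure_M[OF A] \<open>e > 0\<close> by (simp add: emeasure_eq_measure)
    then have "measure M U < measure M A + e" by (simp add: ennreal_less_iff)
    moreover have "measure M (U - A) = measure M U - measure M A"
      using A U by (intro finite_measure_Diff) (auto simp: sets_M)
    ultimately show ?thesis using U by (intro exI[of _ U]) auto
  qed
  fix A :: "'a set" and e :: real assume A: "A \<in> sets borel" and "e > 0"
  \<comment> \<open>Inner approximation is outer approximation of the complement:
    \<open>K - W\<close> is compact, lies in \<open>A\<close>, and \<open>U\<close> exceeds it only
    inside \<open>U - A\<close>, \<open>W \<inter> A\<close> and \<open>- K\<close>. Each of the
    three gets a third of \<open>e\<close>.\<close>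
  obtain U where U: "open U" "A \<subseteq> U" "measure M (U - A) < e / 3"
    using outer_reg[OF A, of "e / 3"] \<open>e > 0\<close> by auto
  obtain W where W: "open W" "- A \<subseteq> W" "measure M (W - - A) < e / 3"
    using outer_reg[of "- A" "e / 3"] A \<open>e > 0\<close> by auto
  obtain K where K: "compact K" "measure M UNIV < measure M K + e / 3"
    using measure_le_compact[of UNIV "e / 3"] \<open>e > 0\<close> by auto
  have cl: "closed K" using K(1) by (rule compact_imp_closed)
  have "measure M (- K) < e / 3"
    using finite_measure_compl[of K] K(2) cl by (simp add: space_M sets_M Compl_eq_Diff_UNIV)
  moreover have "measure M (U - (K - W)) \<le> measure M ((U - A) \<union> (W - - A) \<union> (- K))"
    using A U W cl by (intro finite_measure_mono) (auto simp: sets_M)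
  moreover have "\<dots> \<le> measure M ((U - A) \<union> (W - - A)) + measure M (- K)"
    using A U W cl by (intro measure_Un_le) (auto simp: sets_M)
  moreover have "measure M ((U - A) \<union> (W - - A)) \<le> measure M (U - A) + measure M (W - - A)"
    using A U W by (intro measure_Un_le) (auto simp: sets_M)
  ultimately have "measure M (U - (K - W)) < e" using U(3) W(3) by linarith
  then show "\<exists>K U. compact K \<and> open U \<and> K \<subseteq> A \<and> A \<subseteq> U \<and> measure M (U - K) < e"
    using U W K(1) by (intro exI[of _ "K - W"] exI[of _ U]) (auto intro: compact_diff)
qed

end


section \<open>Bounded functionals as differences of measures\<close>

text \<open>The Jordan decomposition of a functional: \<open>P f\<close> is the supremum of
  \<open>l\<close> over the functions between \<open>0\<close> and \<open>f\<close>. Both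
  \<open>P\<close> and \<open>P - l\<close> are positive, and \<open>l\<close> is the difference of
  the two.\<close>

lemma bounded_functional_radon:
  fixes l :: "('a::t2_space \<Rightarrow> real) \<Rightarrow> real"
  assumes lc: "locally_compact_space (euclidean :: 'a topology)"
    and add: "\<And>f g. f \<in> Cc_nonneg \<Longrightarrow> g \<in> Cc_nonneg \<Longrightarrow> l (\<lambda>x. f x + g x) = l f + l g"
    and bound: "\<And>f c. f \<in> Cc_nonneg \<Longrightarrow> (\<And>x. f x \<le> c) \<Longrightarrow> \<bar>l f\<bar> \<le> B * c"
  obtains M N where "radon_measure M" "radon_measure N"
    "\<And>f. f \<in> Cc_nonneg \<Longrightarrow> l f = integral\<^sup>L M f - integral\<^sup>L N f"
proof -
  define S where "S f = {g \<in> Cc_nonneg. \<forall>x. g x \<le> f x}" for f :: "'a \<Rightarrow> real"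
  define P where "P f = (SUP g\<in>S f. l g)" for f
  have zero: "(\<lambda>x. 0) \<in> (Cc_nonneg :: ('a \<Rightarrow> real) set)"
    by (rule Cc_nonnegI[of _ "{}"]) auto
  have l0: "l (\<lambda>x. 0) = 0" using add[OF zero zero] by simp
  have l_le: "l g \<le> B * c" if "g \<in> S f" "\<And>x. f x \<le> c" for f g c
  proof -
    have "g \<in> Cc_nonneg" "\<And>x. g x \<le> c" using that by (auto simp: S_def intro: order_trans)
    then show ?thesis using bound[of g c] by simp
  qed
  have S_ne: "S f \<noteq> {}" if "f \<in> Cc_nonneg" for f
    using that by (auto simp: S_def)
  have bdd: "bdd_above (l ` S f)" if f: "f \<in> Cc_nonneg" for f
  proof -
    obtain c where "\<And>x. f x \<le> c" using Cc_nonneg_bounded[OF f] by blast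
    then show ?thesis by (intro bdd_aboveI[of _ "B * c"]) (auto intro: l_le)
  qed
  have upper: "l g \<le> P f" if "f \<in> Cc_nonneg" "g \<in> S f" for f g
    unfolding P_def by (rule cSUP_upper[OF that(2) bdd[OF that(1)]])
  have least: "P f \<le> c" if "f \<in> Cc_nonneg" "\<And>g. g \<in> S f \<Longrightarrow> l g \<le> c" for f c
    unfolding P_def by (rule cSUP_least[OF S_ne[OF that(1)] that(2)])
  have P_add: "P (\<lambda>x. f x + g x) = P f + P g" if f: "f \<in> Cc_nonneg" and g: "g \<in> Cc_nonneg" for f g
  proof (rule antisym)
    have fg: "(\<lambda>x. f x + g x) \<in> Cc_nonneg" by (rule Cc_nonneg_add[OF f g])
    show "P (\<lambda>x. f x + g x) \<le> P f + P g"
    proof (rule least[OF fg])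
      fix k assume k: "k \<in> S (\<lambda>x. f x + g x)"
      then have kC: "k \<in> Cc_nonneg" by (simp add: S_def)
      \<comment> \<open>Riesz decomposition: a function below \<open>f + g\<close> is the sum of its
        minimum with \<open>f\<close> and a remainder that stays below \<open>g\<close>.\<close>
      define k1 where "k1 x = min (k x) (f x)" for x
      define k2 where "k2 x = k x - k1 x" for x
      have "0 \<le> f x" "0 \<le> k x" for x by (simp_all add: Cc_nonnegD(2) f kC)
      then have pos: "0 \<le> k1 x" "0 \<le> k2 x" "k x = 0 \<Longrightarrow> k1 x = 0 \<and> k2 x = 0" for x
        by (simp_all add: k1_def k2_def)
      have cont: "continuous_on UNIV k1" "continuous_on UNIV k2"
        unfolding k2_def k1_def by (intro continuous_intros Cc_nonnegD(1) f kC)+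
      have k1: "k1 \<in> Cc_nonneg" by (rule Cc_nonneg_mono[OF kC cont(1)]) (simp_all add: pos)
      have k2: "k2 \<in> Cc_nonneg" by (rule Cc_nonneg_mono[OF kC cont(2)]) (simp_all add: pos)
      have "k1 \<in> S f" using k1 by (simp add: S_def k1_def)
      moreover have "k2 \<in> S g"
      proof -
        have "k2 x \<le> g x" for x
        proof -
          have "k x \<le> f x + g x" using k by (simp add: S_def)
          then show ?thesis using Cc_nonnegD(2)[OF g, of x] by (simp add: k2_def k1_def min_def)
        qed
        then show ?thesis using k2 by (simp add: S_def)
      qed
      moreover have "l k = l k1 + l k2" using add[OF k1 k2] by (simp add: k2_def)
      ultimately show "l k \<le> P f + P g" using upper[OF f] upper[OF g] by (simp add: add_mono)
    qed
    have "P f \<le> P (\<lambda>x. f x + g x) - P g"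
    proof (rule least[OF f])
      fix k assume k: "k \<in> S f"
      have "P g \<le> P (\<lambda>x. f x + g x) - l k"
      proof (rule least[OF g])
        fix k' assume k': "k' \<in> S g"
        have C: "k \<in> Cc_nonneg" "k' \<in> Cc_nonneg" using k k' by (auto simp: S_def)
        have "(\<lambda>x. k x + k' x) \<in> S (\<lambda>x. f x + g x)"
          using k k' Cc_nonneg_add[OF C] by (auto simp: S_def intro: add_mono)
        from upper[OF fg this] show "l k' \<le> P (\<lambda>x. f x + g x) - l k" by (simp add: add[OF C])
      qed
      then show "l k \<le> P (\<lambda>x. f x + g x) - P g" by simp
    qed
    then show "P f + P g \<le> P (\<lambda>x. f x + g x)" by simp
  qed
  have "positive_functional P B"
  proof
    show "0 \<le> P f" if "f \<in> Cc_nonneg" for f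
      using upper[OF that, of "\<lambda>x. 0"] zero Cc_nonnegD(2)[OF that] by (simp add: l0 S_def)
    show "P f \<le> B * c" if "f \<in> Cc_nonneg" "\<And>x. f x \<le> c" for f c
      using l_le[OF _ that(2)] by (intro least[OF that(1)])
  qed (rule lc P_add; assumption)+
  then interpret P: positive_functional P B .
  \<comment> \<open>One \<open>B\<close> bounds \<open>P\<close>, the other bounds the absolute
    value of \<open>l\<close>.\<close>
  have "positive_functional (\<lambda>f. P f - l f) (2 * B)"
  proof
    show "0 \<le> P f - l f" if "f \<in> Cc_nonneg" for f
      using upper[OF that, of f] that by (simp add: S_def)
    show "P f - l f \<le> 2 * B * c" if "f \<in> Cc_nonneg" "\<And>x. f x \<le> c" for f c
      using P.bound[OF that] bound[OF that] by (simp add: abs_le_iff)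
  qed (use lc in \<open>simp_all add: P_add add\<close>)
  then interpret N: positive_functional "\<lambda>f. P f - l f" "2 * B" .
  show thesis
    by (rule that[OF P.radon_M N.radon_M]) (simp add: P.integral_eq_L N.integral_eq_L)
qed

text \<open>Two decompositions of one signed measure, \<open>P - S = R - Q\<close>, are compared in
  the additive form \<open>P + Q = R + S\<close>, in which no infinite quantities are subtracted and
  induction over nonnegative measurable functions applies.\<close>

lemma nn_integral_add_eq_if_measure_add_eq:
  assumes sets: "sets P = sets M" "sets Q = sets M" "sets R = sets M" "sets S = sets M"
    and eq: "\<And>A. A \<in> sets M \<Longrightarrow> emeasure P A + emeasure Q A = emeasure R A + emeasure S A"
    and u: "u \<in> borel_measurable M"
  shows "(\<integral>\<^sup>+x. u x \<partial>P) + (\<integral>\<^sup>+x. u x \<partial>Q) = (\<integral>\<^sup>+x. u x \<partial>R) + (\<integral>\<^sup>+x. u x \<partial>S)"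
proof -
  note [measurable_cong] = sets
  show ?thesis
    using u
  proof induction
    case (cong f g)
    have "(\<integral>\<^sup>+x. f x \<partial>X) = (\<integral>\<^sup>+x. g x \<partial>X)" if "sets X = sets M" for X
      using cong(3) sets_eq_imp_space_eq[OF that] by (intro nn_integral_cong) simp
    then show ?case using cong(4) sets by simp
  next
    case (set A)
    then show ?case using eq sets by simp
  next
    case (mult u c)
    then have [measurable]: "u \<in> borel_measurable M" by simp
    show ?case using mult.IH by (simp add: nn_integral_cmult flip: distrib_left)
  next
    case (add u v)
    then have [measurable]: "u \<in> borel_measurable M" "v \<in> borel_measurable M" by auto
    show ?case using add.IH by (simp add: nn_integral_add ac_simps)
  next
    case (seq U)
    then have [measurable]: "\<And>i. U i \<in> borel_measurable M" by simp
    have mono: "incseq (\<lambda>i. \<integral>\<^sup>+x. U i x \<partial>X)" for X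
      using \<open>incseq U\<close> by (auto simp: incseq_def le_fun_def intro!: nn_integral_mono)
    have "(\<integral>\<^sup>+x. (SUP i. U i x) \<partial>X) = (SUP i. \<integral>\<^sup>+x. U i x \<partial>X)" if "sets X = sets M" for X
    proof (rule nn_integral_monotone_convergence_SUP[OF \<open>incseq U\<close>])
      show "U i \<in> borel_measurable X" for i
        using measurable_cong_sets[OF that refl] by (metis seq(1))
    qed
    then show ?case
      using sets seq.IH by (simp add: SUP_apply image_comp flip: ennreal_SUP_add[OF mono mono])
  qed
qed

lemma integral_add_eq_if_measure_add_eq:
  fixes f :: "'a \<Rightarrow> complex"
  assumes sets: "sets P = sets M" "sets Q = sets M" "sets R = sets M" "sets S = sets M"
    and fin: "finite_measure P" "finite_measure Q" "finite_measure R" "finite_measure S"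
    and eq: "\<And>A. A \<in> sets M \<Longrightarrow> measure P A + measure Q A = measure R A + measure S A"
    and f: "f \<in> borel_measurable M" and bdd: "\<And>x. norm (f x) \<le> c"
  shows "integral\<^sup>L P f + integral\<^sup>L Q f = integral\<^sup>L R f + integral\<^sup>L S f"
proof -
  have em: "emeasure P A + emeasure Q A = emeasure R A + emeasure S A" if "A \<in> sets M" for A
    using eq[OF that] fin by (simp add: finite_measure.emeasure_eq_measure flip: ennreal_plus)
  have int: "integrable X g" if "finite_measure X" "sets X = sets M" "g \<in> borel_measurable M" "\<And>x. norm (g x) \<le> c"
    for X and g :: "'a \<Rightarrow> 'b::{banach, second_countable_topology}"
    using that measurable_cong_sets[OF that(2) refl]
    by (intro finite_measure.integrable_const_bound[OF that(1), of _ c]) auto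
  have real: "integral\<^sup>L P g + integral\<^sup>L Q g = integral\<^sup>L R g + integral\<^sup>L S g"
    if g: "g \<in> borel_measurable M" "\<And>x. norm (g x) \<le> c" for g :: "'a \<Rightarrow> real"
  proof -
    have nn: "(\<integral>\<^sup>+x. ennreal (h x) \<partial>X) < \<infinity>" if "finite_measure X" "sets X = sets M" "h \<in> borel_measurable M"
      "\<And>x. norm (h x) \<le> c" for X and h :: "'a \<Rightarrow> real"
    proof -
      have "(\<integral>\<^sup>+x. ennreal (h x) \<partial>X) \<le> (\<integral>\<^sup>+x. ennreal (norm (h x)) \<partial>X)"
        by (intro nn_integral_mono ennreal_leI) simp
      also have "\<dots> < \<infinity>" using int[OF that] by (simp add: integrable_iff_bounded)
      finally show ?thesis .
    qed
    have enn: "enn2real (\<integral>\<^sup>+x. h x \<partial>P) + enn2real (\<integral>\<^sup>+x. h x \<partial>Q) = enn2real (\<integral>\<^sup>+x. h x \<partial>R) + enn2real (\<integral>\<^sup>+x. h x \<partial>S)"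
      if h: "h \<in> borel_measurable M" "\<And>x. norm (h x) \<le> c" for h :: "'a \<Rightarrow> real"
    proof -
      have "(\<integral>\<^sup>+x. h x \<partial>P) + (\<integral>\<^sup>+x. h x \<partial>Q) = (\<integral>\<^sup>+x. h x \<partial>R) + (\<integral>\<^sup>+x. h x \<partial>S)"
        using h(1) by (intro nn_integral_add_eq_if_measure_add_eq[OF sets em]) auto
      then show ?thesis
        using nn[OF fin(1) sets(1) h] nn[OF fin(2) sets(2) h] nn[OF fin(3) sets(3) h] nn[OF fin(4) sets(4) h]
        by (simp flip: enn2real_plus)
    qed
    show ?thesis
      using enn[OF g] enn[of "\<lambda>x. - g x"] g
      by (simp add: real_lebesgue_integral_def int[OF fin(1) sets(1) g] int[OF fin(2) sets(2) g]
          int[OF fin(3) sets(3) g] int[OF fin(4) sets(4) g])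
  qed
  have Re: "integral\<^sup>L X (\<lambda>x. Re (f x)) = Re (integral\<^sup>L X f)"
    and Im: "integral\<^sup>L X (\<lambda>x. Im (f x)) = Im (integral\<^sup>L X f)"
    if "finite_measure X" "sets X = sets M" for X
    using integral_bounded_linear[OF bounded_linear_Re int[OF that f bdd]]
      integral_bounded_linear[OF bounded_linear_Im int[OF that f bdd]] by auto
  have "norm (Re (f x)) \<le> c" "norm (Im (f x)) \<le> c" for x
    using bdd[of x] abs_Re_le_cmod[of "f x"] abs_Im_le_cmod[of "f x"] by auto
  then show ?thesis
    using real[of "\<lambda>x. Re (f x)"] real[of "\<lambda>x. Im (f x)"] f
    by (intro complex_eqI) (simp_all add: Re Im fin sets)
qed

lemma signed_integral_diff_measure:
  fixes f :: "'a::topological_space \<Rightarrow> complex"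
  assumes M: "sets M = sets borel" "finite_measure M" and N: "sets N = sets borel" "finite_measure N"
    and f: "f \<in> borel_measurable borel" "\<And>x. norm (f x) \<le> c"
  shows "signed_integral borel (\<lambda>A. measure M A - measure N A) f = integral\<^sup>L M f - integral\<^sup>L N f"
proof -
  interpret M: finite_measure M by fact
  interpret N: finite_measure N by fact
  have sp: "space M = UNIV" "space N = UNIV"
    using M(1) N(1) by (auto dest: sets_eq_imp_space_eq)
  define \<nu> where "\<nu> A = measure M A - measure N A" for A
  have sums: "(\<lambda>i. \<nu> (A i)) sums \<nu> (\<Union>i. A i)"
    if "range A \<subseteq> sets borel" "disjoint_family A" for A :: "nat \<Rightarrow> 'a set"
    unfolding \<nu>_def using that M N
    by (intro sums_diff M.finite_measure_UNION N.finite_measure_UNION) auto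
  then have neg: "(\<lambda>i. - \<nu> (A i)) sums - \<nu> (\<Union>i. A i)"
    if "range A \<subseteq> sets borel" "disjoint_family A" for A :: "nat \<Rightarrow> 'a set"
    using that by (intro sums_minus)
  have bd: "\<bar>\<nu> A\<bar> \<le> measure M UNIV + measure N UNIV" for A
    using M.bounded_measure[of A] N.bounded_measure[of A] measure_nonneg[of M A] measure_nonneg[of N A]
    unfolding \<nu>_def sp by linarith
  have sets_pp: "sets (positive_part borel \<rho>) = sets borel" for \<rho> :: "'a set \<Rightarrow> real"
    unfolding positive_part_def
    using sets.sigma_sets_eq[of "borel :: 'a measure"] by (simp add: sets_measure_of_conv)
  have fin_pp: "finite_measure (positive_part borel \<rho>)"
    if "\<And>A::nat \<Rightarrow> 'a set. range A \<subseteq> sets borel \<Longrightarrow> disjoint_family A \<Longrightarrow> (\<lambda>i. \<rho> (A i)) sums \<rho> (\<Union>i. A i)"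
      and b: "\<And>A. \<bar>\<rho> A\<bar> \<le> measure M UNIV + measure N UNIV" for \<rho>
  proof
    have "space (positive_part borel \<rho>) = UNIV"
      using sets_eq_imp_space_eq[OF sets_pp[of \<rho>]] by simp
    moreover have "emeasure (positive_part borel \<rho>) UNIV = (SUP B\<in>{B \<in> sets borel. B \<subseteq> UNIV}. ennreal (\<rho> B))"
      by (rule emeasure_positive_part) (use that in auto)
    moreover have "\<dots> \<le> ennreal (measure M UNIV + measure N UNIV)"
      using b by (intro SUP_least ennreal_leI) (auto simp: abs_le_iff)
    ultimately show "emeasure (positive_part borel \<rho>) (space (positive_part borel \<rho>)) \<noteq> \<infinity>"
      by (metis ennreal_neq_top infinity_ennreal_def neq_top_trans)
  qed
  \<comment> \<open>The Jordan decomposition is not \<open>(M, N)\<close>, but \<open>\<nu>\<^sup>+ + N = \<nu>\<^sup>- + M\<close>.\<close>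
  have "integral\<^sup>L (positive_part borel \<nu>) f + integral\<^sup>L N f
      = integral\<^sup>L (positive_part borel (\<lambda>A. - \<nu> A)) f + integral\<^sup>L M f"
  proof (rule integral_add_eq_if_measure_add_eq[where M = borel and c = c])
    show "finite_measure (positive_part borel \<nu>)" by (rule fin_pp[OF sums bd])
    show "finite_measure (positive_part borel (\<lambda>A. - \<nu> A))" by (rule fin_pp[OF neg]) (simp_all add: bd)
    show "measure (positive_part borel \<nu>) A + measure N A
        = measure (positive_part borel (\<lambda>A. - \<nu> A)) A + measure M A" if "A \<in> sets borel" for A
      using jordan_decomposition[of borel \<nu> _ A, OF sums bd that] by (simp add: \<nu>_def[of A])
  qed (use sets_pp M N f in auto)
  then show ?thesis
    unfolding signed_integral_def \<nu>_def by (simp add: algebra_simps)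
qed


section \<open>From functionals to complex measures\<close>

text \<open>The entries 0 to 3 carry a positive and a negative part of the real part, then of the
  imaginary part. Indexing by \<open>k\<close> lets one argument serve all four.\<close>

locale radon_quadruple =
  fixes M :: "nat \<Rightarrow> 'a::t2_space measure"
  assumes radon: "radon_measure (M k)"
begin

lemma sets_M [measurable_cong]: "sets (M k) = sets borel"
  using radon[of k] by (simp add: radon_measure_def)

lemma finite_M: "finite_measure (M k)"
  using radon[of k] by (simp add: radon_measure_def)

lemma space_M: "space (M k) = UNIV"
  using sets_eq_imp_space_eq[OF sets_M[of k]] by simp

lemma measure_mono: "A \<subseteq> A' \<Longrightarrow> A' \<in> sets borel \<Longrightarrow> measure (M k) A \<le> measure (M k) A'"
  using finite_measure.finite_measure_mono[OF finite_M, of A A' k] by (simp add: sets_M)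

definition \<mu> :: "'a set \<Rightarrow> complex"
  where "\<mu> A = complex_of_real (measure (M 0) A) - of_real (measure (M 1) A)
    + \<i> * (of_real (measure (M 2) A) - of_real (measure (M 3) A))"

text \<open>A finite positive majorant of the total variation of \<open>\<mu>\<close>
  (\<open>tv_le_\<sigma>\<close>). It is additive and monotone by construction, so regularity is
  proved for it and then passed on to the variation.\<close>

definition \<sigma> :: "'a set \<Rightarrow> real"
  where "\<sigma> A = (\<Sum>k<4. measure (M k) A)"

definition \<Phi> :: "('a \<Rightarrow>\<^sub>C complex) \<Rightarrow> complex"
  where "\<Phi> f = integral\<^sup>L (M 0) f - integral\<^sup>L (M 1) f + \<i> * (integral\<^sup>L (M 2) f - integral\<^sup>L (M 3) f)"

lemma sum_4: "(\<Sum>k<4. g k) = g 0 + g 1 + g 2 + g (3 :: nat)"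
  for g :: "nat \<Rightarrow> real"
  by (simp add: eval_nat_numeral)

lemma norm_combination_le:
  "norm (a - b + \<i> * (c - d)) \<le> norm a + norm b + norm c + norm d" for a b c d :: complex
proof -
  have "norm (a - b + \<i> * (c - d)) \<le> norm (a - b) + norm (\<i> * (c - d))" by (rule norm_triangle_ineq)
  also have "norm (\<i> * (c - d)) = norm (c - d)" by (simp add: norm_mult)
  finally show ?thesis using norm_triangle_ineq4[of a b] norm_triangle_ineq4[of c d] by linarith
qed

lemma norm_\<mu>_le: "norm (\<mu> A) \<le> \<sigma> A"
  using norm_combination_le[of "of_real (measure (M 0) A)" "of_real (measure (M 1) A)"
      "of_real (measure (M 2) A)" "of_real (measure (M 3) A)"]
  unfolding \<mu>_def \<sigma>_def sum_4 by simp

lemma \<sigma>_nonneg: "0 \<le> \<sigma> A"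
  unfolding \<sigma>_def by (intro sum_nonneg) simp

lemma \<sigma>_approx:
  assumes "A \<in> sets borel" "e > 0"
  obtains K U where "compact K" "open U" "K \<subseteq> A" "A \<subseteq> U" "\<sigma> (U - K) < e"
proof -
  have "e / 4 > 0" using assms(2) by simp
  then have "\<exists>K U. compact K \<and> open U \<and> K \<subseteq> A \<and> A \<subseteq> U \<and> measure (M k) (U - K) < e / 4" for k
    using radon[of k] assms(1) unfolding radon_measure_def by blast
  then obtain K U where KU: "\<And>k. compact (K k)" "\<And>k. open (U k)" "\<And>k. K k \<subseteq> A" "\<And>k. A \<subseteq> U k"
    "\<And>k. measure (M k) (U k - K k) < e / 4" by metis
  \<comment> \<open>The intersection of the \<open>U k\<close> minus the union of the
    \<open>K k\<close> lies in each \<open>U k - K k\<close>, so one pair of sets serves all four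
    measures.\<close>
  show thesis
  proof (rule that[of "\<Union>k<4. K k" "\<Inter>k<4. U k"])
    show "A \<subseteq> (\<Inter>k<4. U k)" using KU(4) by blast
    have "measure (M k) ((\<Inter>k<4. U k) - (\<Union>k<4. K k)) < e / 4" if "k < 4" for k
    proof (rule le_less_trans[OF measure_mono KU(5)])
      show "U k - K k \<in> sets borel" using KU(1,2) by (intro sets.Diff borel_open borel_closed compact_imp_closed)
    qed (use that in auto)
    then have "\<sigma> ((\<Inter>k<4. U k) - (\<Union>k<4. K k)) < (\<Sum>k<(4::nat). e / 4)"
      unfolding \<sigma>_def by (intro sum_strict_mono) (auto simp: lessThan_empty_iff)
    then show "\<sigma> ((\<Inter>k<4. U k) - (\<Union>k<4. K k)) < e" by simp
  qed (use KU in \<open>auto intro!: compact_UN open_INT\<close>)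
qed

lemma complex_measure_\<mu>: "complex_measure borel \<mu>"
  unfolding complex_measure_def \<mu>_def
proof (intro allI impI)
  fix A :: "nat \<Rightarrow> 'a set" assume A: "range A \<subseteq> sets borel" "disjoint_family A"
  have "(\<lambda>i. complex_of_real (measure (M k) (A i))) sums of_real (measure (M k) (\<Union>i. A i))" for k
    using finite_measure.finite_measure_UNION[OF finite_M, of A k] A by (intro sums_of_real) (simp add: sets_M)
  then show "(\<lambda>i. complex_of_real (measure (M 0) (A i)) - of_real (measure (M 1) (A i))
      + \<i> * (of_real (measure (M 2) (A i)) - of_real (measure (M 3) (A i)))) sums
    (complex_of_real (measure (M 0) (\<Union>i. A i)) - of_real (measure (M 1) (\<Union>i. A i))
      + \<i> * (of_real (measure (M 2) (\<Union>i. A i)) - of_real (measure (M 3) (\<Union>i. A i))))"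
    by (intro sums_add sums_diff sums_mult)
qed

section \<open>Total variation and its regularity\<close>

abbreviation tv :: "'a set \<Rightarrow> ennreal" where "tv \<equiv> total_variation borel \<mu>"

abbreviation partitions :: "'a set \<Rightarrow> 'a set set set"
  where "partitions A \<equiv> {P. finite P \<and> P \<subseteq> sets borel \<and> disjoint P \<and> \<Union>P = A}"

lemma tv_upper: "P \<in> partitions A \<Longrightarrow> (\<Sum>E\<in>P. ennreal (norm (\<mu> E))) \<le> tv A"
  unfolding total_variation_def by (rule SUP_upper)

lemma tv_least: "(\<And>P. P \<in> partitions A \<Longrightarrow> (\<Sum>E\<in>P. ennreal (norm (\<mu> E))) \<le> c) \<Longrightarrow> tv A \<le> c"
  unfolding total_variation_def by (rule SUP_least)

lemma tv_le_\<sigma>: "tv A \<le> ennreal (\<sigma> A)"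
proof (rule tv_least)
  fix P assume P: "P \<in> partitions A"
  have "(\<Sum>E\<in>P. measure (M k) E) = measure (M k) A" for k
  proof -
    have "disjoint_family_on (\<lambda>E. E) P" using P by (auto simp: disjoint_family_on_def disjoint_def)
    then have "measure (M k) (\<Union>E\<in>P. E) = (\<Sum>E\<in>P. measure (M k) E)"
      using P by (intro finite_measure.finite_measure_finite_Union[OF finite_M]) (auto simp: sets_M)
    then show ?thesis using P by simp
  qed
  then have "(\<Sum>E\<in>P. \<sigma> E) = \<sigma> A" unfolding \<sigma>_def by (subst sum.swap) simp
  moreover have "(\<Sum>E\<in>P. ennreal (norm (\<mu> E))) \<le> (\<Sum>E\<in>P. ennreal (\<sigma> E))"
    by (intro sum_mono ennreal_leI norm_\<mu>_le)
  ultimately show "(\<Sum>E\<in>P. ennreal (norm (\<mu> E))) \<le> ennreal (\<sigma> A)"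
    by (simp add: sum_ennreal \<sigma>_nonneg)
qed

lemma tv_mono:
  assumes "A \<subseteq> A'" "A \<in> sets borel" "A' \<in> sets borel"
  shows "tv A \<le> tv A'"
proof (rule tv_least)
  fix P assume P: "P \<in> partitions A"
  have "disjoint (insert (A' - A) P)"
    using P by (auto simp: disjoint_def)
  then have "insert (A' - A) P \<in> partitions A'" using P assms by auto
  then have "(\<Sum>E\<in>insert (A' - A) P. ennreal (norm (\<mu> E))) \<le> tv A'" by (rule tv_upper)
  moreover have "(\<Sum>E\<in>P. ennreal (norm (\<mu> E))) \<le> (\<Sum>E\<in>insert (A' - A) P. ennreal (norm (\<mu> E)))"
    using P by (intro sum_mono2) auto
  ultimately show "(\<Sum>E\<in>P. ennreal (norm (\<mu> E))) \<le> tv A'" by (rule order_trans[rotated])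
qed

lemma \<mu>_empty: "\<mu> {} = 0" by (simp add: \<mu>_def)

lemma \<mu>_Un:
  assumes "A \<in> sets borel" "A' \<in> sets borel" "A \<inter> A' = {}"
  shows "\<mu> (A \<union> A') = \<mu> A + \<mu> A'"
proof -
  have "measure (M k) (A \<union> A') = measure (M k) A + measure (M k) A'" for k
    using assms by (intro finite_measure.finite_measure_Union[OF finite_M]) (auto simp: sets_M)
  then show ?thesis by (simp add: \<mu>_def algebra_simps)
qed

lemma tv_Un:
  assumes "A \<in> sets borel" "A' \<in> sets borel" "A \<inter> A' = {}"
  shows "tv (A \<union> A') \<le> tv A + tv A'"
proof (rule tv_least)
  fix P assume P: "P \<in> partitions (A \<union> A')"
  have part: "(\<Sum>E\<in>P. ennreal (norm (\<mu> (E \<inter> C)))) \<le> tv C" if C: "C \<in> sets borel" "C \<subseteq> A \<union> A'" for C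
  proof -
    have "disjoint ((\<lambda>E. E \<inter> C) ` P)"
    proof (rule disjointI)
      fix X Y assume "X \<in> (\<lambda>E. E \<inter> C) ` P" "Y \<in> (\<lambda>E. E \<inter> C) ` P" "X \<noteq> Y"
      then obtain E E' where E: "E \<in> P" "E' \<in> P" "E \<noteq> E'" "X = E \<inter> C" "Y = E' \<inter> C" by blast
      then have "E \<inter> E' = {}" using P by (auto simp: disjoint_def)
      then show "X \<inter> Y = {}" using E(4,5) by blast
    qed
    then have "(\<lambda>E. E \<inter> C) ` P \<in> partitions C"
      using P C by auto
    then have "(\<Sum>E\<in>(\<lambda>E. E \<inter> C) ` P. ennreal (norm (\<mu> E))) \<le> tv C" by (rule tv_upper)
    moreover have "(\<Sum>E\<in>(\<lambda>E. E \<inter> C) ` P. ennreal (norm (\<mu> E))) = (\<Sum>E\<in>P. ennreal (norm (\<mu> (E \<inter> C))))"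
    \<comment> \<open>Distinct members of \<open>P\<close> can have the same trace on
      \<open>C\<close> only if that trace is empty, and there \<open>\<mu>\<close> vanishes.\<close>
    proof (rule sum.reindex_nontrivial[unfolded o_def])
      fix E E' assume "E \<in> P" "E' \<in> P" "E \<noteq> E'" and eq: "E \<inter> C = E' \<inter> C"
      then have "E \<inter> E' = {}" using P by (auto simp: disjoint_def)
      then have "E \<inter> C = {}" using eq by blast
      then show "ennreal (norm (\<mu> (E \<inter> C))) = 0" by (simp add: \<mu>_empty)
    qed (use P in simp)
    ultimately show ?thesis by simp
  qed
  have "ennreal (norm (\<mu> E)) \<le> ennreal (norm (\<mu> (E \<inter> A))) + ennreal (norm (\<mu> (E \<inter> A')))" if "E \<in> P" for E
  proof -
    have "E \<in> sets borel" "E = (E \<inter> A) \<union> (E \<inter> A')" using P that by auto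
    then have "\<mu> E = \<mu> (E \<inter> A) + \<mu> (E \<inter> A')"
      using \<mu>_Un[of "E \<inter> A" "E \<inter> A'"] assms by auto
    then show ?thesis
      by (simp add: norm_triangle_ineq ennreal_leI flip: ennreal_plus)
  qed
  then have "(\<Sum>E\<in>P. ennreal (norm (\<mu> E)))
      \<le> (\<Sum>E\<in>P. ennreal (norm (\<mu> (E \<inter> A)))) + (\<Sum>E\<in>P. ennreal (norm (\<mu> (E \<inter> A'))))"
    unfolding sum.distrib[symmetric] by (rule sum_mono)
  also have "\<dots> \<le> tv A + tv A'" using assms by (intro add_mono part) auto
  finally show "(\<Sum>E\<in>P. ennreal (norm (\<mu> E))) \<le> tv A + tv A'" .
qed

lemma regular_complex_borel_measure_\<mu>: "regular_complex_borel_measure \<mu>"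
  unfolding regular_complex_borel_measure_def regular_borel_def
proof (intro conjI ballI)
  show "complex_measure borel \<mu>" by (rule complex_measure_\<mu>)
  show "tv UNIV < \<infinity>" using tv_le_\<sigma>[of UNIV] by (rule le_less_trans) simp
  \<comment> \<open>Enlarging a set raises its variation by at most \<open>\<sigma>\<close> of what
    is added. This is how approximation in \<open>\<sigma>\<close> becomes approximation in
    \<open>tv\<close>, both from outside and from inside.\<close>
  have split: "tv C \<le> tv A + ennreal e" if "A \<subseteq> C" "A \<in> sets borel" "C \<in> sets borel" "\<sigma> (C - A) \<le> e" for A C e
  proof -
    have "tv C \<le> tv A + tv (C - A)"
      using tv_Un[of A "C - A"] that by (auto simp: Un_absorb1)
    also have "tv (C - A) \<le> ennreal e"
      using tv_le_\<sigma>[of "C - A"] ennreal_leI[OF that(4)] by (rule order_trans)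
    finally show ?thesis by (simp add: add_left_mono)
  qed
  fix A :: "'a set" assume A: "A \<in> sets borel"
  have \<sigma>_mono: "\<sigma> C \<le> \<sigma> C'" if "C \<subseteq> C'" "C' \<in> sets borel" for C C'
    unfolding \<sigma>_def using that by (intro sum_mono measure_mono)
  have approx: "\<exists>K U. compact K \<and> open U \<and> K \<subseteq> A \<and> A \<subseteq> U \<and> tv U \<le> tv A + ennreal e \<and> tv A \<le> tv K + ennreal e"
    if e: "e > 0" for e
  proof -
    obtain K U where KU: "compact K" "open U" "K \<subseteq> A" "A \<subseteq> U" "\<sigma> (U - K) < e"
      by (rule \<sigma>_approx[OF A e])
    have K: "K \<in> sets borel" using KU(1) by (intro borel_closed compact_imp_closed)
    have "\<sigma> (U - A) \<le> \<sigma> (U - K)" "\<sigma> (A - K) \<le> \<sigma> (U - K)"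
      using KU K A by (auto intro!: \<sigma>_mono)
    then have "tv U \<le> tv A + ennreal e" "tv A \<le> tv K + ennreal e"
      using KU K A by (auto intro!: split)
    then show ?thesis using KU by blast
  qed
  show "tv A = (INF U\<in>{U. open U \<and> A \<subseteq> U}. tv U)"
  proof (rule antisym)
    show "tv A \<le> (INF U\<in>{U. open U \<and> A \<subseteq> U}. tv U)"
      using A by (intro INF_greatest tv_mono) auto
    show "(INF U\<in>{U. open U \<and> A \<subseteq> U}. tv U) \<le> tv A"
    proof (rule ennreal_le_epsilon)
      fix e :: real assume "e > 0"
      then obtain U where "open U" "A \<subseteq> U" "tv U \<le> tv A + ennreal e" using approx by blast
      then show "(INF U\<in>{U. open U \<and> A \<subseteq> U}. tv U) \<le> tv A + ennreal e"
        by (intro INF_lower2[of U]) auto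
    qed
  qed
  show "tv A = (SUP K\<in>{K. compact K \<and> K \<subseteq> A}. tv K)"
  proof (rule antisym)
    show "(SUP K\<in>{K. compact K \<and> K \<subseteq> A}. tv K) \<le> tv A"
      using A by (intro SUP_least tv_mono) (auto intro: borel_closed compact_imp_closed)
    show "tv A \<le> (SUP K\<in>{K. compact K \<and> K \<subseteq> A}. tv K)"
    proof (rule ennreal_le_epsilon)
      fix e :: real assume "e > 0"
      then obtain K where K: "compact K" "K \<subseteq> A" "tv A \<le> tv K + ennreal e" using approx by blast
      have "tv K \<le> (SUP K\<in>{K. compact K \<and> K \<subseteq> A}. tv K)" using K by (intro SUP_upper) auto
      then show "tv A \<le> (SUP K\<in>{K. compact K \<and> K \<subseteq> A}. tv K) + ennreal e"
        using K(3) by (meson add_right_mono order_trans)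
    qed
  qed
qed

lemma borel_measurable_bcontfun: "apply_bcontfun f \<in> borel_measurable borel"
  for f :: "'a \<Rightarrow>\<^sub>C complex"
  by (intro borel_measurable_continuous_onI continuous_on_apply_bcontfun)

lemma integrable_bcontfun: "integrable (M k) (apply_bcontfun f)"
  for f :: "'a \<Rightarrow>\<^sub>C complex"
  using borel_measurable_bcontfun[of f] measurable_cong_sets[OF sets_M refl]
  by (intro finite_measure.integrable_const_bound[OF finite_M, of _ "norm f"]) (auto simp: norm_bounded)

lemma complex_measure_integral_\<mu>: "complex_measure_integral borel \<mu> (apply_bcontfun f) = \<Phi> f"
proof -
  have "(\<lambda>A. Re (\<mu> A)) = (\<lambda>A. measure (M 0) A - measure (M 1) A)"
    "(\<lambda>A. Im (\<mu> A)) = (\<lambda>A. measure (M 2) A - measure (M 3) A)"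
    by (auto simp: \<mu>_def)
  moreover have "signed_integral borel (\<lambda>A. measure (M j) A - measure (M k) A) f
      = integral\<^sup>L (M j) f - integral\<^sup>L (M k) f" for j k
    by (rule signed_integral_diff_measure[OF sets_M finite_M sets_M finite_M borel_measurable_bcontfun norm_bounded])
  ultimately show ?thesis by (simp add: complex_measure_integral_def \<Phi>_def)
qed

lemma \<Phi>_add: "\<Phi> (f + g) = \<Phi> f + \<Phi> g"
  unfolding \<Phi>_def plus_bcontfun.rep_eq by (simp add: integrable_bcontfun algebra_simps)

lemma \<Phi>_diff: "\<Phi> (f - g) = \<Phi> f - \<Phi> g"
  unfolding \<Phi>_def minus_bcontfun.rep_eq by (simp add: integrable_bcontfun algebra_simps)

lemma \<Phi>_cscale: "\<Phi> (cscale c f) = c * \<Phi> f"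
proof -
  have "apply_bcontfun (cscale c f) = (\<lambda>x. c * f x)" by auto
  then show ?thesis by (simp add: \<Phi>_def algebra_simps)
qed

lemma norm_\<Phi>_le:
  fixes r :: "'a \<Rightarrow>\<^sub>C complex"
  assumes "compact K" "\<And>x. x \<in> K \<Longrightarrow> r x = 0" "\<And>x. norm (r x) \<le> c"
  shows "norm (\<Phi> r) \<le> c * \<sigma> (- K)"
proof -
  have cl: "closed K" using assms(1) by (rule compact_imp_closed)
  have "norm (integral\<^sup>L (M k) r) \<le> c * measure (M k) (- K)" for k
  proof -
    interpret finite_measure "M k" by (rule finite_M)
    have K: "- K \<in> sets (M k)" using cl by (simp add: sets_M)
    have "norm (integral\<^sup>L (M k) r) \<le> (\<integral>x. norm (r x) \<partial>M k)" by (rule integral_norm_bound)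
    also have "\<dots> \<le> (\<integral>x. c * indicator (- K) x \<partial>M k)"
      using assms(2,3) K
      by (intro integral_mono integrable_norm integrable_bcontfun integrable_mult_right integrable_real_indicator)
         (auto simp: indicator_def emeasure_eq_measure)
    also have "\<dots> = c * measure (M k) (- K)" using K by (simp add: space_M)
    finally show ?thesis .
  qed
  then have "(\<Sum>k<4. norm (integral\<^sup>L (M k) r)) \<le> c * \<sigma> (- K)"
    unfolding \<sigma>_def sum_distrib_left by (intro sum_mono)
  then show ?thesis
    using norm_combination_le[of "integral\<^sup>L (M 0) r" "integral\<^sup>L (M 1) r" "integral\<^sup>L (M 2) r" "integral\<^sup>L (M 3) r"]
    unfolding \<Phi>_def sum_4 by linarith
qed

end

section \<open>Agreement of the functional with a measure\<close>

definition complexify :: "('a::topological_space \<Rightarrow> real) \<Rightarrow> 'a \<Rightarrow>\<^sub>C complex"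
  where "complexify f = Bcontfun (\<lambda>x. of_real (f x))"

lemma complexify:
  fixes f :: "'a::{topological_group_add, t2_space} \<Rightarrow> real"
  assumes "f \<in> Cc_nonneg"
  shows "complexify f x = of_real (f x)" and "complexify f \<in> LUC"
proof -
  obtain K where K: "compact K" "\<And>x. x \<notin> K \<Longrightarrow> f x = 0" using Cc_nonnegD(3)[OF assms] by blast
  obtain c where c: "\<And>x. f x \<le> c" using Cc_nonneg_bounded[OF assms] by blast
  have uc: "left_uc (\<lambda>x. complex_of_real (f x))"
    by (rule left_uc_compact_support[OF _ K(1)])
       (auto intro!: continuous_intros Cc_nonnegD(1)[OF assms] simp: K(2))
  have b: "norm (complex_of_real (f x)) \<le> c" for x
    using c[of x] Cc_nonnegD(2)[OF assms, of x] by simp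
  show "complexify f x = of_real (f x)" "complexify f \<in> LUC"
    unfolding complexify_def using Bcontfun_in_LUC[OF uc b] by simp_all
qed

lemma complexify_add:
  fixes f g :: "'a::{topological_group_add, t2_space} \<Rightarrow> real"
  assumes "f \<in> Cc_nonneg" "g \<in> Cc_nonneg"
  shows "complexify (\<lambda>x. f x + g x) = complexify f + complexify g"
  by (rule bcontfun_eqI) (simp add: complexify assms Cc_nonneg_add)

lemma functional_on_Cc_radon:
  fixes m :: "('a::{topological_group_add, t2_space} \<Rightarrow>\<^sub>C complex) \<Rightarrow> complex"
  assumes lc: "locally_compact_space (euclidean :: 'a topology)" and m: "m \<in> LUC_dual"
  obtains M where "radon_quadruple M"
    "\<And>f. f \<in> Cc_nonneg \<Longrightarrow> m (complexify f) = radon_quadruple.\<Phi> M (complexify f)"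
proof -
  obtain C where C: "C \<ge> 0" "\<And>f. f \<in> LUC \<Longrightarrow> norm (m f) \<le> C * norm f"
    using LUC_dual_bound[OF m] by blast
  have bound: "norm (m (complexify f)) \<le> C * c" if f: "f \<in> Cc_nonneg" and c: "\<And>x. f x \<le> c" for f c
  proof -
    have "norm (complexify f) \<le> c"
      using c Cc_nonnegD(2)[OF f] by (intro norm_bound) (simp add: complexify f)
    then show ?thesis
      using C(2)[OF complexify(2)[OF f]] mult_left_mono[OF _ C(1)] order_trans by blast
  qed
  have add: "m (complexify (\<lambda>x. f x + g x)) = m (complexify f) + m (complexify g)"
    if "f \<in> Cc_nonneg" "g \<in> Cc_nonneg" for f g
    using that by (simp add: complexify_add LUC_dual_add[OF m] complexify)
  obtain M0 M1 where M01: "radon_measure M0" "radon_measure M1"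
    "\<And>f. f \<in> Cc_nonneg \<Longrightarrow> Re (m (complexify f)) = integral\<^sup>L M0 f - integral\<^sup>L M1 f"
  proof (rule bounded_functional_radon[OF lc, of "\<lambda>f. Re (m (complexify f))" C])
    show "\<bar>Re (m (complexify f))\<bar> \<le> C * c" if "f \<in> Cc_nonneg" "\<And>x. f x \<le> c" for f c
      using bound[OF that] abs_Re_le_cmod order_trans by blast
  qed (simp_all add: add)
  obtain M2 M3 where M23: "radon_measure M2" "radon_measure M3"
    "\<And>f. f \<in> Cc_nonneg \<Longrightarrow> Im (m (complexify f)) = integral\<^sup>L M2 f - integral\<^sup>L M3 f"
  proof (rule bounded_functional_radon[OF lc, of "\<lambda>f. Im (m (complexify f))" C])
    show "\<bar>Im (m (complexify f))\<bar> \<le> C * c" if "f \<in> Cc_nonneg" "\<And>x. f x \<le> c" for f c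
      using bound[OF that] abs_Im_le_cmod order_trans by blast
  qed (simp_all add: add)
  \<comment> \<open>Repeating \<open>M3\<close> for all larger \<open>k\<close> makes every entry a
    Radon measure, as the locale demands.\<close>
  define M where "M k = (if k = 0 then M0 else if k = 1 then M1 else if k = 2 then M2 else M3)" for k :: nat
  have "radon_quadruple M"
    by unfold_locales (simp add: M_def M01 M23)
  then interpret radon_quadruple M .
  show thesis
  proof (rule that)
    fix f :: "'a \<Rightarrow> real" assume f: "f \<in> Cc_nonneg"
    have "apply_bcontfun (complexify f) = (\<lambda>x. of_real (f x))" using complexify(1)[OF f] by auto
    then have "\<Phi> (complexify f) = of_real (integral\<^sup>L M0 f - integral\<^sup>L M1 f)
        + \<i> * of_real (integral\<^sup>L M2 f - integral\<^sup>L M3 f)"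
      by (simp add: \<Phi>_def M_def)
    also have "\<dots> = m (complexify f)"
      by (rule complex_eqI) (simp_all add: M01(3)[OF f] M23(3)[OF f])
    finally show "m (complexify f) = \<Phi> (complexify f)" by simp
  qed fact
qed

lemma functional_eq_on_compact_support:
  fixes m :: "('a::{topological_group_add, t2_space} \<Rightarrow>\<^sub>C complex) \<Rightarrow> complex"
    and p :: "'a \<Rightarrow>\<^sub>C complex"
  assumes m: "m \<in> LUC_dual" and M: "radon_quadruple M"
    and eq: "\<And>f. f \<in> Cc_nonneg \<Longrightarrow> m (complexify f) = radon_quadruple.\<Phi> M (complexify f)"
    and K: "compact K" and p: "\<And>x. x \<notin> K \<Longrightarrow> p x = 0"
  shows "m p = radon_quadruple.\<Phi> M p"
proof -
  interpret radon_quadruple M by fact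
  have cont: "continuous_on UNIV (apply_bcontfun p)" by (rule continuous_on_apply_bcontfun)
  have C: "(\<lambda>x. max 0 (Re (p x))) \<in> Cc_nonneg" "(\<lambda>x. max 0 (- Re (p x))) \<in> Cc_nonneg"
    "(\<lambda>x. max 0 (Im (p x))) \<in> Cc_nonneg" "(\<lambda>x. max 0 (- Im (p x))) \<in> Cc_nonneg"
    by (rule Cc_nonnegI[OF _ _ K]; use p in \<open>auto intro!: continuous_intros cont\<close>)+
  define q1 q2 q3 q4 where "q1 = complexify (\<lambda>x. max 0 (Re (p x)))"
    and "q2 = complexify (\<lambda>x. max 0 (- Re (p x)))"
    and "q3 = complexify (\<lambda>x. max 0 (Im (p x)))"
    and "q4 = complexify (\<lambda>x. max 0 (- Im (p x)))"
  note q = q1_def q2_def q3_def q4_def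
  have L: "q1 \<in> LUC" "q2 \<in> LUC" "q3 \<in> LUC" "q4 \<in> LUC"
    unfolding q by (intro complexify C)+
  have mq: "m q1 = \<Phi> q1" "m q2 = \<Phi> q2" "m q3 = \<Phi> q3" "m q4 = \<Phi> q4"
    unfolding q by (intro eq C)+
  have "q1 x = of_real (max 0 (Re (p x)))" "q2 x = of_real (max 0 (- Re (p x)))"
    "q3 x = of_real (max 0 (Im (p x)))" "q4 x = of_real (max 0 (- Im (p x)))" for x
    unfolding q by (rule C[THEN complexify(1)])+
  then have p_eq: "p = (q1 - q2) + cscale \<i> (q3 - q4)"
    by (intro bcontfun_eqI complex_eqI) (simp_all add: max_def)
  have L': "q1 - q2 \<in> LUC" "q3 - q4 \<in> LUC" "cscale \<i> (q3 - q4) \<in> LUC"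
    using L by (auto intro!: LUC_dual_diff(1)[OF m] LUC_cscale)
  have "m p = (m q1 - m q2) + \<i> * (m q3 - m q4)"
    unfolding p_eq using L L' by (simp add: LUC_dual_add[OF m] LUC_dual_cscale[OF m] LUC_dual_diff(2)[OF m])
  also have "\<dots> = \<Phi> p"
    unfolding p_eq mq by (simp add: \<Phi>_add \<Phi>_diff \<Phi>_cscale)
  finally show ?thesis .
qed

theorem mainTheorem2:
  fixes m :: "('a::{topological_group_add, t2_space} \<Rightarrow>\<^sub>C complex) \<Rightarrow> complex"
  assumes "locally_compact_space (euclidean :: 'a topology)"
    and "m \<in> LUC_dual"
    and "continuous_map (subtopology weak_star (weak_star closure_of (range point_eval)))
           weak_star (\<lambda>n. dual_mult m n)"
  shows "m \<in> M_G"
proof -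
  obtain M where M: "radon_quadruple M"
    "\<And>f. f \<in> Cc_nonneg \<Longrightarrow> m (complexify f) = radon_quadruple.\<Phi> M (complexify f)"
    using functional_on_Cc_radon[OF assms(1,2)] by blast
  interpret radon_quadruple M by (rule M(1))
  have "m f = \<Phi> f" if f: "f \<in> LUC" for f
  proof (rule ccontr)
    assume "m f \<noteq> \<Phi> f"
    \<comment> \<open>The discrepancy will be bounded by \<open>e + norm f * e\<close>; this choice
      makes that sum half of the discrepancy.\<close>
    define e where "e = norm (m f - \<Phi> f) / 2 / (1 + norm f)"
    have pos: "1 + norm f > 0" by (simp add: add_pos_nonneg)
    have "e > 0" using \<open>m f \<noteq> \<Phi> f\<close> pos by (simp add: e_def)
    have "UNIV \<in> sets (borel :: 'a measure)" by simp
    \<comment> \<open>Regularity applied to the whole group forces \<open>U = UNIV\<close> and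
      leaves a compact \<open>K\<close> whose complement has \<open>\<sigma>\<close> below
      \<open>e\<close>.\<close>
    then obtain K U where K: "compact K" "open U" "K \<subseteq> UNIV" "UNIV \<subseteq> U" "\<sigma> (U - K) < e"
      by (rule \<sigma>_approx[OF _ \<open>e > 0\<close>])
    then have \<sigma>K: "\<sigma> (- K) < e" by (simp add: top.extremum_unique Compl_eq_Diff_UNIV)
    obtain u :: "'a \<Rightarrow> real" and K' r where u: "continuous_on UNIV u" "\<And>x. 0 \<le> u x" "\<And>x. u x \<le> 1"
      "compact K'" "\<And>x. x \<notin> K' \<Longrightarrow> u x = 0" "\<And>x. x \<in> K \<Longrightarrow> u x = 1"
      "r \<in> LUC" "\<And>x. r x = f x * of_real (1 - u x)" "norm (m r) < e"
      by (rule functional_tight[OF assms f K(1) \<open>e > 0\<close>]) blast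
    \<comment> \<open>\<open>f - r\<close> is \<open>f * u\<close>, which has compact support. The
      discrepancy between \<open>m\<close> and \<open>\<Phi>\<close> at \<open>f\<close> is thus the
      one at \<open>r\<close>, where \<open>m\<close> is small by tightness and
      \<open>\<Phi>\<close> because \<open>r\<close> vanishes on \<open>K\<close>.\<close>
    have "m (f - r) = \<Phi> (f - r)"
    proof (rule functional_eq_on_compact_support[OF assms(2) M u(4)])
      fix x assume "x \<notin> K'"
      then have "u x = 0" by (rule u(5))
      then show "(f - r) x = 0" by (simp add: u(8))
    qed
    then have eq: "m f - \<Phi> f = m r - \<Phi> r"
      using LUC_dual_diff(2)[OF assms(2) f u(7)] by (simp add: \<Phi>_diff algebra_simps)
    have "norm (r x) \<le> norm f" for x
    proof -
      have "norm (r x) = norm (f x) * (1 - u x)"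
        using u(3)[of x] by (simp add: u(8) norm_mult del: of_real_diff)
      also have "\<dots> \<le> norm (f x) * 1" using u(2)[of x] by (intro mult_left_mono) auto
      finally show ?thesis using norm_bounded[of f x] by simp
    qed
    then have "norm (\<Phi> r) \<le> norm f * \<sigma> (- K)"
      using u(6,8) by (intro norm_\<Phi>_le K(1)) auto
    also have "\<dots> \<le> norm f * e" using \<sigma>K by (intro mult_left_mono) auto
    finally have "norm (m f - \<Phi> f) < e + norm f * e"
      unfolding eq using norm_triangle_ineq4[of "m r" "\<Phi> r"] u(9) by linarith
    also have "\<dots> = (1 + norm f) * e" by (simp add: distrib_right)
    also have "\<dots> = norm (m f - \<Phi> f) / 2"
      unfolding e_def times_divide_eq_right[of "1 + norm f" "norm (m f - \<Phi> f) / 2"]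
      using pos by (intro nonzero_mult_div_cancel_left) simp
    finally show False using norm_ge_zero[of "m f - \<Phi> f"] by linarith
  qed
  then have "measure_functional \<mu> = m"
    using assms(2)
    by (auto simp: fun_eq_iff measure_functional_def complex_measure_integral_\<mu> restrict_def LUC_dual_def
        extensional_def)
  then show ?thesis
    using regular_complex_borel_measure_\<mu> by (auto simp: M_G_def)
qed

end
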